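(* Let $m,n\ge1$ be integers and let $1\le\alpha\le 2(m+n)$ be a fixed natural number. For $1\le j\le 2(m+n)$ let $\psi_{j\alpha}:\mathbf{Sp}(m+n)/\mathbf{Sp}(m)\times\mathbf{Sp}(n)\to\mathbb{C}$ be the function on the quaternionic Grassmannian induced by the $\mathbf{Sp}(m)\times\mathbf{Sp}(n)$-invariant function $$\hat\psi_{j\alpha}:\mathbf{Sp}(m+n)\to\mathbb{C},\qquad \hat\psi_{j\alpha}(q)=\tfrac12\big(q\,\hat I_{m,n}\,\bar q^t+I_{2(m+n)}\big)_{j\alpha}.$$ Then the set $$\mathcal{E}_\alpha=\{\psi_{j\alpha}:\mathbf{Sp}(m+n)/\mathbf{Sp}(m)\times\mathbf{Sp}(n)\to\mathbb{C}\ |\ 1\le j\le 2(m+n),\ j\ne\alpha\}$$ is an eigenfamily on the quaternionic Grassmannian such that the tension field $\tau$ and the conformality operator $\kappa$ satisfy $$\tau(\phi)=-2(m+n)\cdot\phi\quad\text{and}\quad\kappa(\phi,\psi)=-\,\phi\cdot\psi$$ for all $\phi,\psi\in\mathcal{E}_\alpha$.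
   Context: For a Riemannian manifold $(M,g)$, extend $g$ complex-bilinearly to the complexified tangent bundle. For $\phi,\psi:M\to\mathbb{C}$ put $\tau(\phi)=\operatorname{div}(\nabla\phi)$ (tension field, i.e. Laplace-Beltrami operator) and $\kappa(\phi,\psi)=g(\nabla\phi,\nabla\psi)$ (conformality operator). A set $\mathcal{E}$ of functions $M\to\mathbb{C}$ is a $(\lambda,\mu)$-eigenfamily if $\tau(\phi)=\lambda\phi$ and $\kappa(\phi,\psi)=\mu\phi\psi$ for all $\phi,\psi\in\mathcal{E}$. $\mathbf{Sp}(N)$ is the group of all $q\in\mathbf{U}(2N)$ of the form $q=\begin{bmatrix} z & w\\ -\bar w&\bar z\end{bmatrix}$ with $z,w\in\mathbb{C}^{N\times N}$, with the (bi-invariant) Riemannian metric induced by the inner product $\operatorname{Re}\operatorname{trace}(Z\bar W^t)$ on its Lie algebra. Put $I_{m,n}=\begin{bmatrix} I_m&0\\0&-I_n\end{bmatrix}$ and $\hat I_{m,n}=\begin{bmatrix} I_{m,n}&0\\0&I_{m,n}\end{bmatrix}$. The subgroup $\mathbf{Sp}(m)\times\mathbf{Sp}(n)$ of $\mathbf{Sp}(m+n)$ is the fixed-point set of the involutive automorphism $\sigma(q)=\hat I_{m,n}\,q\,\hat I_{m,n}$ (block-diagonal quaternionic matrices). The quotient carries the metric for which the projection from $\mathbf{Sp}(m+n)$ is a Riemannian submersion. *)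

theory Defs
  imports "HOL-Analysis.Analysis"
begin

section \<open>Smooth maps\<close>

text \<open>Only meant for open \<open>S\<close>: \<open>Ck_on k S f\<close> says that \<open>f\<close> is of class $C^k$ on \<open>S\<close>.\<close>

primrec Ck_on :: "nat \<Rightarrow> 'a::euclidean_space set \<Rightarrow> ('a \<Rightarrow> 'b::real_normed_vector) \<Rightarrow> bool" where
  "Ck_on 0 = (\<lambda>S f. continuous_on S f)"
| "Ck_on (Suc k) = (\<lambda>S f. (\<forall>x\<in>S. f differentiable (at x)) \<and>
      (\<forall>v. Ck_on k S (\<lambda>x. frechet_derivative f (at x) v)))"

definition smooth_on :: "'a::euclidean_space set \<Rightarrow> ('a \<Rightarrow> 'b::real_normed_vector) \<Rightarrow> bool" where
  "smooth_on S f \<longleftrightarrow> (\<forall>k. Ck_on k S f)"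

text \<open>Smoothness on an arbitrary subset of Euclidean space (here: on open subsets of an embedded
  submanifold): locally the restriction of a smooth map defined on an open set of the ambient space.\<close>

definition smooth_on_subset :: "'a::euclidean_space set \<Rightarrow> ('a \<Rightarrow> 'b::real_normed_vector) \<Rightarrow> bool" where
  "smooth_on_subset S f \<longleftrightarrow>
     (\<forall>x\<in>S. \<exists>V F. open V \<and> x \<in> V \<and> smooth_on V F \<and> (\<forall>y\<in>S \<inter> V. F y = f y))"

text \<open>Velocities at \<open>x\<close> of curves lying in \<open>S\<close>; for an embedded submanifold \<open>S\<close> this is the tangent
  space of \<open>S\<close> at \<open>x\<close>, as a subspace of the ambient space.\<close>

definition tangent_space_at :: "'a::real_normed_vector set \<Rightarrow> 'a \<Rightarrow> 'a set" where
  "tangent_space_at S x =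
     {v. \<exists>c :: real \<Rightarrow> 'a. range c \<subseteq> S \<and> c 0 = x \<and> (c has_vector_derivative v) (at 0)}"

section \<open>Riemannian manifolds in local coordinates\<close>

type_synonym ('p, 'd) chart = "'p set \<times> ('p \<Rightarrow> real^'d)"

text \<open>A Riemannian manifold is presented by its set of points, its smooth charts \<open>(U, x)\<close> and, for
  each chart \<open>c\<close> and each point \<open>p\<close> in its domain, the Gram matrix $(g_{ij}(p))$ of the metric with
  respect to the coordinate frame of \<open>c\<close>.\<close>

record ('p, 'd) riem_manifold =
  points :: "'p set"
  charts :: "('p, 'd::finite) chart set"
  gram :: "('p, 'd) chart \<Rightarrow> 'p \<Rightarrow> real^'d^'d"

definition in_coords :: "('p, 'd) chart \<Rightarrow> ('p \<Rightarrow> 'b) \<Rightarrow> real^'d::finite \<Rightarrow> 'b" where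
  "in_coords c f = f \<circ> inv_into (fst c) (snd c)"

definition chart_partial ::
    "('p, 'd) chart \<Rightarrow> 'd::finite \<Rightarrow> ('p \<Rightarrow> complex) \<Rightarrow> 'p \<Rightarrow> complex" where
  "chart_partial c i f p = frechet_derivative (in_coords c f) (at (snd c p)) (axis i 1)"

definition smooth_function :: "('p, 'd::finite) riem_manifold \<Rightarrow> ('p \<Rightarrow> complex) \<Rightarrow> bool" where
  "smooth_function M f \<longleftrightarrow> (\<forall>c\<in>charts M. smooth_on (snd c ` fst c) (in_coords c f))"

text \<open>Complexified vector fields are given by their components in the coordinate frame of a chart:
  $(\nabla f)^i = g^{ij} \partial_j f$, $g(X, Y) = g_{ij} X^i Y^j$ (complex bilinear, no conjugation)
  and $\mathrm{div} X = |g|^{-1/2} \partial_i (|g|^{1/2} X^i)$.\<close>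

definition gradient ::
    "('p, 'd::finite) riem_manifold \<Rightarrow> ('p, 'd) chart \<Rightarrow> ('p \<Rightarrow> complex) \<Rightarrow> 'p \<Rightarrow> complex^'d" where
  "gradient M c f p =
     (\<chi> i. \<Sum>j\<in>UNIV. of_real (matrix_inv (gram M c p) $ i $ j) * chart_partial c j f p)"

definition metric_C ::
    "('p, 'd::finite) riem_manifold \<Rightarrow> ('p, 'd) chart \<Rightarrow> 'p \<Rightarrow> complex^'d \<Rightarrow> complex^'d \<Rightarrow> complex" where
  "metric_C M c p X Y = (\<Sum>i\<in>UNIV. \<Sum>j\<in>UNIV. of_real (gram M c p $ i $ j) * X $ i * Y $ j)"

definition divergence ::
    "('p, 'd::finite) riem_manifold \<Rightarrow> ('p, 'd) chart \<Rightarrow> ('p \<Rightarrow> complex^'d) \<Rightarrow> 'p \<Rightarrow> complex" where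
  "divergence M c X p =
     (\<Sum>i\<in>UNIV. chart_partial c i (\<lambda>q. of_real (sqrt (det (gram M c q))) * X q $ i) p)
       / of_real (sqrt (det (gram M c p)))"

text \<open>The operators below do not depend on the chart in which they are computed, so any chart around
  the point may be used.\<close>

definition chart_at :: "('p, 'd::finite) riem_manifold \<Rightarrow> 'p \<Rightarrow> ('p, 'd) chart" where
  "chart_at M p = (SOME c. c \<in> charts M \<and> p \<in> fst c)"

definition tension :: "('p, 'd::finite) riem_manifold \<Rightarrow> ('p \<Rightarrow> complex) \<Rightarrow> 'p \<Rightarrow> complex" where
  "tension M f p = (let c = chart_at M p in divergence M c (gradient M c f) p)"

definition conformality ::
    "('p, 'd::finite) riem_manifold \<Rightarrow> ('p \<Rightarrow> complex) \<Rightarrow> ('p \<Rightarrow> complex) \<Rightarrow> 'p \<Rightarrow> complex" where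
  "conformality M f h p =
     (let c = chart_at M p in metric_C M c p (gradient M c f p) (gradient M c h p))"

definition eigenfamily ::
    "('p, 'd::finite) riem_manifold \<Rightarrow> complex \<Rightarrow> complex \<Rightarrow> ('p \<Rightarrow> complex) set \<Rightarrow> bool" where
  "eigenfamily M lam mu E \<longleftrightarrow>
     (\<forall>f\<in>E. smooth_function M f \<and> (\<forall>p\<in>points M. tension M f p = lam * f p)) \<and>
     (\<forall>f\<in>E. \<forall>h\<in>E. \<forall>p\<in>points M. conformality M f h p = mu * f p * h p)"

section \<open>The quaternionic unitary group\<close>

definition block :: "'a^'k^'k \<Rightarrow> 'a^'l^'k \<Rightarrow> 'a^'k^'l \<Rightarrow> 'a^'l^'l \<Rightarrow> 'a^('k::finite + 'l::finite)^('k + 'l)" where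
  "block A B C D = (\<chi> i j. case i of
      Inl i' \<Rightarrow> (case j of Inl j' \<Rightarrow> A $ i' $ j' | Inr j' \<Rightarrow> B $ i' $ j')
    | Inr i' \<Rightarrow> (case j of Inl j' \<Rightarrow> C $ i' $ j' | Inr j' \<Rightarrow> D $ i' $ j'))"

definition conj_mat :: "complex^'l^'k \<Rightarrow> complex^'l::finite^'k::finite" where
  "conj_mat A = (\<chi> i j. cnj (A $ i $ j))"

definition adj :: "complex^'l^'k \<Rightarrow> complex^'k::finite^'l::finite" where
  "adj A = transpose (conj_mat A)"

definition unitary :: "complex^'k^'k::finite \<Rightarrow> bool" where
  "unitary q \<longleftrightarrow> q ** adj q = mat 1 \<and> adj q ** q = mat 1"

definition Sp :: "(complex^('k::finite + 'k)^('k + 'k)) set" where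
  "Sp = {q. unitary q \<and> (\<exists>z w. q = block z w (- conj_mat w) (conj_mat z))}"

text \<open>Left translate of the inner product $\mathrm{Re}\,\mathrm{trace}(Z \bar W^t)$ on the Lie
  algebra, evaluated on tangent vectors \<open>X\<close>, \<open>Y\<close> of \<open>Sp\<close> at \<open>q\<close>.\<close>

definition Sp_metric ::
    "complex^('k::finite + 'k)^('k + 'k) \<Rightarrow> complex^('k + 'k)^('k + 'k) \<Rightarrow> complex^('k + 'k)^('k + 'k) \<Rightarrow> real" where
  "Sp_metric q X Y = Re (trace ((matrix_inv q ** X) ** adj (matrix_inv q ** Y)))"

section \<open>The quaternionic Grassmannian\<close>

text \<open>The positive integers \<open>m\<close> and \<open>n\<close> are the cardinalities of the index types \<open>'m\<close> and \<open>'n\<close>.\<close>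

type_synonym ('m, 'n) cmat = "complex^(('m + 'n) + ('m + 'n))^(('m + 'n) + ('m + 'n))"

definition I_mn :: "complex^('m::finite + 'n::finite)^('m + 'n)" where
  "I_mn = block (mat 1) 0 0 (- mat 1)"

definition I_hat :: "('m::finite, 'n::finite) cmat" where
  "I_hat = block I_mn 0 0 I_mn"

definition Sp_times_Sp :: "('m::finite, 'n::finite) cmat set" where
  "Sp_times_Sp = {q \<in> Sp. I_hat ** q ** I_hat = q}"

definition coset :: "('m::finite, 'n::finite) cmat \<Rightarrow> ('m, 'n) cmat set" where
  "coset q = (\<lambda>k. q ** k) ` Sp_times_Sp"

text \<open>Derivatives within \<open>Sp\<close> are determined only on vectors tangent to \<open>Sp\<close>; \<open>coset_diff\<close> is the
  differential at \<open>q\<close> of \<open>x \<circ> coset\<close> and is applied to such vectors only.\<close>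

definition coset_diff ::
    "(('m::finite, 'n::finite) cmat set \<Rightarrow> real^'d::finite) \<Rightarrow> ('m, 'n) cmat \<Rightarrow> ('m, 'n) cmat \<Rightarrow> real^'d" where
  "coset_diff x q = frechet_derivative (x \<circ> coset) (at q within Sp)"

text \<open>The smooth structure of the quotient is the one for which the projection is a smooth submersion.
  The real dimension of the quotient is \<open>4 m n\<close>, the number of coordinates, so the smooth charts of
  the quotient are exactly the injective maps with open image, defined on an open set, whose
  composition with the projection is a smooth submersion.\<close>

definition grassmannian_charts :: "(('m::finite, 'n::finite) cmat set, 'm \<times> 'n \<times> 4) chart set" where
  "grassmannian_charts = {(U, x).
     U \<subseteq> coset ` Sp \<and> openin (top_of_set Sp) {q \<in> Sp. coset q \<in> U} \<and>
     inj_on x U \<and> open (x ` U) \<and>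
     smooth_on_subset {q \<in> Sp. coset q \<in> U} (x \<circ> coset) \<and>
     (\<forall>q\<in>Sp. coset q \<in> U \<longrightarrow> coset_diff x q ` tangent_space_at Sp q = UNIV)}"

text \<open>The vertical space at \<open>q\<close> is the tangent space of the fibre \<open>coset q\<close> of the projection.\<close>

definition horizontal_space :: "('m::finite, 'n::finite) cmat \<Rightarrow> ('m, 'n) cmat set" where
  "horizontal_space q =
     {X \<in> tangent_space_at Sp q. \<forall>V\<in>tangent_space_at (coset q) q. Sp_metric q X V = 0}"

definition horizontal_lift ::
    "(('m::finite, 'n::finite) cmat set \<Rightarrow> real^'d::finite) \<Rightarrow> ('m, 'n) cmat \<Rightarrow> real^'d \<Rightarrow> ('m, 'n) cmat" where
  "horizontal_lift x q v = (THE X. X \<in> horizontal_space q \<and> coset_diff x q X = v)"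

text \<open>For the projection to be a Riemannian submersion, the inner product of two tangent vectors of the
  quotient at \<open>p\<close> must be that of their horizontal lifts at \<open>q\<close>, for any \<open>q\<close> over \<open>p\<close>. By right
  invariance of \<open>Sp_metric\<close> it does not matter which element \<open>q\<close> of the coset \<open>p\<close> is used.\<close>

definition grassmannian_gram ::
    "(('m::finite, 'n::finite) cmat set, 'm \<times> 'n \<times> 4) chart \<Rightarrow> ('m, 'n) cmat set \<Rightarrow> real^('m \<times> 'n \<times> 4)^('m \<times> 'n \<times> 4)" where
  "grassmannian_gram c p = (let q = (SOME q. q \<in> p) in
     (\<chi> i j. Sp_metric q (horizontal_lift (snd c) q (axis i 1)) (horizontal_lift (snd c) q (axis j 1))))"

definition quaternionic_grassmannian :: "(('m::finite, 'n::finite) cmat set, 'm \<times> 'n \<times> 4) riem_manifold" where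
  "quaternionic_grassmannian =
     \<lparr>points = coset ` Sp, charts = grassmannian_charts, gram = grassmannian_gram\<rparr>"

type_synonym ('m, 'n) index = "('m + 'n) + ('m + 'n)"

definition psi_hat :: "('m, 'n) index \<Rightarrow> ('m, 'n) index \<Rightarrow> ('m::finite, 'n::finite) cmat \<Rightarrow> complex" where
  "psi_hat j a q = (1/2) * (q ** I_hat ** adj q + mat 1) $ j $ a"

text \<open>\<open>psi_hat\<close> is constant on cosets; \<open>psi\<close> takes this constant value on each of them.\<close>

definition psi :: "('m, 'n) index \<Rightarrow> ('m, 'n) index \<Rightarrow> ('m::finite, 'n::finite) cmat set \<Rightarrow> complex" where
  "psi j a p = the_elem (psi_hat j a ` p)"

end

theory Submission
  imports Defs
begin

text \<open>The map \<open>F = q \<mapsto> q I q\<^sup>*\<close> (with \<open>I\<close> for \<open>I_hat\<close>) embeds the Grassmannian, isometrically up to the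
  factor 4 in the metric, into the Euclidean space of Hermitian matrices commuting with the
  quaternionic structure, and \<open>\<psi>\<close> is a matrix entry of \<open>(F + 1)/2\<close>. The tangent space of the image at \<open>F\<close>
  consists of those matrices that anticommute with \<open>F\<close>; contracting two tangent vectors with the
  inverse metric gives the orthogonal projection onto it, an average over three involutions, whose
  complexified entries are explicit. This yields \<open>\<kappa>\<close> at once. For \<open>\<tau>\<close>, the Laplacian of an isometric
  immersion is normal, so it commutes with \<open>F\<close>; applying it to \<open>F\<^sup>2 = 1\<close> expresses it through the
  contraction of \<open>dF dF\<close>, which is again explicit. In an arbitrary chart \<open>F\<close> is smooth by the inverse function
  theorem, applied to a local section built from the Cayley transform.\<close>

section \<open>Calculus of $C^k$ maps\<close>

text \<open>The condition j \<noteq> \<alpha> is what turns the matrix identities into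
  eigen-equations. With N = 2(m+n), the trace of the identity matrix, the Laplacian of F is trace(F)
  1 - N F, an eigen-equation exactly at the entries where the identity vanishes. In the contraction
  behind \<kappa> the identity term drops for the same reason; the terms produced by the
  quaternionic structure carry a diagonal entry of \<open>J\<close> or of \<open>J ** F\<close>, and
  both matrices are skew-symmetric.

  Two obstacles come from the way the manifold is presented. No atlas is given: a chart is any map
  satisfying the submersion conditions, so smoothness of F in its coordinates has to be extracted
  from those conditions. And the operators are evaluated in a chart chosen by \<open>SOME\<close>,
  so around every point some chart must really be exhibited; otherwise the choice would be
  arbitrary. Affine coordinates on the Grassmannian supply one, and the openness of their image is
  the delicate condition.\<close>

lemma Ck_on_SucI:
  assumes "\<And>x. x \<in> S \<Longrightarrow> (f has_derivative f' x) (at x)"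
    and "\<And>v. Ck_on k S (\<lambda>x. frechet_derivative f (at x) v)"
  shows "Ck_on (Suc k) S f"
  using assms by (auto simp: differentiable_def)

lemma Ck_on_differentiable:
  "Ck_on (Suc k) S f \<Longrightarrow> x \<in> S \<Longrightarrow> (f has_derivative frechet_derivative f (at x)) (at x)"
  by (simp add: frechet_derivative_works)

lemma frechet_derivative_cong:
  assumes "open S" "x \<in> S" "\<And>y. y \<in> S \<Longrightarrow> f y = g y"
  shows "frechet_derivative f (at x) = frechet_derivative g (at x)"
proof -
  have "(f has_derivative D) (at x) \<longleftrightarrow> (g has_derivative D) (at x)" for D
    using has_derivative_transform_within_open[OF _ assms(1,2), of f D UNIV g]
      has_derivative_transform_within_open[OF _ assms(1,2), of g D UNIV f] assms(3) by auto
  then show ?thesis by (simp add: frechet_derivative_def)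
qed

lemma Ck_on_cong:
  assumes "open S" "\<And>x. x \<in> S \<Longrightarrow> f x = g x" "Ck_on k S f"
  shows "Ck_on k S g"
  using assms
proof (induction k arbitrary: f g)
  case 0
  then show ?case using continuous_on_cong[of S S f g] by simp
next
  case (Suc k)
  have "frechet_derivative f (at x) = frechet_derivative g (at x)" if "x \<in> S" for x
    using frechet_derivative_cong[OF Suc.prems(1) that] Suc.prems(2) by blast
  with Suc.IH[OF Suc.prems(1), of "\<lambda>x. frechet_derivative f (at x) _" "\<lambda>x. frechet_derivative g (at x) _"]
  have "Ck_on k S (\<lambda>x. frechet_derivative g (at x) v)" for v
    using Suc.prems(3) by simp
  moreover have "(g has_derivative frechet_derivative f (at x)) (at x)" if "x \<in> S" for x
    using has_derivative_transform_within_open[OF Ck_on_differentiable[OF Suc.prems(3) that] Suc.prems(1) that]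
      Suc.prems(2) by blast
  ultimately show ?case by (intro Ck_on_SucI)
qed

text \<open>The working form of the recursion: on an open set any pointwise derivative may replace
  \<open>frechet_derivative\<close>, so each closure rule below is a product or chain rule followed
  by the induction hypothesis.\<close>

lemma Ck_on_Suc:
  assumes "open S" "\<And>x. x \<in> S \<Longrightarrow> (f has_derivative f' x) (at x)" "\<And>v. Ck_on k S (\<lambda>x. f' x v)"
  shows "Ck_on (Suc k) S f"
proof (rule Ck_on_SucI[OF assms(2)])
  show "Ck_on k S (\<lambda>x. frechet_derivative f (at x) v)" for v
    by (rule Ck_on_cong[OF assms(1) _ assms(3)]) (simp add: frechet_derivative_at[OF assms(2)])
qed

lemma Ck_on_mono:
  "T \<subseteq> S \<Longrightarrow> Ck_on k S f \<Longrightarrow> Ck_on k T f"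
  by (induction k arbitrary: f) (auto intro: continuous_on_subset)

lemma Ck_on_continuous: "Ck_on k S f \<Longrightarrow> continuous_on S f"
  by (cases k) (auto intro: continuous_at_imp_continuous_on differentiable_imp_continuous_within)

lemma Ck_on_Suc_imp: "Ck_on (Suc k) S f \<Longrightarrow> Ck_on k S f"
proof (induction k arbitrary: f)
  case 0 then show ?case using Ck_on_continuous[OF 0] by simp
next
  case (Suc k) then show ?case by (simp only: Ck_on.simps(2)) blast
qed

lemma Ck_on_local:
  assumes "\<And>x. x \<in> S \<Longrightarrow> \<exists>T. open T \<and> x \<in> T \<and> Ck_on k T f"
  shows "Ck_on k S f"
  using assms
proof (induction k arbitrary: f)
  case 0
  have "isCont f x" if x: "x \<in> S" for x
  proof -
    obtain T where "open T" "x \<in> T" "continuous_on T f" using 0[OF x] by auto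
    then show ?thesis by (simp add: continuous_on_eq_continuous_at)
  qed
  then show ?case by (simp add: continuous_at_imp_continuous_on)
next
  case (Suc k)
  have "Ck_on k S (\<lambda>x. frechet_derivative f (at x) v)" for v
  proof (rule Suc.IH)
    fix x assume "x \<in> S"
    then obtain T where "open T" "x \<in> T" "Ck_on (Suc k) T f" using Suc.prems by blast
    then show "\<exists>T. open T \<and> x \<in> T \<and> Ck_on k T (\<lambda>x. frechet_derivative f (at x) v)" by auto
  qed
  moreover have "f differentiable (at x)" if "x \<in> S" for x
    using Suc.prems[OF that] by auto
  ultimately show ?case by simp
qed

lemma Ck_on_bounded_linear:
  assumes "bounded_linear h" "open S" "Ck_on k S f"
  shows "Ck_on k S (\<lambda>x. h (f x))"
  using assms(3)
proof (induction k arbitrary: f)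
  case 0
  then show ?case using assms(1) bounded_linear.continuous_on by auto
next
  case (Suc k)
  show ?case
  proof (rule Ck_on_Suc[OF assms(2)])
    show "((\<lambda>x. h (f x)) has_derivative (\<lambda>v. h (frechet_derivative f (at x) v))) (at x)" if "x \<in> S" for x
      by (rule bounded_linear.has_derivative[OF assms(1) Ck_on_differentiable[OF Suc.prems that]])
    show "Ck_on k S (\<lambda>x. h (frechet_derivative f (at x) v))" for v
      using Suc.IH Suc.prems by simp
  qed
qed

lemma Ck_on_add:
  assumes "open S" "Ck_on k S f" "Ck_on k S g"
  shows "Ck_on k S (\<lambda>x. f x + g x)"
  using assms(2,3)
proof (induction k arbitrary: f g)
  case 0 then show ?case by (auto intro: continuous_intros)
next
  case (Suc k)
  show ?case
  proof (rule Ck_on_Suc[OF assms(1)])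
    show "((\<lambda>x. f x + g x) has_derivative
        (\<lambda>v. frechet_derivative f (at x) v + frechet_derivative g (at x) v)) (at x)" if "x \<in> S" for x
      by (rule has_derivative_add[OF Ck_on_differentiable[OF Suc.prems(1) that] Ck_on_differentiable[OF Suc.prems(2) that]])
  qed (use Suc in simp)
qed

lemma Ck_on_const: "Ck_on k S (\<lambda>x. c)"
  by (induction k arbitrary: c) auto

lemma Ck_on_bounded_linear_id:
  assumes "bounded_linear h" "open S" shows "Ck_on k S h"
proof (cases k)
  case 0 then show ?thesis using assms(1) by (simp add: linear_continuous_on)
next
  case (Suc l)
  then show ?thesis
    using Ck_on_Suc[OF assms(2), of h "\<lambda>_. h"] Ck_on_const assms(1) bounded_linear_imp_has_derivative by blast
qed

lemma Ck_on_sum: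
  assumes "open S" "\<And>i. i \<in> I \<Longrightarrow> Ck_on k S (f i)"
  shows "Ck_on k S (\<lambda>x. \<Sum>i\<in>I. f i x)"
  using assms(2)
proof (induction I rule: infinite_finite_induct)
  case (insert i I)
  then show ?case using Ck_on_add[OF assms(1), of k "f i" "\<lambda>x. \<Sum>i\<in>I. f i x"] by simp
qed (simp_all add: Ck_on_const)

lemma Ck_on_bilinear:
  assumes "bounded_bilinear h" "open S" "Ck_on k S f" "Ck_on k S g"
  shows "Ck_on k S (\<lambda>x. h (f x) (g x))"
  using assms(3,4)
proof (induction k arbitrary: f g)
  case 0 then show ?case using bounded_bilinear.continuous_on[OF assms(1)] by auto
next
  case (Suc k)
  show ?case
  proof (rule Ck_on_Suc[OF assms(2)])
    show "((\<lambda>x. h (f x) (g x)) has_derivative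
        (\<lambda>v. h (f x) (frechet_derivative g (at x) v) + h (frechet_derivative f (at x) v) (g x))) (at x)"
      if "x \<in> S" for x
      by (rule bounded_bilinear.FDERIV[OF assms(1) Ck_on_differentiable[OF Suc.prems(1) that]
          Ck_on_differentiable[OF Suc.prems(2) that]])
    show "Ck_on k S (\<lambda>x. h (f x) (frechet_derivative g (at x) v) + h (frechet_derivative f (at x) v) (g x))" for v
      using Suc.prems Suc.IH[of f "\<lambda>x. frechet_derivative g (at x) v"]
        Suc.IH[of "\<lambda>x. frechet_derivative f (at x) v" g]
        Ck_on_Suc_imp[OF Suc.prems(1)] Ck_on_Suc_imp[OF Suc.prems(2)]
      by (auto intro!: Ck_on_add assms(2))
  qed
qed

lemma Ck_on_compose:
  fixes f :: "'b::euclidean_space \<Rightarrow> 'c::real_normed_vector"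
  assumes "open S" "open T" "g ` S \<subseteq> T" "Ck_on k T f" "Ck_on k S g"
  shows "Ck_on k S (\<lambda>x. f (g x))"
  using assms(4,5)
proof (induction k arbitrary: f)
  case 0
  then show ?case using assms(3) by (auto intro: continuous_on_compose2)
next
  case (Suc k)
  show ?case
  proof (rule Ck_on_Suc[OF assms(1)])
    fix x assume x: "x \<in> S"
    let ?F = "frechet_derivative f (at (g x))" and ?G = "frechet_derivative g (at x)"
    have F: "(f has_derivative ?F) (at (g x))"
      using Ck_on_differentiable[OF Suc.prems(1)] x assms(3) by blast
    \<comment> \<open>\<open>Ck_on\<close> controls a derivative only in a fixed direction, while
      the chain rule applies \<open>?F\<close> to a direction varying with the point. Expanding that
      direction in \<open>Basis\<close> leaves a sum of products of functions of class
      \<open>k\<close>.\<close>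
    have "?F w = (\<Sum>b\<in>Basis. (w \<bullet> b) *\<^sub>R ?F b)" for w
    proof -
      have "?F w = ?F (\<Sum>b\<in>Basis. (w \<bullet> b) *\<^sub>R b)" by (simp add: euclidean_representation)
      also have "\<dots> = (\<Sum>b\<in>Basis. (w \<bullet> b) *\<^sub>R ?F b)"
        using has_derivative_linear[OF F] by (simp add: linear_sum linear_cmul)
      finally show ?thesis .
    qed
    then have eq: "(\<lambda>v. \<Sum>b\<in>Basis. (?G v \<bullet> b) *\<^sub>R ?F b) = (\<lambda>v. ?F (?G v))" by metis
    show "((\<lambda>x. f (g x)) has_derivative (\<lambda>v. \<Sum>b\<in>Basis. (?G v \<bullet> b) *\<^sub>R ?F b)) (at x)"
      unfolding eq using has_derivative_compose[OF Ck_on_differentiable[OF Suc.prems(2) x] F] .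
  next
    have g: "Ck_on k S g" using Ck_on_Suc_imp[OF Suc.prems(2)] .
    have "Ck_on k S (\<lambda>x. frechet_derivative f (at (g x)) b)" for b
      using Suc.IH[OF _ g] Suc.prems(1) by auto
    moreover have "Ck_on k S (\<lambda>x. frechet_derivative g (at x) v \<bullet> b)" for v b
      using Ck_on_bounded_linear[OF bounded_linear_inner_left[of b] assms(1), of k "\<lambda>x. frechet_derivative g (at x) v"]
        Suc.prems(2) by simp
    ultimately show "Ck_on k S (\<lambda>x. \<Sum>b\<in>Basis. (frechet_derivative g (at x) v \<bullet> b) *\<^sub>R frechet_derivative f (at (g x)) b)" for v
      by (intro Ck_on_sum Ck_on_bilinear[OF bounded_bilinear_scaleR] assms(1))
  qed
qed

lemma bounded_linear_axis: "bounded_linear (\<lambda>x. axis i x :: 'b::real_normed_vector ^ 'n::finite)"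
proof (rule bounded_linear_intro[where K=1])
  fix x :: 'b
  show "norm (axis i x) \<le> norm x * 1"
    by (simp add: norm_vec_def L2_set_def axis_def if_distrib[where f=norm] if_distrib[where f="\<lambda>x. x\<^sup>2"] cong: if_cong)
qed (auto simp: axis_def vec_eq_iff)

lemma Ck_on_vec:
  fixes f :: "'a::euclidean_space \<Rightarrow> 'b::real_normed_vector ^ 'n::finite"
  assumes "open S" "\<And>i. Ck_on k S (\<lambda>x. f x $ i)"
  shows "Ck_on k S f"
proof -
  have eq: "(\<lambda>x. \<Sum>i\<in>UNIV. axis i (f x $ i)) = f"
    by (auto simp: fun_eq_iff vec_eq_iff axis_def)
  have "Ck_on k S (\<lambda>x. \<Sum>i\<in>UNIV. axis i (f x $ i))"
    by (rule Ck_on_sum[OF assms(1) Ck_on_bounded_linear[OF bounded_linear_axis assms]])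
  then show ?thesis unfolding eq .
qed

section \<open>Symmetry of second derivatives\<close>

text \<open>The mean value theorem is used along \<open>u\<close> for the difference in
  \<open>v\<close>, and then along \<open>v\<close> for the derivative in \<open>u\<close>. The
  second difference is symmetric in \<open>u\<close> and \<open>v\<close>, but the derivative
  obtained has a definite order; this tension gives the symmetry below.\<close>

lemma second_difference_mvt:
  fixes f :: "'a::real_normed_vector \<Rightarrow> real"
  assumes t: "t > 0"
    and in_S: "\<And>a b. 0 \<le> a \<Longrightarrow> a \<le> t \<Longrightarrow> 0 \<le> b \<Longrightarrow> b \<le> t \<Longrightarrow> y + a *\<^sub>R u + b *\<^sub>R v \<in> S"
    and D1: "\<And>x. x \<in> S \<Longrightarrow> (f has_derivative D x) (at x)"
    and D2: "\<And>x. x \<in> S \<Longrightarrow> ((\<lambda>z. D z u) has_derivative D2 x) (at x)"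
  shows "\<exists>a b. 0 \<le> a \<and> a \<le> t \<and> 0 \<le> b \<and> b \<le> t \<and>
    f (y + t *\<^sub>R u + t *\<^sub>R v) - f (y + t *\<^sub>R u) - f (y + t *\<^sub>R v) + f y = t * (t * D2 (y + a *\<^sub>R u + b *\<^sub>R v) v)"
proof -
  define \<phi> where "\<phi> s = f (y + s *\<^sub>R u + t *\<^sub>R v) - f (y + s *\<^sub>R u)" for s
  have curve_u: "((\<lambda>s. f (y + s *\<^sub>R u + b *\<^sub>R v)) has_real_derivative D (y + s *\<^sub>R u + b *\<^sub>R v) u) (at s)"
    if "0 \<le> s" "s \<le> t" "0 \<le> b" "b \<le> t" for s b
  proof -
    have "((\<lambda>s. f (y + s *\<^sub>R u + b *\<^sub>R v)) has_derivative (\<lambda>h. D (y + s *\<^sub>R u + b *\<^sub>R v) (h *\<^sub>R u))) (at s)"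
      by (rule has_derivative_compose[where f="\<lambda>s. y + s *\<^sub>R u + b *\<^sub>R v", OF _ D1[OF in_S[OF that]]]) (auto intro!: derivative_eq_intros)
    then show ?thesis
      using has_derivative_linear[OF D1[OF in_S[OF that]]]
      by (simp add: has_field_derivative_def linear_cmul mult_commute_abs)
  qed
  have "((\<lambda>s. \<phi> s) has_real_derivative D (y + s *\<^sub>R u + t *\<^sub>R v) u - D (y + s *\<^sub>R u) u) (at s)"
    if "0 \<le> s" "s \<le> t" for s
    unfolding \<phi>_def using DERIV_diff[OF curve_u[OF that, of t] curve_u[OF that, of 0]] t by simp
  from MVT2[OF t, of \<phi>, OF this]
  obtain a where a: "0 < a" "a < t" "\<phi> t - \<phi> 0 = t * (D (y + a *\<^sub>R u + t *\<^sub>R v) u - D (y + a *\<^sub>R u) u)"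
    by auto
  have "((\<lambda>b. D (y + a *\<^sub>R u + b *\<^sub>R v) u) has_real_derivative D2 (y + a *\<^sub>R u + b *\<^sub>R v) v) (at b)"
    if "0 \<le> b" "b \<le> t" for b
  proof -
    have S: "y + a *\<^sub>R u + b *\<^sub>R v \<in> S" using in_S that a by simp
    have "((\<lambda>b. D (y + a *\<^sub>R u + b *\<^sub>R v) u) has_derivative (\<lambda>h. D2 (y + a *\<^sub>R u + b *\<^sub>R v) (h *\<^sub>R v))) (at b)"
      by (rule has_derivative_compose[where f="\<lambda>b. y + a *\<^sub>R u + b *\<^sub>R v", OF _ D2[OF S]]) (auto intro!: derivative_eq_intros)
    then show ?thesis
      using has_derivative_linear[OF D2[OF S]]
      by (simp add: has_field_derivative_def linear_cmul mult_commute_abs)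
  qed
  from MVT2[OF t, of "\<lambda>b. D (y + a *\<^sub>R u + b *\<^sub>R v) u", OF this]
  obtain b where "0 < b" "b < t"
    "D (y + a *\<^sub>R u + t *\<^sub>R v) u - D (y + a *\<^sub>R u) u = t * D2 (y + a *\<^sub>R u + b *\<^sub>R v) v"
    by auto
  with a show ?thesis
    by (intro exI[of _ a] exI[of _ b]) (simp add: \<phi>_def)
qed

lemma second_derivative_symmetric_real:
  fixes f :: "'a::real_normed_vector \<Rightarrow> real"
  assumes "open S" "y \<in> S"
    and D: "\<And>x. x \<in> S \<Longrightarrow> (f has_derivative D x) (at x)"
    and U: "\<And>x. x \<in> S \<Longrightarrow> ((\<lambda>z. D z u) has_derivative DU x) (at x)"
    and V: "\<And>x. x \<in> S \<Longrightarrow> ((\<lambda>z. D z v) has_derivative DV x) (at x)"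
    and cU: "isCont (\<lambda>x. DU x v) y" and cV: "isCont (\<lambda>x. DV x u) y"
  shows "DU y v = DV y u"
proof (rule ccontr)
  assume ne: "DU y v \<noteq> DV y u"
  define e where "e = \<bar>DU y v - DV y u\<bar> / 2"
  have e: "e > 0" using ne by (simp add: e_def)
  obtain d0 where d0: "d0 > 0" "ball y d0 \<subseteq> S" using assms(1,2) open_contains_ball by blast
  obtain d1 where d1: "d1 > 0" "\<And>x. dist x y < d1 \<Longrightarrow> dist (DU x v) (DU y v) < e"
    using cU e unfolding continuous_at_eps_delta by blast
  obtain d2 where d2: "d2 > 0" "\<And>x. dist x y < d2 \<Longrightarrow> dist (DV x u) (DV y u) < e"
    using cV e unfolding continuous_at_eps_delta by blast
  define r where "r = min d0 (min d1 d2)"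
  \<comment> \<open>Chosen so that the whole parallelogram stays within distance
    \<open>r / 2\<close> of \<open>y\<close>; the summand 1 keeps the denominator positive when
    \<open>u\<close> and \<open>v\<close> are zero.\<close>
  define t where "t = r / (2 * (norm u + norm v + 1))"
  have r: "r > 0" "r \<le> d0" "r \<le> d1" "r \<le> d2" using d0 d1 d2 by (auto simp: r_def)
  have nn: "norm u + norm v + 1 > 0" by (metis add_nonneg_pos norm_ge_zero add_nonneg_nonneg zero_less_one)
  have t: "t > 0" using r nn by (simp add: t_def)
  have tN: "t * N = r / 2" if "N = norm u + norm v + 1" for N
    using nn unfolding t_def that[symmetric] by (simp add: that[symmetric])
  have small: "dist (y + a *\<^sub>R p + b *\<^sub>R q) y < r"
    if ab: "0 \<le> a" "a \<le> t" "0 \<le> b" "b \<le> t" and pq: "norm p + norm q = norm u + norm v" for a b p q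
  proof -
    have "dist (y + a *\<^sub>R p + b *\<^sub>R q) y = norm (a *\<^sub>R p + b *\<^sub>R q)"
      by (simp add: dist_norm algebra_simps)
    also have "\<dots> \<le> a * norm p + b * norm q" using norm_triangle_ineq[of "a *\<^sub>R p" "b *\<^sub>R q"] ab by simp
    also have "\<dots> \<le> t * norm p + t * norm q" using ab by (intro add_mono mult_right_mono) auto
    also have "\<dots> = t * (norm u + norm v)" using pq by (metis distrib_left)
    also have "\<dots> \<le> t * (norm u + norm v + 1)" using t by (intro mult_left_mono) auto
    also have "\<dots> = r / 2" by (rule tN) simp
    finally show ?thesis using r by simp
  qed
  have "y + a *\<^sub>R u + b *\<^sub>R v \<in> S" if "0 \<le> a" "a \<le> t" "0 \<le> b" "b \<le> t" for a b
    using small[OF that, of u v] r d0 by (force simp: dist_commute)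
  from second_difference_mvt[OF t this D U]
  obtain a b where ab: "0 \<le> a" "a \<le> t" "0 \<le> b" "b \<le> t"
    "f (y + t *\<^sub>R u + t *\<^sub>R v) - f (y + t *\<^sub>R u) - f (y + t *\<^sub>R v) + f y = t * (t * DU (y + a *\<^sub>R u + b *\<^sub>R v) v)"
    by blast
  have "y + a *\<^sub>R v + b *\<^sub>R u \<in> S" if "0 \<le> a" "a \<le> t" "0 \<le> b" "b \<le> t" for a b
    using small[OF that, of v u] r d0 by (force simp: dist_commute)
  from second_difference_mvt[OF t this D V]
  obtain a' b' where ab': "0 \<le> a'" "a' \<le> t" "0 \<le> b'" "b' \<le> t"
    "f (y + t *\<^sub>R v + t *\<^sub>R u) - f (y + t *\<^sub>R v) - f (y + t *\<^sub>R u) + f y = t * (t * DV (y + a' *\<^sub>R v + b' *\<^sub>R u) u)"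
    by blast
  have "f (y + t *\<^sub>R v + t *\<^sub>R u) = f (y + t *\<^sub>R u + t *\<^sub>R v)" by (simp add: algebra_simps)
  with ab(5) ab'(5) have "t * (t * DU (y + a *\<^sub>R u + b *\<^sub>R v) v) = t * (t * DV (y + a' *\<^sub>R v + b' *\<^sub>R u) u)"
    by linarith
  with t have "DU (y + a *\<^sub>R u + b *\<^sub>R v) v = DV (y + a' *\<^sub>R v + b' *\<^sub>R u) u" by simp
  moreover have "dist (DU (y + a *\<^sub>R u + b *\<^sub>R v) v) (DU y v) < e"
    using d1(2) small[OF ab(1-4), of u v] r by simp
  moreover have "dist (DV (y + a' *\<^sub>R v + b' *\<^sub>R u) u) (DV y u) < e"
    using d2(2) small[OF ab'(1-4), of v u] r by simp
  moreover have "\<lbrakk>X = Y; \<bar>X - p\<bar> < \<bar>p - q\<bar> / 2; \<bar>Y - q\<bar> < \<bar>p - q\<bar> / 2\<rbrakk> \<Longrightarrow> False" for X Y p q :: real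
    by (auto simp: abs_if split: if_splits)
  ultimately show False unfolding e_def dist_real_def by blast
qed

lemma second_derivative_symmetric:
  fixes f :: "'a::euclidean_space \<Rightarrow> 'b::euclidean_space"
  assumes S: "open S" "y \<in> S" and f: "Ck_on 2 S f"
  shows "frechet_derivative (\<lambda>x. frechet_derivative f (at x) u) (at y) v =
    frechet_derivative (\<lambda>x. frechet_derivative f (at x) v) (at y) u"
proof (rule euclidean_eqI)
  fix b :: 'b assume "b \<in> Basis"
  let ?D = "\<lambda>x. frechet_derivative f (at x)"
  let ?D2 = "\<lambda>w x. frechet_derivative (\<lambda>x. ?D x w) (at x)"
  have D: "(f has_derivative ?D x) (at x)" if "x \<in> S" for x
    using f that by (auto simp: numeral_2_eq_2 frechet_derivative_works)
  have D2: "((\<lambda>x. ?D x w) has_derivative ?D2 w x) (at x)" if "x \<in> S" for x w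
    using f that by (auto simp: numeral_2_eq_2 frechet_derivative_works)
  have c: "isCont (\<lambda>x. ?D2 w x z) y" for w z
    using f S by (auto simp: numeral_2_eq_2 continuous_on_eq_continuous_at)
  show "?D2 u y v \<bullet> b = ?D2 v y u \<bullet> b"
    by (rule second_derivative_symmetric_real[OF S, of "\<lambda>x. f x \<bullet> b" "\<lambda>x w. ?D x w \<bullet> b" u
          "\<lambda>x w. ?D2 u x w \<bullet> b" v "\<lambda>x w. ?D2 v x w \<bullet> b"])
      (auto intro!: has_derivative_inner_left D D2 continuous_intros c)
qed

section \<open>Differentiation of matrix products, inverses and determinants\<close>

lemma bounded_bilinear_matrix_mult:
  "bounded_bilinear ((**) :: 'a::{real_normed_field,euclidean_space}^'n^'m \<Rightarrow> 'a^'p^'n \<Rightarrow> 'a^'p^'m)"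
  unfolding bilinear_conv_bounded_bilinear[symmetric] bilinear_def
  by (auto intro!: linearI simp: matrix_matrix_mult_def vec_eq_iff algebra_simps sum.distrib scaleR_sum_right)

lemmas matrix_mult_simps =
  bounded_bilinear.add_left[OF bounded_bilinear_matrix_mult]
  bounded_bilinear.add_right[OF bounded_bilinear_matrix_mult]
  bounded_bilinear.diff_left[OF bounded_bilinear_matrix_mult]
  bounded_bilinear.diff_right[OF bounded_bilinear_matrix_mult]
  bounded_bilinear.minus_left[OF bounded_bilinear_matrix_mult]
  bounded_bilinear.minus_right[OF bounded_bilinear_matrix_mult]
  bounded_bilinear.scaleR_left[OF bounded_bilinear_matrix_mult]
  bounded_bilinear.scaleR_right[OF bounded_bilinear_matrix_mult]

lemmas bounded_linear_matrix_mult_left = bounded_bilinear.bounded_linear_left[OF bounded_bilinear_matrix_mult]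
lemmas bounded_linear_matrix_mult_right = bounded_bilinear.bounded_linear_right[OF bounded_bilinear_matrix_mult]
lemmas has_derivative_matrix_mult = bounded_bilinear.FDERIV[OF bounded_bilinear_matrix_mult]

lemma matrix_inv_cancel:
  assumes "invertible A"
  shows "matrix_inv A ** A = mat 1" "A ** matrix_inv A = mat 1"
  using someI_ex[OF assms[unfolded invertible_def]] by (auto simp: matrix_inv_def)

lemma matrix_inv_unique:
  fixes A :: "'a::field^'n^'n"
  assumes "A ** B = mat 1" shows "matrix_inv A = B" "invertible A"
proof -
  show inv: "invertible A" using assms invertible_right_inverse by blast
  have "matrix_inv A ** (A ** B) = B" by (simp add: matrix_mul_assoc matrix_inv_cancel[OF inv])
  then show "matrix_inv A = B" by (simp add: assms)
qed

lemma continuous_on_det: "continuous_on S (det :: 'a::real_normed_field^'n^'n \<Rightarrow> 'a)"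
  unfolding det_def by (intro continuous_intros)

lemma open_invertible: "open {A :: 'a::real_normed_field^'n^'n. invertible A}"
  unfolding invertible_det_nz
  using open_vimage[of "- {0 :: 'a}" "det :: 'a^'n^'n \<Rightarrow> 'a"] continuous_on_det
  by (auto simp: vimage_def Collect_neg_eq)

text \<open>For the inverses \<open>R\<close> of \<open>A\<close> and \<open>S\<close> of
  \<open>Y = A + D\<close>, the identity S - R = - R D S, applied twice, turns the linearization
  error into - R D (S - R), which is quadratic in \<open>D\<close> once \<open>S\<close> is
  bounded.\<close>

lemma has_derivative_matrix_inv_at:
  fixes A :: "'a::{real_normed_field,euclidean_space}^'n^'n"
  assumes A: "invertible A"
  shows "(matrix_inv has_derivative (\<lambda>H. - (matrix_inv A ** H ** matrix_inv A))) (at A)"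
proof -
  define R where "R = matrix_inv A"
  obtain K where K: "K > 0" "\<And>(X :: 'a^'n^'n) (Y :: 'a^'n^'n). norm (X ** Y) \<le> norm X * norm Y * K"
    using bounded_bilinear.pos_bounded[OF bounded_bilinear_matrix_mult] by blast
  have K3: "norm (X ** Y ** Z) \<le> K * K * norm X * norm Y * norm Z" for X Y Z :: "'a^'n^'n"
  proof -
    have "norm (X ** Y ** Z) \<le> norm (X ** Y) * norm Z * K" by (rule K)
    also have "\<dots> \<le> (norm X * norm Y * K) * norm Z * K" using K by (intro mult_right_mono) auto
    finally show ?thesis by (simp add: mult_ac)
  qed
  obtain e1 where e1: "e1 > 0" "\<And>Y. dist Y A < e1 \<Longrightarrow> invertible Y"
    using open_invertible[where 'a='a and 'n='n] A
    by (auto simp: open_dist)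
  define c where "c = K * K * norm R"
  have c: "c \<ge> 0" using K by (simp add: c_def)
  \<comment> \<open>The first bound keeps \<open>Y\<close> invertible; the second gives
    \<open>c * norm D \<le> 1 / 2\<close> and thereby
    \<open>norm S \<le> 2 * norm R\<close>.\<close>
  define e where "e = min e1 (1 / (2 * (c + 1)))"
  show ?thesis
  proof (rule has_derivativeI_sandwich[of e])
    show "e > 0" using e1 c by (simp add: e_def)
    show "bounded_linear (\<lambda>H. - (matrix_inv A ** H ** matrix_inv A))"
      by (intro bounded_linear_minus bounded_linear_compose[OF bounded_linear_matrix_mult_left]
          bounded_linear_matrix_mult_right)
    show "((\<lambda>Y. 2 * c * c * norm R * norm (Y - A)) \<longlongrightarrow> 0) (at A)"
      by (auto intro!: tendsto_eq_intros)
    fix Y assume Y: "Y \<noteq> A" "dist Y A < e"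
    define S where "S = matrix_inv Y"
    define D where "D = Y - A"
    have inv: "invertible Y" using e1 Y by (simp add: e_def)
    have "S = R ** A ** S" by (simp add: R_def matrix_inv_cancel[OF A])
    also have "\<dots> = R ** (Y ** S) - R ** D ** S" by (simp add: D_def matrix_mult_simps matrix_mul_assoc)
    also have "\<dots> = R - R ** D ** S" by (simp add: S_def matrix_inv_cancel[OF inv])
    finally have S: "S - R = - (R ** D ** S)" by (metis diff_minus_eq_add minus_diff_eq add_diff_cancel_left')
    have "c * norm D \<le> (c + 1) * norm D" by (simp add: mult_right_mono)
    also have "\<dots> \<le> (c + 1) * (1 / (2 * (c + 1)))"
      using Y c by (intro mult_left_mono) (auto simp: D_def e_def dist_norm)
    also have "\<dots> = 1 / 2" using c by (simp add: field_simps)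
    finally have cD: "c * norm D \<le> 1 / 2" .
    have SR: "norm (S - R) \<le> c * norm D * norm S"
      unfolding S using K3[of R D S] by (simp add: c_def)
    also have "\<dots> \<le> 1 / 2 * norm S" using cD by (rule mult_right_mono) simp
    finally have "norm S \<le> 2 * norm R" using norm_triangle_ineq2[of S R] by simp
    then have SR2: "norm (S - R) \<le> c * norm D * (2 * norm R)"
      using SR c by (meson mult_left_mono mult_nonneg_nonneg norm_ge_zero order_trans)
    have "S - R - - (R ** D ** R) = - (R ** D ** (S - R))"
      using S by (subst bounded_bilinear.diff_right[OF bounded_bilinear_matrix_mult]) simp
    then have "norm (S - R - - (R ** D ** R)) \<le> c * norm D * norm (S - R)"
      using K3[of R D "S - R"] by (simp add: c_def)
    also have "\<dots> \<le> c * norm D * (c * norm D * (2 * norm R))"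
      using SR2 c by (intro mult_left_mono) auto
    finally have "norm (S - R - - (R ** D ** R)) \<le> (2 * c * c * norm R * norm D) * norm D"
      by (simp add: mult_ac)
    then show "norm (matrix_inv Y - matrix_inv A - - (matrix_inv A ** (Y - A) ** matrix_inv A)) / norm (Y - A)
        \<le> 2 * c * c * norm R * norm (Y - A)"
      using Y by (simp add: S_def R_def D_def divide_le_eq)
  qed
qed

lemma has_derivative_matrix_inv:
  fixes f :: "'b::real_normed_vector \<Rightarrow> 'a::{real_normed_field,euclidean_space}^'n^'n"
  assumes "(f has_derivative f') (at x within S)" "invertible (f x)"
  shows "((\<lambda>x. matrix_inv (f x)) has_derivative
    (\<lambda>h. - (matrix_inv (f x) ** f' h ** matrix_inv (f x)))) (at x within S)"
  using has_derivative_compose[OF assms(1) has_derivative_matrix_inv_at[OF assms(2)]] .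

lemma has_derivative_det_mat1: "(det has_derivative trace) (at (mat 1 :: real^'n^'n))"
proof -
  let ?T = "\<lambda>p (H :: real^'n^'n). \<Sum>i\<in>UNIV. H $ i $ p i * (\<Prod>j\<in>UNIV - {i}. mat 1 $ j $ p j)"
  have "((\<lambda>A :: real^'n^'n. \<Sum>p | p permutes UNIV. of_int (sign p) * (\<Prod>i\<in>UNIV. A $ i $ p i)) has_derivative
    (\<lambda>H. \<Sum>p | p permutes UNIV. of_int (sign p) * ?T p H)) (at (mat 1))"
    by (auto intro!: derivative_eq_intros bounded_linear_imp_has_derivative
        bounded_linear_compose[OF bounded_linear_vec_nth bounded_linear_vec_nth])
  moreover have "(\<Sum>p | p permutes UNIV. of_int (sign p) * ?T p H) = trace H" for H
  proof -
    \<comment> \<open>A permutation other than the identity moves at least two indices, so after one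
      factor is differentiated an off-diagonal entry of \<open>mat 1\<close> remains in the
      product.\<close>
    have zero: "?T p H = 0" if p: "p permutes UNIV" "p \<noteq> id" for p
    proof (rule sum.neutral, rule ballI)
      fix i
      have "\<exists>j. j \<noteq> i \<and> p j \<noteq> j"
      proof (rule ccontr)
        assume *: "\<not> ?thesis"
        then have "p i = i" using permutes_inj[OF p(1)] by (metis injD)
        with * p(2) show False by (auto simp: fun_eq_iff)
      qed
      then obtain j where "j \<noteq> i" "j \<noteq> p j" by metis
      then have "(\<Prod>j\<in>UNIV - {i}. mat 1 $ j $ p j :: real) = 0"
        by (intro prod_zero bexI[of _ j]) (auto simp: mat_def)
      then show "H $ i $ p i * (\<Prod>j\<in>UNIV - {i}. mat 1 $ j $ p j) = 0" by simp
    qed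
    have "(\<Sum>p | p permutes UNIV. of_int (sign p) * ?T p H) =
      (\<Sum>p\<in>{id}. of_int (sign p) * ?T p H)"
      by (rule sum.mono_neutral_right) (auto simp: zero permutes_id)
    then show ?thesis by (simp add: trace_def mat_def sign_id)
  qed
  ultimately show ?thesis by (simp add: det_def[abs_def])
qed

lemma has_derivative_det:
  fixes A :: "real^'n^'n"
  assumes "invertible A"
  shows "(det has_derivative (\<lambda>H. det A * trace (matrix_inv A ** H))) (at A)"
proof -
  let ?R = "matrix_inv A"
  have det: "det Y = det A * det (?R ** Y)" for Y
  proof -
    have "A ** (?R ** Y) = Y" by (simp add: matrix_mul_assoc matrix_inv_cancel[OF assms])
    then show ?thesis by (metis det_mul)
  qed
  have "((\<lambda>Y. det (?R ** Y)) has_derivative (\<lambda>H. trace (?R ** H))) (at A)"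
    by (rule has_derivative_compose[OF bounded_linear_imp_has_derivative[OF bounded_linear_matrix_mult_right]])
      (simp add: matrix_inv_cancel[OF assms] has_derivative_det_mat1)
  then have "((\<lambda>Y. det A * det (?R ** Y)) has_derivative (\<lambda>H. det A * trace (?R ** H))) (at A)"
    by (rule has_derivative_mult_right)
  then show ?thesis by (simp add: det[symmetric])
qed

lemma Ck_on_matrix_inv:
  "Ck_on k {A :: 'a::{real_normed_field,euclidean_space}^'n^'n. invertible A} matrix_inv"
proof (induction k)
  case 0
  have "isCont matrix_inv A" if "invertible A" for A :: "'a^'n^'n"
    using has_derivative_continuous[OF has_derivative_matrix_inv_at[OF that]] by simp
  then show ?case by (simp add: continuous_at_imp_continuous_on)
next
  case (Suc k)
  show ?case
  proof (rule Ck_on_Suc[OF open_invertible])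
    show "(matrix_inv has_derivative (\<lambda>H. - (matrix_inv A ** H ** matrix_inv A))) (at A)"
      if "A \<in> {A :: 'a^'n^'n. invertible A}" for A
      using that has_derivative_matrix_inv_at by blast
    show "Ck_on k {A :: 'a^'n^'n. invertible A} (\<lambda>A. - (matrix_inv A ** H ** matrix_inv A))" for H
      by (intro Ck_on_bounded_linear[OF bounded_linear_minus[OF bounded_linear_ident]]
          Ck_on_bilinear[OF bounded_bilinear_matrix_mult] Ck_on_const open_invertible Suc)
  qed
qed

lemma Ck_on_matrix_inv_compose:
  fixes f :: "'b::euclidean_space \<Rightarrow> 'a::{real_normed_field,euclidean_space}^'n^'n"
  assumes "open S" "Ck_on k S f" "\<And>x. x \<in> S \<Longrightarrow> invertible (f x)"
  shows "Ck_on k S (\<lambda>x. matrix_inv (f x))"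
  by (rule Ck_on_compose[OF assms(1) open_invertible _ Ck_on_matrix_inv assms(2)]) (use assms(3) in auto)

text \<open>Regularity is bootstrapped: the derivative of \<open>g\<close> at \<open>y\<close> is
  the inverse matrix of the derivative of \<open>f\<close> at \<open>g y\<close>, so if
  \<open>g\<close> is of class \<open>k\<close>, then so is its derivative, and \<open>g\<close> is
  of class \<open>Suc k\<close>.\<close>

theorem smooth_inverse_function:
  fixes f :: "real^'n \<Rightarrow> real^'n"
  assumes U: "open U" "x \<in> U" and f: "smooth_on U f" and surj: "surj (frechet_derivative f (at x))"
  obtains U' V g where "open U'" "U' \<subseteq> U" "x \<in> U'" "open V" "f x \<in> V" "homeomorphism U' V f g" "smooth_on V g"
proof -
  let ?D = "\<lambda>x. frechet_derivative f (at x)"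
  have Ck: "Ck_on k U f" for k using f by (simp add: smooth_on_def)
  have D: "(f has_derivative ?D x) (at x)" if "x \<in> U" for x
    using Ck_on_differentiable[OF Ck that] .
  have bl: "bounded_linear (?D x)" if "x \<in> U" for x using D[OF that] by (rule has_derivative_bounded_linear)
  define f' where "f' x = Blinfun (?D x)" for x
  have f': "blinfun_apply (f' x) = ?D x" if "x \<in> U" for x
    using bl[OF that] by (simp add: f'_def bounded_linear_Blinfun_apply)
  have cont: "continuous_on U f'"
  proof (rule continuous_on_blinfun_componentwise)
    fix v :: "real^'n"
    have "continuous_on U (\<lambda>x. ?D x v)" using Ck[of "Suc 0"] by simp
    then show "continuous_on U (\<lambda>x. blinfun_apply (f' x) v)" using f' by (simp cong: continuous_on_cong)
  qed
  obtain h where h: "linear h" "h \<circ> ?D x = id"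
    using linear_injective_left_inverse[of "?D x"] linear_surjective_imp_injective[of "?D x"]
      surj has_derivative_linear[OF D[OF U(2)]] by blast
  have hb: "bounded_linear h" using h(1) by (simp add: linear_conv_bounded_linear)
  have "Blinfun h o\<^sub>L f' x = id_blinfun"
    using h(2) by (intro blinfun_eqI)
      (simp add: f'[OF U(2)] bounded_linear_Blinfun_apply[OF hb] fun_eq_iff)
  then obtain U' V g g' where inv: "open U'" "U' \<subseteq> U" "x \<in> U'" "open V" "f x \<in> V" "homeomorphism U' V f g"
    and g: "\<And>y. y \<in> V \<Longrightarrow> (g has_derivative (g' y)) (at y)"
    "\<And>y. y \<in> V \<Longrightarrow> g' y = inv (blinfun_apply (f'(g y)))" "\<And>y. y \<in> V \<Longrightarrow> bij (blinfun_apply (f'(g y)))"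
    using inverse_function_theorem[OF U(1) _ cont U(2)] D f' by metis
  have gU: "g y \<in> U" if "y \<in> V" for y using inv that by (auto simp: homeomorphism_def)
  let ?M = "\<lambda>y. matrix (?D (g y))"
  have M: "?M y *v v = ?D (g y) v" if "y \<in> V" for y v
    using has_derivative_linear[OF D[OF gU[OF that]]] by (simp add: matrix_works)
  have M_inv: "invertible (?M y)" if "y \<in> V" for y
  proof -
    have "inj (\<lambda>v. ?M y *v v)" using g(3)[OF that] M[OF that] f'[OF gU[OF that]] by (simp add: bij_def)
    then show ?thesis using matrix_left_invertible_injective invertible_left_inverse by blast
  qed
  have g': "g' y v = matrix_inv (?M y) *v v" if y: "y \<in> V" for y v
  proof -
    have "?D (g y) (matrix_inv (?M y) *v v) = v"
      by (simp add: M[OF y, symmetric] matrix_vector_mul_assoc matrix_inv_cancel[OF M_inv[OF y]])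
    then show ?thesis using g(2,3)[OF y] f'[OF gU[OF y]] by (metis bij_inv_eq_iff)
  qed
  have "Ck_on k V g" for k
  proof (induction k)
    case 0
    show ?case using inv(6) by (simp add: homeomorphism_def)
  next
    case (Suc k)
    show ?case
    proof (rule Ck_on_Suc[OF inv(4)])
      show "(g has_derivative (\<lambda>v. matrix_inv (?M y) *v v)) (at y)" if "y \<in> V" for y
      proof -
        have "g' y = (\<lambda>v. matrix_inv (?M y) *v v)" using g'[OF that] by (rule ext)
        then show ?thesis using g(1)[OF that] by simp
      qed
      fix v
      have "Ck_on k V (\<lambda>y. ?D (g y) w)" for w
        by (rule Ck_on_compose[OF inv(4) U(1) _ _ Suc]) (use gU Ck[of "Suc k"] in auto)
      then have "Ck_on k V (\<lambda>y. ?D (g y) w $ i)" for w i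
        by (rule Ck_on_bounded_linear[OF bounded_linear_vec_nth inv(4)])
      then have "Ck_on k V ?M" by (intro Ck_on_vec inv(4)) (simp add: matrix_def)
      then have "Ck_on k V (\<lambda>y. matrix_inv (?M y))" by (rule Ck_on_matrix_inv_compose[OF inv(4) _ M_inv])
      moreover have "bounded_linear (\<lambda>A :: real^'n^'n. A *v v)"
        unfolding linear_conv_bounded_linear[symmetric]
        by (auto intro!: linearI simp: algebra_simps scaleR_matrix_vector_assoc)
      ultimately show "Ck_on k V (\<lambda>y. matrix_inv (?M y) *v v)"
        using Ck_on_bounded_linear[OF _ inv(4)] by blast
    qed
  qed
  then show thesis using that inv by (simp add: smooth_on_def)
qed

section \<open>The Laplacian of an isometric immersion\<close>

lemma has_derivative_vec_lambda:
  fixes f :: "'n::finite \<Rightarrow> 'a::real_normed_vector \<Rightarrow> 'b::real_normed_vector"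
  assumes "\<And>i. (f i has_derivative f' i) F"
  shows "((\<lambda>x. \<chi> i. f i x) has_derivative (\<lambda>h. \<chi> i. f' i h)) F"
proof -
  have eq: "(\<lambda>x. \<chi> i. p i x) = (\<lambda>x. \<Sum>i\<in>UNIV. axis i (p i x))" for p :: "'n \<Rightarrow> 'a \<Rightarrow> 'b"
    by (simp add: fun_eq_iff vec_eq_iff axis_def)
  show ?thesis
    unfolding eq by (intro has_derivative_sum bounded_linear.has_derivative[OF bounded_linear_axis] assms)
qed

text \<open>\<open>c\<close> is the ratio of the Riemannian metric to the pullback of the Euclidean
  inner product; it stays a parameter because the embedding used later is isometric only up to
  scale.\<close>

locale immersed_patch =
  fixes F :: "real^'d \<Rightarrow> 'e::euclidean_space" and V :: "(real^'d) set" and c :: real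
  assumes open_V: "open V" and C2: "Ck_on 2 V F" and c_pos: "c > 0"
    and immersion: "\<And>y. y \<in> V \<Longrightarrow> inj (frechet_derivative F (at y))"
begin

definition Fd :: "'d \<Rightarrow> real^'d \<Rightarrow> 'e" where
  "Fd i y = frechet_derivative F (at y) (axis i 1)"

definition g :: "real^'d \<Rightarrow> real^'d^'d" where
  "g y = (\<chi> i j. c * (Fd i y \<bullet> Fd j y))"

definition ginv :: "real^'d \<Rightarrow> real^'d^'d" where
  "ginv y = matrix_inv (g y)"

definition F2 :: "'d \<Rightarrow> 'd \<Rightarrow> real^'d \<Rightarrow> 'e" where
  "F2 i j y = frechet_derivative (Fd i) (at y) (axis j 1)"

text \<open>Component by component in the target space this is the \<open>i\<close>-th coordinate of
  the gradient of \<open>F\<close>, so \<open>laplacian\<close> below is the coordinate formula for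
  div grad applied to a vector-valued map.\<close>

definition dual :: "'d \<Rightarrow> real^'d \<Rightarrow> 'e" where
  "dual i y = (\<Sum>j\<in>UNIV. ginv y $ i $ j *\<^sub>R Fd j y)"

definition laplacian :: "real^'d \<Rightarrow> 'e" where
  "laplacian y = (\<Sum>i\<in>UNIV. frechet_derivative (\<lambda>z. sqrt (det (g z)) *\<^sub>R dual i z) (at y) (axis i 1)) /\<^sub>R sqrt (det (g y))"

lemma F2_sym: "y \<in> V \<Longrightarrow> F2 i j y = F2 j i y"
  unfolding F2_def Fd_def by (rule second_derivative_symmetric[OF open_V _ C2])

lemma Fd_deriv: "y \<in> V \<Longrightarrow> (Fd i has_derivative frechet_derivative (Fd i) (at y)) (at y)"
  using C2 by (simp add: numeral_2_eq_2 Fd_def[abs_def] frechet_derivative_works)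

lemma F_deriv_linear: "y \<in> V \<Longrightarrow> linear (frechet_derivative F (at y))"
  using C2 by (auto simp: numeral_2_eq_2 intro: linear_frechet_derivative)

lemma F_deriv_expand:
  assumes y: "y \<in> V" shows "frechet_derivative F (at y) v = (\<Sum>i\<in>UNIV. v $ i *\<^sub>R Fd i y)"
proof -
  have "frechet_derivative F (at y) v = frechet_derivative F (at y) (\<Sum>i\<in>UNIV. v $ i *\<^sub>R axis i 1)"
    using basis_expansion[of v] by (simp add: scalar_mult_eq_scaleR)
  then show ?thesis
    using F_deriv_linear[OF y] by (simp add: linear_sum linear_cmul Fd_def)
qed

lemma c_nonzero: "c \<noteq> 0"
  using c_pos by simp

lemma g_inv: assumes y: "y \<in> V" shows "invertible (g y)"
proof -
  have "v = 0" if v: "g y *v v = 0" for v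
  proof -
    \<comment> \<open>The quadratic form of \<open>g\<close> is \<open>c\<close> times the squared
      length of the image vector, so a kernel vector of \<open>g\<close> is annihilated by the
      injective differential.\<close>
    have "c * (frechet_derivative F (at y) v \<bullet> frechet_derivative F (at y) v) = v \<bullet> (g y *v v)"
      unfolding F_deriv_expand[OF y]
      by (simp add: inner_sum_left inner_sum_right inner_vec_def matrix_vector_mult_def g_def
          sum_distrib_left mult_ac inner_commute)
    then have "frechet_derivative F (at y) v = 0" using v c_nonzero by simp
    then show "v = 0" using immersion[OF y] linear_injective_0[OF F_deriv_linear[OF y]] by blast
  qed
  then show ?thesis using matrix_left_invertible_ker invertible_left_inverse by blast
qed

lemma ginv_mult: "y \<in> V \<Longrightarrow> ginv y ** g y = mat 1" "y \<in> V \<Longrightarrow> g y ** ginv y = mat 1"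
  unfolding ginv_def by (rule matrix_inv_cancel[OF g_inv]; assumption)+

lemma ginv_sym: assumes y: "y \<in> V" shows "ginv y $ i $ j = ginv y $ j $ i"
proof -
  have "transpose (g y) = g y" by (simp add: g_def transpose_def inner_commute vec_eq_iff)
  then have "g y ** transpose (ginv y) = mat 1"
    using arg_cong[OF ginv_mult(1)[OF y], of transpose] by (simp add: matrix_transpose_mul)
  then have "ginv y = transpose (ginv y)" unfolding ginv_def by (rule matrix_inv_unique)
  from arg_cong[OF this, of "\<lambda>A. A $ i $ j"] show ?thesis by (simp add: transpose_def)
qed

lemma dual_inner: "y \<in> V \<Longrightarrow> dual i y \<bullet> Fd k y = (if i = k then 1 / c else 0)"
proof -
  assume y: "y \<in> V"
  have "c * (dual i y \<bullet> Fd k y) = (ginv y ** g y) $ i $ k"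
    by (simp add: dual_def g_def matrix_matrix_mult_def inner_sum_left sum_distrib_left mult_ac)
  then show ?thesis using c_nonzero by (simp add: ginv_mult(1)[OF y] mat_def field_simps split: if_splits)
qed

lemma g_deriv:
  assumes y: "y \<in> V"
  shows "(g has_derivative (\<lambda>h. \<chi> i j. c * (Fd i y \<bullet> frechet_derivative (Fd j) (at y) h
      + frechet_derivative (Fd i) (at y) h \<bullet> Fd j y))) (at y)"
  unfolding g_def[abs_def]
  by (intro has_derivative_vec_lambda has_derivative_mult_right bounded_bilinear.FDERIV[OF bounded_bilinear_inner] Fd_deriv[OF y])

lemma det_g: "y \<in> V \<Longrightarrow> det (g y) \<noteq> 0"
  using g_inv by (simp add: invertible_det_nz)

lemma volume_deriv:
  assumes y: "y \<in> V" and g': "(g has_derivative g') (at y)"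
  shows "((\<lambda>z. sqrt (det (g z))) has_derivative (\<lambda>h. sqrt (det (g y)) / 2 * trace (ginv y ** g' h))) (at y)"
proof -
  \<comment> \<open>The real \<open>sqrt\<close> of HOL is an odd function. Written as
    \<open>sqrt x / (2 * x)\<close> its derivative has one form for both signs, so
    \<open>det_g\<close> is all that has to be known about the determinant.\<close>
  have sqrt: "(sqrt has_real_derivative sqrt x / (2 * x)) (at x)" if "x \<noteq> 0" for x
  proof (cases "x > 0")
    case True
    have "sqrt x * sqrt x = x" using True by simp
    then have "inverse (sqrt x) / 2 = sqrt x / (2 * x)" using True by (simp add: field_simps)
    then show ?thesis using DERIV_real_sqrt[OF True] by (simp only:)
  next
    case False
    then have x: "x < 0" using that by simp
    have "sqrt x * sqrt x = - x" using x real_sqrt_mult[of x x] by (simp add: real_sqrt_abs2)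
    then have "sqrt x / (2 * x) = - inverse (sqrt x) / 2" using x by (simp add: field_simps)
    then show ?thesis using DERIV_real_sqrt_generic[OF that, of "sqrt x / (2 * x)"] x by simp
  qed
  have "(det has_derivative (\<lambda>H. det (g y) * trace (ginv y ** H))) (at (g y))"
    unfolding ginv_def by (rule has_derivative_det[OF g_inv[OF y]])
  from has_derivative_compose[OF has_derivative_compose[OF g' this] sqrt[OF det_g[OF y], unfolded has_field_derivative_def]]
  show ?thesis using det_g[OF y] by simp
qed

lemma ginv_entry_differentiable:
  assumes y: "y \<in> V" shows "(\<lambda>z. ginv z $ i $ j) differentiable (at y)"
proof -
  have "\<exists>D. (ginv has_derivative D) (at y)"
    unfolding ginv_def[abs_def] using has_derivative_matrix_inv[OF g_deriv[OF y] g_inv[OF y]] by blast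
  then obtain D where "(ginv has_derivative D) (at y)" by blast
  from bounded_linear.has_derivative[OF bounded_linear_vec_nth
      bounded_linear.has_derivative[OF bounded_linear_vec_nth this]]
  show ?thesis unfolding differentiable_def by blast
qed

lemma volume_differentiable: "y \<in> V \<Longrightarrow> (\<lambda>z. sqrt (det (g z))) differentiable (at y)"
  using volume_deriv[OF _ g_deriv] unfolding differentiable_def by blast

lemma dual_differentiable:
  assumes y: "y \<in> V" shows "dual i differentiable (at y)"
proof -
  have "Fd j differentiable (at y)" for j
    using Fd_deriv[OF y] unfolding differentiable_def by blast
  then show ?thesis
    unfolding dual_def[abs_def]
    by (intro differentiable_sum differentiable_scaleR ginv_entry_differentiable[OF y] ballI) auto
qed

lemma density_differentiable:
  "y \<in> V \<Longrightarrow> (\<lambda>z. sqrt (det (g z)) *\<^sub>R dual i z) differentiable (at y)"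
  by (intro differentiable_scaleR dual_differentiable volume_differentiable)

text \<open>The tangential part vanishes by Jacobi's formula for the volume density and the symmetry of
  second derivatives.\<close>

lemma laplacian_normal:
  assumes y: "y \<in> V" shows "laplacian y \<bullet> Fd k y = 0"
proof -
  let ?s = "\<lambda>z. sqrt (det (g z))"
  let ?W = "\<lambda>i. frechet_derivative (\<lambda>z. ?s z *\<^sub>R dual i z) (at y) (axis i 1)"
  define g' where "g' h = (\<chi> i j. c * (Fd i y \<bullet> frechet_derivative (Fd j) (at y) h
      + frechet_derivative (Fd i) (at y) h \<bullet> Fd j y))" for h
  have g': "(g has_derivative g') (at y)" using g_deriv[OF y] by (simp add: g'_def[abs_def])
  let ?s' = "\<lambda>h. ?s y / 2 * trace (ginv y ** g' h)"
  \<comment> \<open>Two derivatives of the scalar \<open>?q\<close> are compared: one from the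
    product rule, the other from \<open>dual_inner\<close>, which makes \<open>?q\<close> a constant
    multiple of the volume density.\<close>
  have W: "?W i \<bullet> Fd k y = (if i = k then ?s' (axis k 1) / c else 0) - ?s y *\<^sub>R (dual i y \<bullet> F2 k i y)" for i
  proof -
    let ?q = "\<lambda>z. (?s z *\<^sub>R dual i z) \<bullet> Fd k z"
    have "(?q has_derivative (\<lambda>h. (?s y *\<^sub>R dual i y) \<bullet> frechet_derivative (Fd k) (at y) h
        + frechet_derivative (\<lambda>z. ?s z *\<^sub>R dual i z) (at y) h \<bullet> Fd k y)) (at y)"
      using density_differentiable[OF y, of i]
      by (intro bounded_bilinear.FDERIV[OF bounded_bilinear_inner] Fd_deriv[OF y])
        (simp add: frechet_derivative_works)
    moreover have "((\<lambda>z. ?s z * (if i = k then 1 / c else 0)) has_derivative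
        (\<lambda>h. ?s' h * (if i = k then 1 / c else 0))) (at y)"
      by (rule has_derivative_mult_left[OF volume_deriv[OF y g']])
    then have "(?q has_derivative (\<lambda>h. ?s' h * (if i = k then 1 / c else 0))) (at y)"
      by (rule has_derivative_transform_within_open[OF _ open_V y]) (simp add: dual_inner)
    ultimately have "(\<lambda>h. (?s y *\<^sub>R dual i y) \<bullet> frechet_derivative (Fd k) (at y) h
        + frechet_derivative (\<lambda>z. ?s z *\<^sub>R dual i z) (at y) h \<bullet> Fd k y)
        = (\<lambda>h. ?s' h * (if i = k then 1 / c else 0))"
      by (rule has_derivative_unique)
    from fun_cong[OF this, of "axis i 1"] show ?thesis by (auto simp: F2_def)
  qed
  have "trace (ginv y ** g' (axis k 1)) = (\<Sum>i\<in>UNIV. \<Sum>j\<in>UNIV. c * (ginv y $ i $ j * (Fd j y \<bullet> F2 i k y)))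
      + (\<Sum>i\<in>UNIV. \<Sum>j\<in>UNIV. c * (ginv y $ i $ j * (Fd i y \<bullet> F2 j k y)))"
    by (simp add: trace_def matrix_matrix_mult_def g'_def F2_def sum.distrib[symmetric] algebra_simps inner_commute)
  also have "(\<Sum>i\<in>UNIV. \<Sum>j\<in>UNIV. c * (ginv y $ i $ j * (Fd i y \<bullet> F2 j k y)))
      = (\<Sum>i\<in>UNIV. \<Sum>j\<in>UNIV. c * (ginv y $ i $ j * (Fd j y \<bullet> F2 i k y)))"
    by (subst sum.swap) (simp add: ginv_sym[OF y])
  also have "(\<Sum>i\<in>UNIV. \<Sum>j\<in>UNIV. c * (ginv y $ i $ j * (Fd j y \<bullet> F2 i k y)))
      = c * (\<Sum>i\<in>UNIV. dual i y \<bullet> F2 k i y)"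
    by (simp add: dual_def inner_sum_left sum_distrib_left F2_sym[OF y, of _ k] mult_ac)
  finally have tr: "?s' (axis k 1) / c = ?s y * (\<Sum>i\<in>UNIV. dual i y \<bullet> F2 k i y)"
    using c_nonzero by simp
  have "(\<Sum>i\<in>UNIV. ?W i) \<bullet> Fd k y = 0"
    unfolding inner_sum_left W sum_subtractf tr by (simp add: sum_distrib_left)
  then show ?thesis by (simp add: laplacian_def)
qed

text \<open>The coefficients \<open>b\<close> come from differentiating the density times the
  inverse metric and may stay unspecified: the tangential sum is annihilated by the anticommutator
  with \<open>F\<close>, so only the trace of the second derivatives is used explicitly.\<close>

lemma laplacian_decompose:
  assumes y: "y \<in> V"
  shows "\<exists>b. laplacian y = (\<Sum>j\<in>UNIV. b j *\<^sub>R Fd j y) + (\<Sum>i\<in>UNIV. \<Sum>j\<in>UNIV. ginv y $ i $ j *\<^sub>R F2 i j y)"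
proof -
  let ?s = "\<lambda>z. sqrt (det (g z))"
  let ?r = "\<lambda>i j z. ?s z * ginv z $ i $ j"
  let ?R = "\<lambda>i j. frechet_derivative (?r i j) (at y)"
  have R: "(?r i j has_derivative ?R i j) (at y)" for i j
    using differentiable_mult[OF volume_differentiable[OF y] ginv_entry_differentiable[OF y]]
    by (simp add: frechet_derivative_works)
  have D: "((\<lambda>z. ?s z *\<^sub>R dual i z) has_derivative (\<lambda>h. \<Sum>j\<in>UNIV. ?r i j y *\<^sub>R frechet_derivative (Fd j) (at y) h + ?R i j h *\<^sub>R Fd j y)) (at y)" for i
  proof -
    have "(\<lambda>z. ?s z *\<^sub>R dual i z) = (\<lambda>z. \<Sum>j\<in>UNIV. ?r i j z *\<^sub>R Fd j z)"
      by (simp add: dual_def scaleR_sum_right)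
    then show ?thesis by (simp only:) (intro has_derivative_sum has_derivative_scaleR R Fd_deriv[OF y])
  qed
  have W: "frechet_derivative (\<lambda>z. ?s z *\<^sub>R dual i z) (at y) =
      (\<lambda>h. \<Sum>j\<in>UNIV. ?r i j y *\<^sub>R frechet_derivative (Fd j) (at y) h + ?R i j h *\<^sub>R Fd j y)" for i
    by (rule frechet_derivative_at[OF D, symmetric])
  have s: "?s y \<noteq> 0" using det_g[OF y] by simp
  have term_eq: "(?r i j y *\<^sub>R F2 j i y + ?R i j (axis i 1) *\<^sub>R Fd j y) /\<^sub>R ?s y
      = (?R i j (axis i 1) / ?s y) *\<^sub>R Fd j y + ginv y $ i $ j *\<^sub>R F2 i j y" for i j
  proof -
    have "((t * a) *\<^sub>R u + b *\<^sub>R v) /\<^sub>R t = (b / t) *\<^sub>R v + a *\<^sub>R u" if "t \<noteq> 0" for t a b :: real and u v :: 'e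
      using that by (simp add: scaleR_add_right field_simps)
    from this[OF s] show ?thesis unfolding F2_sym[OF y, of j i] .
  qed
  have "laplacian y = (\<Sum>i\<in>UNIV. \<Sum>j\<in>UNIV. ?r i j y *\<^sub>R F2 j i y + ?R i j (axis i 1) *\<^sub>R Fd j y) /\<^sub>R ?s y"
    unfolding laplacian_def W F2_def ..
  also have "\<dots> = (\<Sum>i\<in>UNIV. \<Sum>j\<in>UNIV. (?R i j (axis i 1) / ?s y) *\<^sub>R Fd j y)
      + (\<Sum>i\<in>UNIV. \<Sum>j\<in>UNIV. ginv y $ i $ j *\<^sub>R F2 i j y)"
    unfolding scaleR_sum_right term_eq by (simp only: sum.distrib)
  also have "(\<Sum>i\<in>UNIV. \<Sum>j\<in>UNIV. (?R i j (axis i 1) / ?s y) *\<^sub>R Fd j y)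
      = (\<Sum>j\<in>UNIV. (\<Sum>i\<in>UNIV. ?R i j (axis i 1) / ?s y) *\<^sub>R Fd j y)"
    by (subst sum.swap) (simp add: scaleR_sum_left)
  finally show ?thesis by (intro exI)
qed

end

section \<open>Quaternionic matrices\<close>

lemma conj_mat_nth [simp]: "conj_mat A $ i $ j = cnj (A $ i $ j)"
  by (simp add: conj_mat_def)

lemma adj_nth [simp]: "adj A $ i $ j = cnj (A $ j $ i)"
  by (simp add: adj_def transpose_def)

lemma conj_mat_mult [simp]: "conj_mat (A ** B) = conj_mat A ** conj_mat B"
  by (simp add: vec_eq_iff matrix_matrix_mult_def)

lemma conj_mat_simps [simp]:
  "conj_mat (A + B) = conj_mat A + conj_mat B"
  "conj_mat (A - B) = conj_mat A - conj_mat B" "conj_mat (- A) = - conj_mat A"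
  "conj_mat (r *\<^sub>R A) = r *\<^sub>R conj_mat A" "conj_mat (conj_mat A) = A" "conj_mat 0 = 0"
  by (simp_all add: vec_eq_iff)

lemma conj_mat_1 [simp]: "conj_mat (mat 1) = mat 1"
  by (simp add: vec_eq_iff mat_def)

lemma adj_mult [simp]: "adj (A ** B) = adj B ** adj A"
  by (simp add: vec_eq_iff matrix_matrix_mult_def mult.commute)

lemma adj_simps [simp]:
  "adj (A + B) = adj A + adj B"
  "adj (A - B) = adj A - adj B" "adj (- A) = - adj A"
  "adj (r *\<^sub>R A) = r *\<^sub>R adj A" "adj (adj A) = A" "adj 0 = 0" "adj (conj_mat A) = conj_mat (adj A)"
  by (simp_all add: vec_eq_iff)

lemma adj_1 [simp]: "adj (mat 1) = mat 1"
  by (simp add: vec_eq_iff mat_def)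

lemma bounded_linear_conj_mat: "bounded_linear (conj_mat :: complex^'l^'k \<Rightarrow> _)"
  unfolding linear_conv_bounded_linear[symmetric] by (rule linearI) simp_all

lemma bounded_linear_adj: "bounded_linear (adj :: complex^'l^'k \<Rightarrow> _)"
  unfolding linear_conv_bounded_linear[symmetric] by (rule linearI) simp_all

lemma sum_UNIV_Plus:
  "(\<Sum>x\<in>(UNIV :: ('a::finite + 'b::finite) set). f x) = (\<Sum>x\<in>UNIV. f (Inl x)) + (\<Sum>x\<in>UNIV. f (Inr x))"
  by (simp add: UNIV_Plus_UNIV[symmetric] sum.Plus del: UNIV_Plus_UNIV)

lemma block_nth [simp]:
  "block A B C D $ Inl i $ Inl j = A $ i $ j" "block A B C D $ Inl i $ Inr l = B $ i $ l"
  "block A B C D $ Inr k $ Inl j = C $ k $ j" "block A B C D $ Inr k $ Inr l = D $ k $ l"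
  by (simp_all add: block_def)

lemma vec_eq_iff_Plus: "(x :: 'c^('a::finite + 'b::finite)) = y \<longleftrightarrow> (\<forall>i. x $ Inl i = y $ Inl i) \<and> (\<forall>i. x $ Inr i = y $ Inr i)"
  by (auto simp: vec_eq_iff split_sum_all)

lemma block_eq_iff: "block A B C D = block A' B' C' D' \<longleftrightarrow> A = A' \<and> B = B' \<and> C = C' \<and> D = D'"
  unfolding vec_eq_iff_Plus[of "block A B C D"] by (auto simp: vec_eq_iff split_sum_all)

lemma block_exhaust: obtains A B C D where "M = block A B C D"
proof
  show "M = block (\<chi> i j. M $ Inl i $ Inl j) (\<chi> i j. M $ Inl i $ Inr j) (\<chi> i j. M $ Inr i $ Inl j) (\<chi> i j. M $ Inr i $ Inr j)"
    by (simp add: vec_eq_iff split_sum_all)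
qed

lemma block_mult:
  fixes A A' :: "'a::semiring_1^_^_"
  shows "block A B C D ** block A' B' C' D' =
    block (A ** A' + B ** C') (A ** B' + B ** D') (C ** A' + D ** C') (C ** B' + D ** D')"
  by (simp add: vec_eq_iff split_sum_all matrix_matrix_mult_def sum_UNIV_Plus)

lemma block_simps:
  "conj_mat (block A1 B1 C1 D1) = block (conj_mat A1) (conj_mat B1) (conj_mat C1) (conj_mat D1)"
  "adj (block A1 B1 C1 D1) = block (adj A1) (adj C1) (adj B1) (adj D1)"
  "- block A B C D = block (- A) (- B) (- C) (- (D :: 'a::group_add^_^_))"
  "block (mat 1) 0 0 (mat 1) = (mat 1 :: 'b::zero_neq_one^_^_)"
  by (simp_all add: vec_eq_iff split_sum_all mat_def)

definition J :: "complex^('k::finite + 'k)^('k + 'k)" where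
  "J = block 0 (mat 1) (- mat 1) 0"

lemma J_simps [simp]: "J ** J = - mat 1" "conj_mat J = J" "adj J = - J"
  by (simp_all add: J_def block_mult block_simps matrix_mult_simps block_simps(4)[symmetric] del: block_simps(4))

lemma J_cancel [simp]: "J ** (J ** A) = - A" "A ** J ** J = - A"
  by (simp_all add: matrix_mul_assoc matrix_mult_simps) (simp add: matrix_mul_assoc[symmetric] matrix_mult_simps)

text \<open>The block shape of \<open>Sp\<close> as one real-linear equation: \<open>A\<close>
  commutes with the antilinear map v -> J conj(v). Closure under sums, products, adjoints and
  inverses then needs no block computation.\<close>

definition quaternionic :: "complex^('k::finite + 'k)^('k + 'k) \<Rightarrow> bool" where
  "quaternionic A \<longleftrightarrow> A ** J = J ** conj_mat A"

lemma quaternionic_iff_block: "quaternionic A \<longleftrightarrow> (\<exists>z w. A = block z w (- conj_mat w) (conj_mat z))"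
proof
  assume A: "quaternionic A"
  obtain a b c d where abcd: "A = block a b c d" by (rule block_exhaust)
  have "block (- b) a (- d) c = block (conj_mat c) (conj_mat d) (- conj_mat a) (- conj_mat b)"
    using A[unfolded quaternionic_def abcd] by (simp add: J_def block_mult block_simps matrix_mult_simps)
  then have "- d = - conj_mat a" "c = - conj_mat b" unfolding block_eq_iff by blast+
  then have "A = block a b (- conj_mat b) (conj_mat a)" unfolding abcd by (metis minus_minus)
  then show "\<exists>z w. A = block z w (- conj_mat w) (conj_mat z)" by blast
qed (auto simp: quaternionic_def J_def block_mult block_simps block_eq_iff matrix_mult_simps)

lemma Sp_iff: "q \<in> Sp \<longleftrightarrow> unitary q \<and> quaternionic q"
  by (simp add: Sp_def quaternionic_iff_block)

lemma quaternionic_1: "quaternionic (mat 1)" by (simp add: quaternionic_def)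

lemma quaternionic_add: "quaternionic A \<Longrightarrow> quaternionic B \<Longrightarrow> quaternionic (A + B)"
  and quaternionic_diff: "quaternionic A \<Longrightarrow> quaternionic B \<Longrightarrow> quaternionic (A - B)"
  and quaternionic_scaleR: "quaternionic A \<Longrightarrow> quaternionic (r *\<^sub>R A)"
  by (simp_all add: quaternionic_def matrix_mult_simps)

lemma quaternionic_mult:
  assumes "quaternionic A" "quaternionic B" shows "quaternionic (A ** B)"
proof -
  have "A ** B ** J = A ** (B ** J)" by (simp add: matrix_mul_assoc)
  also have "\<dots> = (A ** J) ** conj_mat B" using assms(2) by (simp add: quaternionic_def matrix_mul_assoc)
  also have "\<dots> = J ** conj_mat (A ** B)" using assms(1) by (simp add: quaternionic_def matrix_mul_assoc)
  finally show ?thesis by (simp add: quaternionic_def)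
qed

lemma quaternionic_adj:
  assumes "quaternionic A" shows "quaternionic (adj A)"
proof -
  have "adj (A ** J) = adj (J ** conj_mat A)" using assms by (simp add: quaternionic_def)
  then have "J ** adj A = conj_mat (adj A) ** J" by (simp add: matrix_mult_simps)
  from arg_cong[OF this, of conj_mat] show ?thesis by (simp add: quaternionic_def)
qed

lemma conj_mat_matrix_inv: "invertible (A :: complex^'k^'k) \<Longrightarrow> conj_mat (matrix_inv A) = matrix_inv (conj_mat A)"
  by (rule matrix_inv_unique(1)[symmetric]) (simp add: conj_mat_mult[symmetric] matrix_inv_cancel del: conj_mat_mult)

lemma adj_matrix_inv: "invertible (A :: complex^'k^'k) \<Longrightarrow> adj (matrix_inv A) = matrix_inv (adj A)"
  by (rule matrix_inv_unique(1)[symmetric]) (simp add: adj_mult[symmetric] matrix_inv_cancel del: adj_mult)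

lemma invertible_conj_mat: "invertible (A :: complex^'k^'k) \<Longrightarrow> invertible (conj_mat A)"
  by (rule matrix_inv_unique(2)[where B="conj_mat (matrix_inv A)"])
    (simp add: conj_mat_mult[symmetric] matrix_inv_cancel del: conj_mat_mult)

lemma quaternionic_matrix_inv:
  assumes A: "quaternionic A" "invertible A" shows "quaternionic (matrix_inv A)"
proof -
  let ?R = "matrix_inv A" and ?S = "matrix_inv (conj_mat A)"
  have "?R ** J = ?R ** (J ** conj_mat A) ** ?S"
    by (simp add: matrix_mul_assoc[symmetric] matrix_inv_cancel[OF invertible_conj_mat[OF A(2)]])
  also have "\<dots> = ?R ** A ** J ** ?S"
    unfolding A(1)[unfolded quaternionic_def, symmetric] by (simp only: matrix_mul_assoc)
  also have "\<dots> = J ** conj_mat ?R" by (simp add: matrix_inv_cancel[OF A(2)] conj_mat_matrix_inv[OF A(2)])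
  finally show ?thesis by (simp add: quaternionic_def)
qed

text \<open>The Euclidean inner product of the matrix type is the trace form that defines
  \<open>Sp_metric\<close>, so metric questions on \<open>Sp\<close> become questions about
  \<open>inner\<close> after left translation.\<close>

lemma inner_matrix: "inner A B = Re (trace (A ** adj B))" for A B :: "complex^'l^'k"
  by (simp add: inner_vec_def trace_def matrix_matrix_mult_def inner_complex_def)

lemma trace_mult_commute: "trace (A ** B) = trace (B ** A)" for A :: "'a::comm_semiring_1^'l^'k" and B :: "'a^'k^'l"
  unfolding trace_def matrix_matrix_mult_def by (simp, subst sum.swap, simp add: mult.commute)

lemma inner_mult_left: "inner (A ** B) C = inner B (adj A ** C)"
  for A :: "complex^'l^'k" and B :: "complex^'m^'l" and C :: "complex^'m^'k"
  using trace_mult_commute[of A "B ** adj C"] by (simp add: inner_matrix matrix_mul_assoc[symmetric])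

lemma inner_adj: "inner (adj A) (adj B) = inner A B"
proof -
  have "trace (adj A ** B) = cnj (trace (A ** adj B))"
    by (simp add: trace_mult_commute[of "adj A"]) (simp add: trace_def matrix_matrix_mult_def mult.commute)
  then show ?thesis by (simp add: inner_matrix)
qed

lemma inner_mult_right: "inner (B ** A) C = inner B (C ** adj A)"
  for A :: "complex^'l^'k" and B :: "complex^'k^'m" and C :: "complex^'l^'m"
  using inner_mult_left[of "adj A" "adj B" "adj C"] inner_adj[of "B ** A" C] inner_adj[of B "C ** adj A"]
  by simp

lemma inner_conj_mat: "inner (conj_mat A) (conj_mat B) = inner A B"
  by (simp add: inner_vec_def inner_complex_def)

lemma unitary_matrix_inv: "unitary q \<Longrightarrow> matrix_inv q = adj q"
  by (simp add: unitary_def matrix_inv_unique(1))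

lemma unitary_cancel:
  assumes "unitary q"
  shows "q ** adj q = mat 1" "adj q ** q = mat 1" "q ** (adj q ** A) = A" "adj q ** (q ** A) = A"
    "B ** q ** adj q = B" "B ** adj q ** q = B"
  using assms by (auto simp: unitary_def matrix_mul_assoc) (auto simp: matrix_mul_assoc[symmetric])

lemma Sp_metric_unitary: "unitary q \<Longrightarrow> Sp_metric q (q ** X) (q ** Y) = inner X Y"
  by (simp add: Sp_metric_def inner_matrix unitary_matrix_inv unitary_cancel)

lemma unitary_mult: "unitary p \<Longrightarrow> unitary q \<Longrightarrow> unitary (p ** q)"
  by (simp add: unitary_def) (metis matrix_mul_assoc matrix_mul_lid)

lemma unitary_adj: "unitary p \<Longrightarrow> unitary (adj p)"
  by (simp add: unitary_def)

lemma Sp_mult: "p \<in> Sp \<Longrightarrow> q \<in> Sp \<Longrightarrow> p ** q \<in> Sp"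
  by (simp add: Sp_iff unitary_mult quaternionic_mult)

lemma Sp_adj: "p \<in> Sp \<Longrightarrow> adj p \<in> Sp"
  by (simp add: Sp_iff unitary_adj quaternionic_adj)

lemma Sp_1: "mat 1 \<in> Sp"
  by (simp add: Sp_iff unitary_def quaternionic_1)

section \<open>The Cayley transform\<close>

text \<open>A rational substitute for the exponential map: it sends the Lie algebra into
  \<open>Sp\<close> and is compatible with conjugation by an involution. Its derivative at 0 is
  twice the identity, whence the parameter \<open>t / 2\<close> in the curves below.\<close>

definition cayley :: "complex^'n^'n \<Rightarrow> complex^'n::finite^'n" where
  "cayley Z = (mat 1 + Z) ** matrix_inv (mat 1 - Z)"

text \<open>A skew-Hermitian matrix has no eigenvalue 1: from Z x = x, moving \<open>Z\<close> to
  the other side of the inner product gives that the squared length of x equals its own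
  negative.\<close>

lemma invertible_1_minus_skew:
  assumes Z: "adj Z = - Z" shows "invertible (mat 1 - Z)"
proof -
  have "x = 0" if x: "(mat 1 - Z) *v x = 0" for x
  proof -
    \<comment> \<open>The vector is repeated in every column so that the inner product rules for
      matrices apply.\<close>
    define X :: "complex^'a^'a" where "X = (\<chi> i j. x $ i)"
    have "(mat 1 - Z) ** X = 0" using x by (simp add: X_def vec_eq_iff matrix_matrix_mult_def matrix_vector_mult_def)
    then have ZX: "Z ** X = X" by (simp add: matrix_mult_simps)
    have "inner X X = inner X (adj Z ** X)" by (metis inner_mult_left ZX)
    then have "inner X X = - inner X X" by (simp add: Z ZX matrix_mult_simps)
    then have "X = 0" by simp
    then show "x = 0" by (auto simp: X_def vec_eq_iff)
  qed
  then show ?thesis using matrix_left_invertible_ker invertible_left_inverse by blast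
qed

lemma invertible_1_plus_skew: "adj Z = - Z \<Longrightarrow> invertible (mat 1 + Z)"
  using invertible_1_minus_skew[of "- Z"] by simp

lemma cayley_commute:
  assumes "invertible (mat 1 - Z)"
  shows "cayley Z = matrix_inv (mat 1 - Z) ** (mat 1 + Z)"
proof -
  let ?A = "mat 1 - Z" and ?B = "mat 1 + Z"
  let ?R = "matrix_inv ?A"
  have "?R ** ?B = ?R ** ?B ** (?A ** ?R)" by (simp add: matrix_inv_cancel[OF assms])
  also have "\<dots> = ?R ** (?B ** ?A) ** ?R" by (simp only: matrix_mul_assoc)
  also have "?B ** ?A = ?A ** ?B" by (simp add: matrix_mult_simps)
  also have "?R ** (?A ** ?B) ** ?R = ?B ** ?R" by (simp add: matrix_mul_assoc matrix_inv_cancel[OF assms])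
  finally show ?thesis by (simp add: cayley_def)
qed

lemma adj_cayley: assumes "adj Z = - Z" shows "adj (cayley Z) = cayley (- Z)"
  using cayley_commute[of "- Z"] invertible_1_plus_skew[OF assms]
  by (simp add: cayley_def adj_matrix_inv[OF invertible_1_minus_skew[OF assms]] assms)

lemma cayley_mult_minus:
  assumes "invertible (mat 1 - Z)" "invertible (mat 1 + Z)"
  shows "cayley Z ** cayley (- Z) = mat 1"
proof -
  have "cayley Z ** cayley (- Z) =
      (mat 1 + Z) ** (matrix_inv (mat 1 - Z) ** (mat 1 - Z)) ** matrix_inv (mat 1 + Z)"
    by (simp add: cayley_def matrix_mul_assoc)
  then show ?thesis by (simp add: matrix_inv_cancel[OF assms(1)] matrix_inv_cancel[OF assms(2)])
qed

lemma unitary_cayley: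
  assumes "adj Z = - Z" shows "unitary (cayley Z)"
  using cayley_mult_minus[of Z] cayley_mult_minus[of "- Z"] invertible_1_minus_skew[OF assms] invertible_1_plus_skew[OF assms]
  by (simp add: unitary_def adj_cayley[OF assms])

lemma quaternionic_cayley: "adj Z = - Z \<Longrightarrow> quaternionic Z \<Longrightarrow> quaternionic (cayley Z)"
  unfolding cayley_def
  by (intro quaternionic_mult quaternionic_diff quaternionic_add quaternionic_matrix_inv quaternionic_1 invertible_1_minus_skew)

lemma cayley_conjugate:
  assumes E: "E ** E = mat 1" and Z: "invertible (mat 1 - Z)"
  shows "E ** cayley Z ** E = cayley (E ** Z ** E)"
proof -
  have *: "mat 1 - E ** Z ** E = E ** (mat 1 - Z) ** E" by (simp add: matrix_mult_simps E)
  have "matrix_inv (mat 1 - E ** Z ** E) = E ** matrix_inv (mat 1 - Z) ** E"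
    unfolding *
  proof (rule matrix_inv_unique(1))
    have "E ** (mat 1 - Z) ** E ** (E ** matrix_inv (mat 1 - Z) ** E)
        = E ** (mat 1 - Z) ** (E ** E) ** matrix_inv (mat 1 - Z) ** E" by (simp only: matrix_mul_assoc)
    also have "\<dots> = E ** ((mat 1 - Z) ** matrix_inv (mat 1 - Z)) ** E" by (simp only: E matrix_mul_rid matrix_mul_assoc)
    finally show "E ** (mat 1 - Z) ** E ** (E ** matrix_inv (mat 1 - Z) ** E) = mat 1"
      by (simp add: matrix_inv_cancel[OF Z] E)
  qed
  then have "cayley (E ** Z ** E) = (mat 1 + E ** Z ** E) ** (E ** matrix_inv (mat 1 - Z) ** E)"
    by (simp add: cayley_def)
  also have "mat 1 + E ** Z ** E = E ** (mat 1 + Z) ** E" by (simp add: matrix_mult_simps E)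
  also have "E ** (mat 1 + Z) ** E ** (E ** matrix_inv (mat 1 - Z) ** E) =
      E ** (mat 1 + Z) ** (E ** E) ** matrix_inv (mat 1 - Z) ** E" by (simp only: matrix_mul_assoc)
  finally show ?thesis by (simp add: cayley_def E matrix_mul_assoc)
qed

lemma cayley_0: "cayley 0 = mat 1"
  using matrix_inv_unique(1)[of "mat 1" "mat 1"] by (simp add: cayley_def)

lemma has_derivative_cayley_0: "(cayley has_derivative (\<lambda>H. H + H)) (at 0)"
proof -
  have inv: "matrix_inv (mat 1) = (mat 1 :: complex^'a^'a)" "invertible (mat 1 :: complex^'a^'a)"
    using matrix_inv_unique[of "mat 1" "mat 1"] by auto
  have "((\<lambda>Z :: complex^'a^'a. mat 1 - Z) has_derivative (\<lambda>H. - H)) (at 0)"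
    by (auto intro!: derivative_eq_intros)
  then have R: "((\<lambda>Z :: complex^'a^'a. matrix_inv (mat 1 - Z)) has_derivative (\<lambda>H. H)) (at 0)"
    using has_derivative_matrix_inv[of "\<lambda>Z :: complex^'a^'a. mat 1 - Z" "\<lambda>H. - H" 0 UNIV]
    by (simp add: inv matrix_mult_simps)
  have P: "((\<lambda>Z :: complex^'a^'a. mat 1 + Z) has_derivative (\<lambda>H. H)) (at 0)"
    by (auto intro!: derivative_eq_intros)
  show ?thesis
    unfolding cayley_def[abs_def] using has_derivative_matrix_mult[OF P R] by (simp add: inv)
qed

lemma Ck_on_cayley: "Ck_on k {Z. invertible (mat 1 - Z)} cayley"
proof -
  let ?S = "{Z :: complex^'a^'a. invertible (mat 1 - Z)}"
  have S: "open ?S"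
    using open_vimage[OF open_invertible, of "\<lambda>Z :: complex^'a^'a. mat 1 - Z"]
    by (simp add: vimage_def continuous_intros)
  have "Ck_on k ?S (\<lambda>Z. mat 1 + - Z)"
    by (rule Ck_on_add[OF S Ck_on_const Ck_on_bounded_linear_id[OF bounded_linear_minus[OF bounded_linear_ident] S]])
  then have "Ck_on k ?S (\<lambda>Z. matrix_inv (mat 1 - Z))"
    by (intro Ck_on_matrix_inv_compose[OF S]) simp_all
  from Ck_on_bilinear[OF bounded_bilinear_matrix_mult S
      Ck_on_add[OF S Ck_on_const Ck_on_bounded_linear_id[OF bounded_linear_ident S]] this]
  show ?thesis by (simp add: cayley_def[abs_def])
qed

lemma cayley_curve:
  assumes "adj Z = - Z"
  shows "((\<lambda>t. q ** cayley ((t / 2) *\<^sub>R Z)) has_vector_derivative q ** Z) (at 0)"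
proof -
  have "((\<lambda>t :: real. (t / 2) *\<^sub>R Z) has_derivative (\<lambda>h. (h / 2) *\<^sub>R Z)) (at 0)"
    by (auto intro!: derivative_eq_intros)
  moreover have "(cayley has_derivative (\<lambda>H. H + H)) (at ((0 / 2) *\<^sub>R Z))"
    using has_derivative_cayley_0 by (simp only: div_0 scaleR_zero_left)
  ultimately have "((\<lambda>t. cayley ((t / 2) *\<^sub>R Z)) has_derivative (\<lambda>h. (h / 2) *\<^sub>R Z + (h / 2) *\<^sub>R Z)) (at 0)"
    by (rule has_derivative_compose)
  then have "((\<lambda>t. cayley ((t / 2) *\<^sub>R Z)) has_derivative (\<lambda>h. h *\<^sub>R Z)) (at 0)"
    by (simp only: scaleR_add_left[symmetric] field_sum_of_halves)
  from bounded_linear.has_derivative[OF bounded_linear_matrix_mult_right this, of q]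
  show ?thesis by (simp add: has_vector_derivative_def matrix_mult_simps)
qed

section \<open>Horizontal spaces and the projection matrix\<close>

lemma inner_unitary:
  assumes "unitary u"
  shows "inner (u ** A) (u ** B) = inner A B" "inner (A ** u) (B ** u) = inner A B"
  by (simp add: inner_mult_left unitary_cancel[OF assms], simp add: inner_mult_right unitary_cancel[OF assms])

lemma I_hat_simps [simp]:
  "I_hat ** I_hat = mat 1" "adj I_hat = I_hat" "conj_mat I_hat = I_hat"
  by (simp_all add: I_hat_def I_mn_def block_mult block_simps matrix_mult_simps)

lemma quaternionic_I_hat: "quaternionic I_hat"
  by (simp add: quaternionic_def I_hat_def J_def I_mn_def block_mult block_simps matrix_mult_simps)

lemma unitary_I_hat: "unitary I_hat"
  by (simp add: unitary_def)

definition lie_sp :: "(complex^('k::finite + 'k)^('k + 'k)) set" where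
  "lie_sp = {Z. quaternionic Z \<and> adj Z = - Z}"

definition lie_k :: "('m::finite, 'n::finite) cmat set" where
  "lie_k = {Z \<in> lie_sp. I_hat ** Z ** I_hat = Z}"

definition lie_p :: "('m::finite, 'n::finite) cmat set" where
  "lie_p = {Z \<in> lie_sp. I_hat ** Z ** I_hat = - Z}"

lemma curve_in_kernel:
  fixes L :: "'a::real_normed_vector \<Rightarrow> 'b::real_normed_vector"
  assumes "bounded_linear L" "\<And>t. L (c t) = 0" "(c has_vector_derivative v) (at 0)"
  shows "L v = 0"
  using bounded_linear.has_vector_derivative[OF assms(1,3)] assms(2)
  by (simp add: has_vector_derivative_const vector_derivative_unique_at)

text \<open>Both defining conditions of \<open>Sp\<close>, the linear one and the quadratic one, are
  differentiated along a curve. The set \<open>G\<close> is left general to cover the fibres as well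
  as \<open>Sp\<close> itself.\<close>

lemma tangent_space_unitary:
  assumes q: "q \<in> Sp" and G: "G \<subseteq> Sp" "X \<in> tangent_space_at G q"
  shows "adj q ** X \<in> lie_sp"
proof -
  obtain c where c: "range c \<subseteq> G" "c 0 = q" "(c has_vector_derivative X) (at 0)"
    using G(2) by (auto simp: tangent_space_at_def)
  have cSp: "c t \<in> Sp" for t using c(1) G(1) by auto
  have "X ** J - J ** conj_mat X = 0"
  proof (rule curve_in_kernel[OF _ _ c(3)])
    show "bounded_linear (\<lambda>A :: complex^('a + 'a)^('a + 'a). A ** J - J ** conj_mat A)"
      by (intro bounded_linear_sub bounded_linear_matrix_mult_left
          bounded_linear_compose[OF bounded_linear_matrix_mult_right] bounded_linear_conj_mat)
    show "c t ** J - J ** conj_mat (c t) = 0" for t using cSp[of t] by (simp add: Sp_iff quaternionic_def)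
  qed
  then have X: "quaternionic X" by (simp add: quaternionic_def)
  have "((\<lambda>t. adj (c t) ** c t) has_vector_derivative (adj q ** X + adj X ** q)) (at 0)"
    using has_derivative_matrix_mult[OF bounded_linear.has_derivative[OF bounded_linear_adj c(3)[unfolded has_vector_derivative_def]] c(3)[unfolded has_vector_derivative_def]]
    by (simp add: has_vector_derivative_def c(2) matrix_mult_simps scaleR_add_right)
  moreover have "(\<lambda>t. adj (c t) ** c t) = (\<lambda>t. mat 1)" using cSp by (auto simp: Sp_iff unitary_def)
  ultimately have "adj q ** X + adj X ** q = 0"
    using vector_derivative_unique_at has_vector_derivative_const by metis
  then have "adj (adj q ** X) = - (adj q ** X)" by (simp add: eq_neg_iff_add_eq_0 add.commute)
  with X q show ?thesis by (simp add: lie_sp_def Sp_iff quaternionic_mult quaternionic_adj)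
qed

lemma Sp_cayley: "Z \<in> lie_sp \<Longrightarrow> cayley (t *\<^sub>R Z) \<in> Sp"
  by (simp add: Sp_iff lie_sp_def unitary_cayley quaternionic_cayley quaternionic_scaleR)

lemma tangent_space_Sp:
  assumes q: "q \<in> Sp" shows "tangent_space_at Sp q = (\<lambda>Z. q ** Z) ` lie_sp"
proof (intro equalityI subsetI)
  fix X assume "X \<in> tangent_space_at Sp q"
  then have "adj q ** X \<in> lie_sp" by (rule tangent_space_unitary[OF q subset_refl])
  moreover have "X = q ** (adj q ** X)" using q by (simp add: Sp_iff unitary_cancel)
  ultimately show "X \<in> (\<lambda>Z. q ** Z) ` lie_sp" by blast
next
  fix X assume "X \<in> (\<lambda>Z. q ** Z) ` lie_sp"
  then obtain Z where Z: "Z \<in> lie_sp" "X = q ** Z" by blast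
  have "((\<lambda>t. q ** cayley ((t / 2) *\<^sub>R Z)) has_vector_derivative X) (at 0)"
    using Z cayley_curve[of Z q] by (simp add: lie_sp_def)
  moreover have "range (\<lambda>t. q ** cayley ((t / 2) *\<^sub>R Z)) \<subseteq> Sp" using Sp_mult[OF q Sp_cayley[OF Z(1)]] by blast
  ultimately show "X \<in> tangent_space_at Sp q"
    unfolding tangent_space_at_def by (intro CollectI exI[of _ "\<lambda>t. q ** cayley ((t / 2) *\<^sub>R Z)"]) (simp add: cayley_0)
qed

lemma coset_subset_Sp: "q \<in> Sp \<Longrightarrow> coset q \<subseteq> Sp"
  by (auto simp: coset_def Sp_times_Sp_def Sp_mult)

lemma tangent_space_coset:
  assumes q: "q \<in> Sp" shows "tangent_space_at (coset q) q = (\<lambda>Z. q ** Z) ` lie_k"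
proof (intro equalityI subsetI)
  fix X assume X: "X \<in> tangent_space_at (coset q) q"
  have sp: "adj q ** X \<in> lie_sp" by (rule tangent_space_unitary[OF q coset_subset_Sp[OF q] X])
  obtain c where c: "range c \<subseteq> coset q" "(c has_vector_derivative X) (at 0)"
    using X by (auto simp: tangent_space_at_def)
  let ?L = "\<lambda>A. I_hat ** (adj q ** A) ** I_hat - adj q ** A"
  have "?L X = 0"
  proof (rule curve_in_kernel[OF _ _ c(2)])
    show "bounded_linear ?L"
      by (intro bounded_linear_sub bounded_linear_matrix_mult_right
          bounded_linear_compose[OF bounded_linear_matrix_mult_right]
          bounded_linear_compose[OF bounded_linear_matrix_mult_left])
    show "?L (c t) = 0" for t
    proof -
      obtain k where "c t = q ** k" "k \<in> Sp_times_Sp" using c(1) by (auto simp: coset_def)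
      then show ?thesis using q by (simp add: Sp_times_Sp_def unitary_cancel Sp_iff)
    qed
  qed
  then have "adj q ** X \<in> lie_k" using sp by (simp add: lie_k_def)
  moreover have "X = q ** (adj q ** X)" using q by (simp add: Sp_iff unitary_cancel)
  ultimately show "X \<in> (\<lambda>Z. q ** Z) ` lie_k" by blast
next
  fix X assume "X \<in> (\<lambda>Z. q ** Z) ` lie_k"
  then obtain Z where Z: "Z \<in> lie_sp" "I_hat ** Z ** I_hat = Z" "X = q ** Z" by (auto simp: lie_k_def)
  have "((\<lambda>t. q ** cayley ((t / 2) *\<^sub>R Z)) has_vector_derivative X) (at 0)"
    using Z cayley_curve[of Z q] by (simp add: lie_sp_def)
  moreover have "cayley (t *\<^sub>R Z) \<in> Sp_times_Sp" for t
    using cayley_conjugate[of I_hat "t *\<^sub>R Z"] invertible_1_minus_skew[of "t *\<^sub>R Z"] Z Sp_cayley[OF Z(1), of t]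
    by (simp add: Sp_times_Sp_def lie_sp_def matrix_mult_simps)
  then have "range (\<lambda>t. q ** cayley ((t / 2) *\<^sub>R Z)) \<subseteq> coset q" by (auto simp: coset_def)
  ultimately show "X \<in> tangent_space_at (coset q) q"
    unfolding tangent_space_at_def by (intro CollectI exI[of _ "\<lambda>t. q ** cayley ((t / 2) *\<^sub>R Z)"]) (simp add: cayley_0)
qed

text \<open>The Cartan decomposition: these are the projections onto the eigenspaces for 1 and -1 of
  conjugation by \<open>I_hat\<close>.\<close>

lemma lie_sp_decompose:
  assumes Z: "Z \<in> lie_sp"
  shows "(1/2) *\<^sub>R (Z + I_hat ** Z ** I_hat) \<in> lie_k" "(1/2) *\<^sub>R (Z - I_hat ** Z ** I_hat) \<in> lie_p"
proof -
  have E: "I_hat ** (I_hat ** Z ** I_hat) ** I_hat = Z"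
    by (simp add: matrix_mul_assoc) (simp add: matrix_mul_assoc[symmetric])
  have a: "adj (I_hat ** Z ** I_hat) = - (I_hat ** Z ** I_hat)"
    using Z by (simp add: lie_sp_def matrix_mult_simps matrix_mul_assoc)
  have qs: "quaternionic Z" "quaternionic (I_hat ** Z ** I_hat)"
    using Z by (auto simp: lie_sp_def intro!: quaternionic_mult quaternionic_I_hat)
  show "(1/2) *\<^sub>R (Z + I_hat ** Z ** I_hat) \<in> lie_k"
    using Z a E qs by (simp add: lie_k_def lie_sp_def matrix_mult_simps quaternionic_add quaternionic_scaleR scaleR_add_right scaleR_diff_right add.commute)
  show "(1/2) *\<^sub>R (Z - I_hat ** Z ** I_hat) \<in> lie_p"
    using Z a E qs by (simp add: lie_p_def lie_sp_def matrix_mult_simps quaternionic_diff quaternionic_scaleR scaleR_diff_right)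
qed

lemma inner_I_hat: "inner (I_hat ** A ** I_hat) (I_hat ** B ** I_hat) = inner A B"
  for A B :: "('m::finite, 'n::finite) cmat"
  by (simp add: inner_unitary[OF unitary_I_hat])

text \<open>Conjugation by \<open>I_hat\<close> is an isometry, so its two eigenspaces are
  orthogonal. Conversely, the \<open>lie_k\<close> component of a horizontal vector is orthogonal to
  itself and hence zero.\<close>

lemma horizontal_space_eq:
  assumes q: "q \<in> Sp" shows "horizontal_space q = (\<lambda>Z. q ** Z) ` lie_p"
proof -
  have u: "unitary q" using q by (simp add: Sp_iff)
  have "q ** Z \<in> horizontal_space q \<longleftrightarrow> Z \<in> lie_p" if Z: "Z \<in> lie_sp" for Z
  proof
    assume "q ** Z \<in> horizontal_space q"
    then have orth: "inner Z V = 0" if "V \<in> lie_k" for V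
      using that by (auto simp: horizontal_space_def tangent_space_coset[OF q] Sp_metric_unitary[OF u])
    define K where "K = (1/2) *\<^sub>R (Z + I_hat ** Z ** I_hat)"
    have K: "K \<in> lie_k" using lie_sp_decompose[OF Z] by (simp add: K_def)
    have EK: "inner (I_hat ** Z ** I_hat) K = inner Z K"
      using inner_I_hat[of Z K] K by (simp add: lie_k_def)
    have "inner K M = (inner Z M + inner (I_hat ** Z ** I_hat) M) / 2" for M
      by (simp add: K_def inner_add_left)
    from this[of K] have "inner K K = 0" unfolding EK orth[OF K] by simp
    then have "K = 0" by simp
    then have "I_hat ** Z ** I_hat = - Z" by (simp add: K_def add_eq_0_iff)
    with Z show "Z \<in> lie_p" by (simp add: lie_p_def)
  next
    assume p: "Z \<in> lie_p"
    have "inner Z V = 0" if "V \<in> lie_k" for V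
      using inner_I_hat[of Z V] p that by (simp add: lie_k_def lie_p_def)
    with Z show "q ** Z \<in> horizontal_space q"
      by (auto simp: horizontal_space_def tangent_space_coset[OF q] tangent_space_Sp[OF q] Sp_metric_unitary[OF u])
  qed
  then show ?thesis
    by (auto simp: horizontal_space_def tangent_space_Sp[OF q] lie_p_def)
qed

section \<open>The reflection attached to a coset, and coordinates on the horizontal space\<close>

text \<open>A Hermitian involution for \<open>q\<close> in \<open>Sp\<close>: the reflection whose
  fixed space is the image under \<open>q\<close> of that of \<open>I_hat\<close>. Hence
  \<open>psi_hat\<close> is an entry of the orthogonal projection onto this subspace.\<close>

definition proj_matrix :: "('m::finite, 'n::finite) cmat \<Rightarrow> ('m, 'n) cmat" where
  "proj_matrix q = q ** I_hat ** adj q"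

lemma Sp_times_Sp_commute: "k \<in> Sp_times_Sp \<Longrightarrow> k ** I_hat = I_hat ** k"
  by (simp add: Sp_times_Sp_def) (metis I_hat_simps(1) matrix_mul_assoc matrix_mul_lid)

lemma proj_matrix_coset:
  assumes "r \<in> coset q" shows "proj_matrix r = proj_matrix q"
proof -
  obtain k where k: "k \<in> Sp_times_Sp" "r = q ** k" using assms by (auto simp: coset_def)
  have "proj_matrix r = q ** (k ** I_hat) ** adj k ** adj q" by (simp add: k(2) proj_matrix_def matrix_mul_assoc)
  also have "\<dots> = q ** I_hat ** (k ** adj k) ** adj q" by (simp add: Sp_times_Sp_commute[OF k(1)] matrix_mul_assoc)
  also have "k ** adj k = mat 1" using k(1) by (simp add: Sp_times_Sp_def Sp_iff unitary_def)
  finally show ?thesis by (simp add: proj_matrix_def)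
qed

lemma self_in_coset: "q \<in> coset q"
  by (auto simp: coset_def Sp_times_Sp_def Sp_1 intro!: image_eqI[of _ _ "mat 1"])

lemma Sp_times_Sp_mult: "k \<in> Sp_times_Sp \<Longrightarrow> l \<in> Sp_times_Sp \<Longrightarrow> k ** l \<in> Sp_times_Sp"
  using Sp_times_Sp_commute[of k] Sp_times_Sp_commute[of l]
  by (simp add: Sp_times_Sp_def Sp_mult) (metis I_hat_simps(1) matrix_mul_assoc matrix_mul_rid)

text \<open>Equality of the two reflections says precisely that \<open>adj q ** r\<close> commutes
  with \<open>I_hat\<close>, that is, lies in \<open>Sp_times_Sp\<close>.\<close>

lemma proj_matrix_eq_iff:
  fixes q r :: "('m::finite, 'n::finite) cmat"
  assumes q: "q \<in> Sp" and r: "r \<in> Sp"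
  shows "proj_matrix q = proj_matrix r \<longleftrightarrow> coset q = coset r"
proof
  assume "coset q = coset r"
  then show "proj_matrix q = proj_matrix r" using proj_matrix_coset[of q r] self_in_coset[of q] by simp
next
  have *: "coset r' \<subseteq> coset q'" if eq: "proj_matrix q' = proj_matrix r'" and qr: "q' \<in> Sp" "r' \<in> Sp"
    for q' r' :: "('m, 'n) cmat"
  proof -
    define k where "k = adj q' ** r'"
    have uq: "unitary q'" and ur: "unitary r'" using qr by (auto simp: Sp_iff)
    have "I_hat ** k = adj q' ** (q' ** I_hat ** adj q') ** r'"
      by (simp add: k_def matrix_mul_assoc unitary_cancel[OF uq])
    also have "\<dots> = adj q' ** (r' ** I_hat ** adj r') ** r'" using eq by (simp add: proj_matrix_def)
    also have "\<dots> = k ** I_hat" by (simp add: k_def matrix_mul_assoc unitary_cancel[OF ur])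
    finally have "I_hat ** k ** I_hat = k" by (simp add: matrix_mul_assoc[symmetric])
    then have k: "k \<in> Sp_times_Sp" using qr by (simp add: Sp_times_Sp_def k_def Sp_mult Sp_adj)
    have "r' = q' ** k" by (simp add: k_def unitary_cancel[OF uq])
    then show ?thesis using Sp_times_Sp_mult[OF k] by (auto simp: coset_def matrix_mul_assoc[symmetric])
  qed
  assume "proj_matrix q = proj_matrix r"
  then show "coset q = coset r" using *[of q r] *[of r q] q r by simp
qed

lemma psi_coset:
  "psi j a (coset q) = (1/2) * (proj_matrix q + mat 1) $ j $ a"
proof -
  have "psi_hat j a ` coset q = {(1/2) * (proj_matrix q + mat 1) $ j $ a}"
    using proj_matrix_coset self_in_coset by (force simp: psi_hat_def proj_matrix_def)
  then show ?thesis by (simp add: psi_def)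
qed

lemma proj_matrix_square: "q \<in> Sp \<Longrightarrow> proj_matrix q ** proj_matrix q = mat 1"
  by (simp add: proj_matrix_def Sp_iff unitary_cancel matrix_mul_assoc)
    (simp add: unitary_cancel matrix_mul_assoc[symmetric])

lemma adj_proj_matrix: "adj (proj_matrix q) = proj_matrix q"
  by (simp add: proj_matrix_def matrix_mul_assoc)

lemma quaternionic_proj_matrix: "q \<in> Sp \<Longrightarrow> quaternionic (proj_matrix q)"
  by (simp add: proj_matrix_def Sp_iff quaternionic_mult quaternionic_I_hat quaternionic_adj)

text \<open>Anticommuting with \<open>I_hat\<close> leaves only the off-diagonal blocks of
  \<open>z\<close> and \<open>w\<close>, and skew-Hermitian symmetry determines the lower ones from
  the upper ones. Two free complex m-by-n blocks remain, which are the 4mn real coordinates of a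
  chart.\<close>

definition lie_p_of :: "real^('m::finite \<times> 'n::finite \<times> 4) \<Rightarrow> ('m, 'n) cmat" where
  "lie_p_of v = (let a = (\<chi> r s. Complex (v $ (r, s, 1)) (v $ (r, s, 2)));
       b = (\<chi> r s. Complex (v $ (r, s, 3)) (v $ (r, s, 4)));
       z = block 0 a (- adj a) 0; w = block 0 b (transpose b) 0
     in block z w (- conj_mat w) (conj_mat z))"

definition lie_p_coords :: "('m::finite, 'n::finite) cmat \<Rightarrow> real^('m \<times> 'n \<times> 4)" where
  "lie_p_coords Z = (\<chi> i. case i of (r, s, t) \<Rightarrow> if t = 1 then Re (Z $ Inl (Inl r) $ Inl (Inr s))
     else if t = 2 then Im (Z $ Inl (Inl r) $ Inl (Inr s))
     else if t = 3 then Re (Z $ Inl (Inl r) $ Inr (Inr s))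
     else Im (Z $ Inl (Inl r) $ Inr (Inr s)))"

lemma linear_lie_p_of: "linear lie_p_of"
  by (rule linearI) (simp_all add: lie_p_of_def Let_def vec_eq_iff split_sum_all transpose_def complex_eq_iff)

lemma linear_lie_p_coords: "linear lie_p_coords"
  by (rule linearI) (auto simp: lie_p_coords_def vec_eq_iff)

lemma bounded_linear_lie_p_of: "bounded_linear lie_p_of"
  and bounded_linear_lie_p_coords: "bounded_linear lie_p_coords"
  using linear_lie_p_of linear_lie_p_coords by (simp_all add: linear_conv_bounded_linear)

lemma lie_p_coords_of [simp]: "lie_p_coords (lie_p_of v) = v"
proof -
  have "lie_p_coords (lie_p_of v) $ (r, s, t) = v $ (r, s, t)" for r s t
    using exhaust_4[of t] by (auto simp: lie_p_coords_def lie_p_of_def Let_def)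
  then show ?thesis by (simp add: vec_eq_iff)
qed

lemma lie_p_of_in_lie_p: "lie_p_of v \<in> lie_p"
proof -
  have "adj (lie_p_of v) = - lie_p_of v"
    by (simp add: lie_p_of_def Let_def vec_eq_iff split_sum_all transpose_def)
  moreover have "quaternionic (lie_p_of v)"
    unfolding quaternionic_iff_block lie_p_of_def Let_def by blast
  moreover have "I_hat ** lie_p_of v ** I_hat = - lie_p_of v"
    by (simp add: lie_p_of_def Let_def I_hat_def I_mn_def block_mult block_simps matrix_mult_simps)
  ultimately show ?thesis by (simp add: lie_p_def lie_sp_def)
qed

lemma lie_p_of_coords:
  assumes "Z \<in> lie_p" shows "lie_p_of (lie_p_coords Z) = Z"
proof -
  obtain z w where Z: "Z = block z w (- conj_mat w) (conj_mat z)"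
    using assms by (auto simp: lie_p_def lie_sp_def quaternionic_iff_block)
  obtain a b c d where z: "z = block a b c d" by (rule block_exhaust)
  obtain a' b' c' d' where w: "w = block a' b' c' d'" by (rule block_exhaust)
  have adj: "adj Z = - Z" and E: "I_hat ** Z ** I_hat = - Z" using assms by (auto simp: lie_p_def lie_sp_def)
  have double: "2 * x = 0 \<longleftrightarrow> x = 0" for x :: "complex^'x^'y"
    by (simp add: vec_eq_iff)
  have 0: "a = 0" "d = 0" "a' = 0" "d' = 0"
    using E by (simp_all add: Z z w I_hat_def I_mn_def block_mult block_simps matrix_mult_simps block_eq_iff double)
  have "adj c = - b \<and> adj b = - c" "adj (conj_mat c') = b' \<and> adj (conj_mat b') = c'"
    using adj by (simp_all add: Z z w 0 block_simps block_eq_iff)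
  moreover have "adj (conj_mat b') = transpose b'" by (simp add: vec_eq_iff transpose_def)
  ultimately have c: "c = - adj b" "c' = transpose b'" by (metis minus_minus, metis)
  have "(\<chi> r s. Complex (lie_p_coords Z $ (r, s, 1)) (lie_p_coords Z $ (r, s, 2))) = b"
    "(\<chi> r s. Complex (lie_p_coords Z $ (r, s, 3)) (lie_p_coords Z $ (r, s, 4))) = b'"
    by (simp_all add: lie_p_coords_def Z z w vec_eq_iff)
  then show ?thesis unfolding lie_p_of_def Let_def by (simp add: Z z w 0 c)
qed

section \<open>Smooth charts of the Grassmannian\<close>

lemma coset_eq: "q \<in> Sp \<Longrightarrow> r \<in> coset q \<Longrightarrow> coset r = coset q"
  using proj_matrix_eq_iff[of r q] proj_matrix_coset coset_subset_Sp by blast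

definition proj_of_coset :: "('m::finite, 'n::finite) cmat set \<Rightarrow> ('m, 'n) cmat" where
  "proj_of_coset P = proj_matrix (SOME q. q \<in> P)"

lemma proj_of_coset: "proj_of_coset (coset q) = proj_matrix q"
  unfolding proj_of_coset_def by (rule proj_matrix_coset) (rule someI[of "\<lambda>r. r \<in> coset q", OF self_in_coset])

lemma lie_p_anticommute:
  assumes "Z \<in> lie_p" shows "I_hat ** Z = - (Z ** I_hat)"
proof -
  have "I_hat ** Z = I_hat ** Z ** (I_hat ** I_hat)" by simp
  also have "\<dots> = (I_hat ** Z ** I_hat) ** I_hat" by (simp only: matrix_mul_assoc)
  also have "\<dots> = - (Z ** I_hat)" using assms by (simp add: lie_p_def matrix_mult_simps)
  finally show ?thesis .
qed

text \<open>Separated from the submersion condition because \<open>derivative_horizontal\<close>,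
  proved here, is the tool by which that condition is verified for the chart constructed in
  \<open>chart_exists\<close>.\<close>

locale grassmannian_prechart =
  fixes U :: "('m::finite, 'n::finite) cmat set set" and x :: "('m, 'n) cmat set \<Rightarrow> real^('m \<times> 'n \<times> 4)"
  assumes U_subset: "U \<subseteq> coset ` Sp"
    and preimage_openin: "openin (top_of_set Sp) {q \<in> Sp. coset q \<in> U}"
    and inj_x: "inj_on x U" and open_image: "open (x ` U)"
    and smooth_x: "smooth_on_subset {q \<in> Sp. coset q \<in> U} (x \<circ> coset)"
begin

lemma preimage_open: obtains T where "open T" "{q \<in> Sp. coset q \<in> U} = Sp \<inter> T"
  using preimage_openin by (auto simp: openin_open)

lemma smooth_extension:
  assumes "q \<in> Sp" "coset q \<in> U"
  obtains T f where "open T" "q \<in> T" "smooth_on T f" "\<And>r. r \<in> Sp \<Longrightarrow> r \<in> T \<Longrightarrow> coset r \<in> U \<and> f r = x (coset r)"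
proof -
  obtain T where T: "open T" "{q \<in> Sp. coset q \<in> U} = Sp \<inter> T" by (rule preimage_open)
  obtain V f where V: "open V" "q \<in> V" "smooth_on V f" "\<forall>y\<in>{q \<in> Sp. coset q \<in> U} \<inter> V. f y = (x \<circ> coset) y"
    using bspec[OF smooth_x[unfolded smooth_on_subset_def], of q] assms by auto
  show thesis
  proof
    show "open (T \<inter> V)" using T V by auto
    show "q \<in> T \<inter> V" using T V assms by auto
    show "smooth_on (T \<inter> V) f" using V(3) by (auto simp: smooth_on_def intro: Ck_on_mono[of _ V])
    show "coset r \<in> U \<and> f r = x (coset r)" if "r \<in> Sp" "r \<in> T \<inter> V" for r
    proof -
      have "r \<in> {q \<in> Sp. coset q \<in> U}" using T that by blast
      then show ?thesis using V(4) that by auto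
    qed
  qed
qed

lemma coset_diff_deriv:
  assumes q: "q \<in> Sp" "coset q \<in> U"
  shows "((x \<circ> coset) has_derivative coset_diff x q) (at q within Sp)"
proof -
  obtain T f where T: "open T" "q \<in> T" "smooth_on T f" "\<And>r. r \<in> Sp \<Longrightarrow> r \<in> T \<Longrightarrow> coset r \<in> U \<and> f r = x (coset r)"
    using smooth_extension[OF q] by blast
  obtain d where d: "d > 0" "ball q d \<subseteq> T" using T(1,2) open_contains_ball by blast
  have "Ck_on (Suc 0) T f" using T(3) by (simp only: smooth_on_def)
  then have "(f has_derivative frechet_derivative f (at q)) (at q within Sp)"
    using Ck_on_differentiable T(2) has_derivative_at_withinI by blast
  then have "((x \<circ> coset) has_derivative frechet_derivative f (at q)) (at q within Sp)"
  proof (rule has_derivative_transform_within[OF _ d(1) q(1)])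
    fix r assume r: "r \<in> Sp" "dist r q < d"
    then have "r \<in> T" using d(2) by (auto simp: dist_commute)
    then show "f r = (x \<circ> coset) r" using T(4) r(1) by simp
  qed
  then have "(x \<circ> coset) differentiable (at q within Sp)" by (auto simp: differentiable_def)
  then show ?thesis unfolding coset_diff_def by (simp add: frechet_derivative_works)
qed

lemma linear_coset_diff: "q \<in> Sp \<Longrightarrow> coset q \<in> U \<Longrightarrow> linear (coset_diff x q)"
  using coset_diff_deriv has_derivative_linear by blast

lemma coset_diff_compose:
  assumes "s w \<in> Sp" "coset (s w) \<in> U" "range s \<subseteq> Sp" "(s has_derivative s') (at w)"
  shows "((\<lambda>u. x (coset (s u))) has_derivative (\<lambda>h. coset_diff x (s w) (s' h))) (at w)"
  using has_derivative_in_compose[OF assms(4), of "x \<circ> coset"] 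
    has_derivative_subset[OF coset_diff_deriv[OF assms(1,2)] assms(3)] by simp

lemma coset_diff_curve:
  assumes "range s \<subseteq> Sp" "coset (s 0) \<in> U" "(s has_vector_derivative X) (at 0)"
  shows "((\<lambda>t. x (coset (s t))) has_vector_derivative coset_diff x (s 0) X) (at 0)"
proof -
  have s: "s 0 \<in> Sp" using assms(1) by auto
  show ?thesis
    using coset_diff_compose[OF s assms(2,1) assms(3)[unfolded has_vector_derivative_def]]
    by (simp add: has_vector_derivative_def linear_cmul[OF linear_coset_diff[OF s assms(2)]])
qed

text \<open>\<open>G_eq\<close> is differentiated along a Cayley curve with velocity
  \<open>q ** Z\<close>. As \<open>Z\<close> anticommutes with \<open>I_hat\<close>, the two terms
  of the product rule coincide, which produces \<open>Z + Z\<close>. \<open>G\<close> is general so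
  as to cover both the map \<open>F\<close> of a given chart and the explicit map used to construct
  one.\<close>

lemma derivative_horizontal:
  assumes q: "q \<in> Sp" "coset q \<in> U" and Z: "Z \<in> lie_p"
    and G: "(G has_derivative G') (at (x (coset q)))"
    and G_eq: "\<And>r. r \<in> Sp \<Longrightarrow> coset r \<in> U \<Longrightarrow> G (x (coset r)) = proj_matrix r"
  shows "G' (coset_diff x q (q ** Z)) = q ** (Z + Z) ** I_hat ** adj q"
proof -
  have Zs: "Z \<in> lie_sp" "adj Z = - Z" using Z by (auto simp: lie_p_def lie_sp_def)
  define c where "c = (\<lambda>t. q ** cayley ((t / 2) *\<^sub>R Z))"
  have c: "range c \<subseteq> Sp" "c 0 = q" "(c has_vector_derivative q ** Z) (at 0)"
    using cayley_curve[OF Zs(2)] Sp_mult[OF q(1) Sp_cayley[OF Zs(1)]] by (auto simp: c_def cayley_0)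
  have xc: "((\<lambda>t. x (coset (c t))) has_vector_derivative coset_diff x q (q ** Z)) (at 0)"
    using coset_diff_curve[OF c(1) _ c(3)] c(2) q(2) by simp
  have "((\<lambda>t. G (x (coset (c t)))) has_derivative (\<lambda>t. G' (t *\<^sub>R coset_diff x q (q ** Z)))) (at 0)"
    by (rule has_derivative_compose[OF xc[unfolded has_vector_derivative_def]]) (simp add: c(2) G)
  then have 1: "((\<lambda>t. G (x (coset (c t)))) has_vector_derivative G' (coset_diff x q (q ** Z))) (at 0)"
    using has_derivative_linear[OF G] by (simp add: has_vector_derivative_def linear_cmul)
  \<comment> \<open>\<open>G_eq\<close> is available only over \<open>U\<close>; openness of the
    preimage and continuity of the curve place it there for small \<open>t\<close>.\<close>
  obtain T where T: "open T" "{q \<in> Sp. coset q \<in> U} = Sp \<inter> T" by (rule preimage_open)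
  have "isCont c 0" using c(3) has_derivative_continuous by (auto simp: has_vector_derivative_def)
  then have "eventually (\<lambda>t. c t \<in> T) (at 0)"
    using T q c(2) by (auto simp: isCont_def intro: topological_tendstoD)
  then obtain d where d: "d > 0" "\<And>t. t \<noteq> 0 \<Longrightarrow> dist t 0 < d \<Longrightarrow> c t \<in> T" unfolding eventually_at by auto
  have "c t \<in> T" if "dist t 0 < d" for t using d(2)[of t] that c(2) T q by (cases "t = 0") auto
  then have *: "G (x (coset (c t))) = proj_matrix (c t)" if "dist t 0 < d" for t
    using T(2) c(1) that by (intro G_eq) blast+
  have "((\<lambda>t. proj_matrix (c t)) has_vector_derivative G' (coset_diff x q (q ** Z))) (at 0)"
    using has_derivative_transform_within[OF 1[unfolded has_vector_derivative_def] d(1)] * by (simp add: has_vector_derivative_def)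
  moreover have "((\<lambda>t. proj_matrix (c t)) has_vector_derivative (q ** I_hat ** adj (q ** Z) + q ** Z ** I_hat ** adj q)) (at 0)"
    using has_derivative_matrix_mult[OF bounded_linear.has_derivative[OF bounded_linear_matrix_mult_left c(3)[unfolded has_vector_derivative_def], of I_hat]
        bounded_linear.has_derivative[OF bounded_linear_adj c(3)[unfolded has_vector_derivative_def]]]
    by (simp add: proj_matrix_def has_vector_derivative_def c(2) matrix_mult_simps scaleR_add_right)
  ultimately have D: "G' (coset_diff x q (q ** Z)) = q ** I_hat ** adj (q ** Z) + q ** Z ** I_hat ** adj q"
    by (rule vector_derivative_unique_at)
  have "q ** I_hat ** adj (q ** Z) = - (q ** (I_hat ** Z) ** adj q)"
    by (simp add: Zs(2) matrix_mult_simps matrix_mul_assoc)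
  also have "\<dots> = q ** Z ** I_hat ** adj q" by (simp add: lie_p_anticommute[OF Z] matrix_mult_simps matrix_mul_assoc)
  finally show ?thesis unfolding D by (simp only: matrix_mult_simps)
qed

end

locale grassmannian_chart = grassmannian_prechart U x
  for U :: "('m::finite, 'n::finite) cmat set set" and x :: "('m, 'n) cmat set \<Rightarrow> real^('m \<times> 'n \<times> 4)" +
  assumes submersion: "\<And>q. q \<in> Sp \<Longrightarrow> coset q \<in> U \<Longrightarrow> coset_diff x q ` tangent_space_at Sp q = UNIV"

lemma grassmannian_chart_iff: "(U, x) \<in> grassmannian_charts \<longleftrightarrow> grassmannian_chart U x"
  unfolding grassmannian_charts_def grassmannian_chart_def grassmannian_prechart_def grassmannian_chart_axioms_def
  by auto

section \<open>Local sections over a chart and smoothness of the reflection in its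
  coordinates\<close>

context grassmannian_chart
begin

lemma coset_diff_lie_k:
  assumes q: "q \<in> Sp" "coset q \<in> U" and Z: "Z \<in> lie_k"
  shows "coset_diff x q (q ** Z) = 0"
proof -
  have "q ** Z \<in> tangent_space_at (coset q) q" using Z by (simp add: tangent_space_coset[OF q(1)])
  then obtain c where c: "range c \<subseteq> coset q" "c 0 = q" "(c has_vector_derivative q ** Z) (at 0)"
    by (auto simp: tangent_space_at_def)
  have "((\<lambda>t. x (coset (c t))) has_vector_derivative coset_diff x (c 0) (q ** Z)) (at 0)"
    using c coset_subset_Sp[OF q(1)] q(2) by (intro coset_diff_curve) auto
  moreover have "(\<lambda>t. x (coset (c t))) = (\<lambda>t. x (coset q))"
    using c(1) coset_eq[OF q(1)] by (metis rangeI subsetD)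
  ultimately show ?thesis
    using c(2) has_vector_derivative_const vector_derivative_unique_at by metis
qed

lemma coset_diff_lie_p_surj:
  assumes q: "q \<in> Sp" "coset q \<in> U"
  shows "\<exists>Z\<in>lie_p. coset_diff x q (q ** Z) = v"
proof -
  obtain X where X: "X \<in> tangent_space_at Sp q" "coset_diff x q X = v"
    using submersion[OF q] by (metis UNIV_I imageE)
  obtain Z where Z: "Z \<in> lie_sp" "X = q ** Z" using X(1) by (auto simp: tangent_space_Sp[OF q(1)])
  define K P where "K = (1/2) *\<^sub>R (Z + I_hat ** Z ** I_hat)" and "P = (1/2) *\<^sub>R (Z - I_hat ** Z ** I_hat)"
  have KP: "K \<in> lie_k" "P \<in> lie_p" using lie_sp_decompose[OF Z(1)] by (auto simp: K_def P_def)
  have "K + P = (1/2) *\<^sub>R (Z + Z)"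
    unfolding K_def P_def scaleR_add_right[symmetric] by simp
  then have "Z = K + P" by (simp only: scaleR_half_double)
  then have "q ** Z = q ** K + q ** P" by (simp only: matrix_mult_simps)
  then have "coset_diff x q (q ** P) = v"
    using X(2) Z(2) coset_diff_lie_k[OF q KP(1)] linear_add[OF linear_coset_diff[OF q]] by simp
  then show ?thesis using KP(2) by blast
qed

text \<open>Vertical directions are annihilated, so the submersion condition makes the horizontal
  ones cover all of coordinate space; equality of dimensions upgrades surjective to
  bijective.\<close>

lemma coset_diff_bij:
  assumes q: "q \<in> Sp" "coset q \<in> U"
  shows "bij (\<lambda>v. coset_diff x q (q ** lie_p_of v))"
proof -
  let ?h = "\<lambda>v. coset_diff x q (q ** lie_p_of v)"
  have lin: "linear ?h"
    using linear_compose[OF linear_compose[OF linear_lie_p_of bounded_linear.linear[OF bounded_linear_matrix_mult_right]]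
      linear_coset_diff[OF q]] by (simp add: o_def)
  have "\<exists>w. v = ?h w" for v
    using coset_diff_lie_p_surj[OF q, of v] lie_p_of_coords by metis
  then have "surj ?h" by (simp add: surj_def)
  then show ?thesis using linear_surjective_imp_injective[OF lin] by (simp add: bij_def)
qed

text \<open>The slice \<open>q ** cayley (lie_p_of u)\<close> is transversal to the fibres. Read
  through the chart it is a smooth map between open subsets of the same coordinate space with
  surjective differential at 0; its local inverse followed by the slice is the section.\<close>

lemma local_section:
  assumes q: "q \<in> Sp" "coset q \<in> U"
  obtains V s where "open V" "x (coset q) \<in> V" "smooth_on V s"
    "\<And>y. y \<in> V \<Longrightarrow> s y \<in> Sp \<and> coset (s y) \<in> U \<and> x (coset (s y)) = y"
proof -
  obtain T f where T: "open T" "q \<in> T" "smooth_on T f" "\<And>r. r \<in> Sp \<Longrightarrow> r \<in> T \<Longrightarrow> coset r \<in> U \<and> f r = x (coset r)"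
    using smooth_extension[OF q] by blast
  define \<sigma> where "\<sigma> u = q ** cayley (lie_p_of u)" for u
  have skew: "adj (lie_p_of u) = - lie_p_of u" "lie_p_of u \<in> lie_sp" for u :: "real^('m \<times> 'n \<times> 4)"
    using lie_p_of_in_lie_p[of u] by (auto simp: lie_p_def lie_sp_def)
  have \<sigma>Sp: "\<sigma> u \<in> Sp" for u
    unfolding \<sigma>_def using Sp_mult[OF q(1) Sp_cayley[OF skew(2), of 1]] by simp
  have \<sigma>0: "\<sigma> 0 = q" by (simp add: \<sigma>_def linear_0[OF linear_lie_p_of] cayley_0)
  have Ck\<sigma>: "Ck_on k UNIV \<sigma>" for k
    unfolding \<sigma>_def
  proof (intro Ck_on_bounded_linear[OF bounded_linear_matrix_mult_right] open_UNIV)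
    have "open {Z :: ('m, 'n) cmat. invertible (mat 1 - Z)}"
      using open_vimage[OF open_invertible, of "\<lambda>Z :: ('m, 'n) cmat. mat 1 - Z"]
      by (simp add: vimage_def continuous_intros)
    then show "Ck_on k UNIV (\<lambda>u :: real^('m \<times> 'n \<times> 4). cayley (lie_p_of u))"
      by (rule Ck_on_compose[OF open_UNIV _ _ Ck_on_cayley Ck_on_bounded_linear_id[OF bounded_linear_lie_p_of open_UNIV]])
        (auto simp: skew invertible_1_minus_skew)
  qed
  define W where "W = \<sigma> -` T"
  have W: "open W" "0 \<in> W"
    using open_vimage[OF T(1), of \<sigma>] Ck_on_continuous[OF Ck\<sigma>] T(2) \<sigma>0 by (auto simp: W_def)
  have fW: "f (\<sigma> u) = x (coset (\<sigma> u))" "coset (\<sigma> u) \<in> U" if "u \<in> W" for u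
    using T(4)[OF \<sigma>Sp] that by (auto simp: W_def)
  have smooth: "smooth_on W (\<lambda>u. f (\<sigma> u))"
    unfolding smooth_on_def
  proof
    fix k show "Ck_on k W (\<lambda>u. f (\<sigma> u))"
      by (rule Ck_on_compose[OF W(1) T(1) _ _ Ck_on_mono[OF subset_UNIV Ck\<sigma>]])
        (use T(3) in \<open>auto simp: W_def smooth_on_def\<close>)
  qed
  have "(\<sigma> has_derivative (\<lambda>h. q ** (lie_p_of h + lie_p_of h))) (at 0)"
  proof -
    have "(cayley has_derivative (\<lambda>H. H + H)) (at (lie_p_of (0 :: real^('m \<times> 'n \<times> 4))))"
      using has_derivative_cayley_0 by (simp only: linear_0[OF linear_lie_p_of])
    from bounded_linear.has_derivative[OF bounded_linear_matrix_mult_right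
        has_derivative_compose[OF bounded_linear_imp_has_derivative[OF bounded_linear_lie_p_of] this], of q]
    show ?thesis unfolding \<sigma>_def .
  qed
  then have "((\<lambda>u. x (coset (\<sigma> u))) has_derivative (\<lambda>h. coset_diff x (\<sigma> 0) (q ** (lie_p_of h + lie_p_of h)))) (at 0)"
    using \<sigma>Sp fW(2)[OF W(2)] by (intro coset_diff_compose) auto
  then have "((\<lambda>u. f (\<sigma> u)) has_derivative (\<lambda>h. coset_diff x q (q ** (lie_p_of h + lie_p_of h)))) (at 0)"
    unfolding \<sigma>0 by (rule has_derivative_transform_within_open[OF _ W]) (simp add: fW)
  then have D: "frechet_derivative (\<lambda>u. f (\<sigma> u)) (at 0) = (\<lambda>h. coset_diff x q (q ** (lie_p_of (h + h))))"
    by (simp only: linear_add[OF linear_lie_p_of]) (rule frechet_derivative_at[symmetric])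
  have "surj (frechet_derivative (\<lambda>u. f (\<sigma> u)) (at 0))"
    unfolding D surj_def
  proof
    fix v
    obtain w where w: "v = coset_diff x q (q ** lie_p_of w)"
      using surjD[OF bij_is_surj[OF coset_diff_bij[OF q]], of v] by blast
    have hw: "(1/2) *\<^sub>R w + (1/2) *\<^sub>R w = w" by (simp only: scaleR_add_right[symmetric] scaleR_half_double)
    show "\<exists>h. v = coset_diff x q (q ** lie_p_of (h + h))"
      by (rule exI[of _ "(1/2) *\<^sub>R w"]) (simp only: hw w)
  qed
  from smooth_inverse_function[OF W smooth this]
  obtain U' V g where inv: "open U'" "U' \<subseteq> W" "0 \<in> U'" "open V" "f (\<sigma> 0) \<in> V"
    "homeomorphism U' V (\<lambda>u. f (\<sigma> u)) g" "smooth_on V g" by blast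
  show thesis
  proof
    show "open V" by fact
    show "x (coset q) \<in> V" using inv(5) fW(1)[OF W(2)] \<sigma>0 by simp
    show "smooth_on V (\<lambda>y. \<sigma> (g y))"
      using inv(7) Ck_on_compose[OF inv(4) open_UNIV _ Ck\<sigma>] by (simp add: smooth_on_def)
    show "\<sigma> (g y) \<in> Sp \<and> coset (\<sigma> (g y)) \<in> U \<and> x (coset (\<sigma> (g y))) = y" if "y \<in> V" for y
    proof -
      have "g y \<in> W" "f (\<sigma> (g y)) = y" using inv(2,6) that by (auto simp: homeomorphism_def)
      then show ?thesis using fW \<sigma>Sp by simp
    qed
  qed
qed

definition F :: "real^('m \<times> 'n \<times> 4) \<Rightarrow> ('m, 'n) cmat" where
  "F y = proj_of_coset (inv_into U x y)"

lemma F_eq: "coset q \<in> U \<Longrightarrow> F (x (coset q)) = proj_matrix q"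
  by (simp add: F_def inv_into_f_f[OF inj_x] proj_of_coset)

lemma image_cases:
  assumes "y \<in> x ` U" obtains q where "q \<in> Sp" "coset q \<in> U" "y = x (coset q)"
  using assms U_subset by blast

text \<open>Near each point \<open>F\<close> is \<open>proj_matrix\<close> composed with a smooth
  local section; smoothness is a local property.\<close>

lemma smooth_F: "smooth_on (x ` U) F"
  unfolding smooth_on_def
proof
  fix k show "Ck_on k (x ` U) F"
  proof (rule Ck_on_local)
    fix y assume "y \<in> x ` U"
    then obtain q where q: "q \<in> Sp" "coset q \<in> U" "y = x (coset q)" by (rule image_cases)
    obtain V s where V: "open V" "x (coset q) \<in> V" "smooth_on V s"
      "\<And>y. y \<in> V \<Longrightarrow> s y \<in> Sp \<and> coset (s y) \<in> U \<and> x (coset (s y)) = y"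
      using local_section[OF q(1,2)] by blast
    have s: "Ck_on k V s" using V(3) by (simp add: smooth_on_def)
    have "Ck_on k V (\<lambda>y. proj_matrix (s y))"
      unfolding proj_matrix_def
      by (intro Ck_on_bilinear[OF bounded_bilinear_matrix_mult V(1)] s Ck_on_const
          Ck_on_bounded_linear[OF bounded_linear_adj V(1)])
    then have "Ck_on k V F"
      by (rule Ck_on_cong[OF V(1), rotated]) (metis F_eq V(4))
    then show "\<exists>T. open T \<and> y \<in> T \<and> Ck_on k T F" using V q(3) by blast
  qed
qed

lemma F_deriv: "y \<in> x ` U \<Longrightarrow> (F has_derivative frechet_derivative F (at y)) (at y)"
  using smooth_F Ck_on_differentiable[of 0] unfolding smooth_on_def by blast

lemma F_deriv_horizontal:
  assumes q: "q \<in> Sp" "coset q \<in> U" and Z: "Z \<in> lie_p"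
  shows "frechet_derivative F (at (x (coset q))) (coset_diff x q (q ** Z)) = q ** (Z + Z) ** I_hat ** adj q"
  using q by (intro derivative_horizontal[OF q Z F_deriv] F_eq) auto

end

lemma transpose_J: "transpose J = - J"
  by (simp add: vec_eq_iff split_sum_all transpose_def J_def mat_def)

text \<open>The transpose of a Hermitian matrix is its conjugate, and the quaternionic condition
  moves it across \<open>J\<close>. The purpose is the vanishing diagonal of
  \<open>J ** F\<close>.\<close>

lemma quaternionic_J_mult_skew:
  assumes "quaternionic A" "adj A = A" shows "transpose (J ** A) = - (J ** A)"
proof -
  have "conj_mat A ** J = J ** A"
    using arg_cong[OF assms(1)[unfolded quaternionic_def], of conj_mat] by simp
  moreover have "transpose A = conj_mat A" using assms(2) by (metis adj_def conj_mat_simps(5) transpose_transpose adj_simps(7))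
  ultimately show ?thesis by (simp add: matrix_transpose_mul transpose_J matrix_mult_simps)
qed

section \<open>The tangent space of the image and the comparison of metrics\<close>

context grassmannian_chart
begin

definition TF :: "real^('m \<times> 'n \<times> 4) \<Rightarrow> ('m, 'n) cmat set" where
  "TF y = {A. quaternionic A \<and> adj A = A \<and> F y ** A = - (A ** F y)}"

lemma F_props:
  assumes "y \<in> x ` U"
  shows "quaternionic (F y)" "adj (F y) = F y" "F y ** F y = mat 1"
  using image_cases[OF assms] F_eq quaternionic_proj_matrix adj_proj_matrix proj_matrix_square by metis+

lemma horizontal_image_in_TF:
  assumes q: "q \<in> Sp" "coset q \<in> U" and Z: "Z \<in> lie_p"
  shows "q ** (Z + Z) ** I_hat ** adj q \<in> TF (x (coset q))"
proof -
  have u: "unitary q" "quaternionic q" using q by (auto simp: Sp_iff)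
  have Zp: "quaternionic Z" "adj Z = - Z" using Z by (auto simp: lie_p_def lie_sp_def)
  define Y where "Y = Z + Z"
  have Y: "quaternionic Y" "adj Y = - Y" "I_hat ** Y = - (Y ** I_hat)"
    using Zp lie_p_anticommute[OF Z] by (simp_all only: Y_def quaternionic_add adj_simps matrix_mult_simps minus_add_distrib)
  have "quaternionic (q ** Y ** I_hat ** adj q)"
    by (intro quaternionic_mult quaternionic_adj quaternionic_I_hat u Y)
  moreover have "adj (q ** Y ** I_hat ** adj q) = - (q ** (I_hat ** Y) ** adj q)"
    by (simp add: Y(2) matrix_mult_simps matrix_mul_assoc)
  then have "adj (q ** Y ** I_hat ** adj q) = q ** Y ** I_hat ** adj q"
    by (simp add: Y(3) matrix_mult_simps matrix_mul_assoc)
  moreover have "(q ** I_hat ** adj q) ** (q ** Y ** I_hat ** adj q) = q ** (I_hat ** Y) ** I_hat ** adj q"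
    by (simp add: matrix_mul_assoc unitary_cancel[OF u(1)])
  then have "(q ** I_hat ** adj q) ** (q ** Y ** I_hat ** adj q) = - (q ** Y ** (I_hat ** I_hat) ** adj q)"
    by (simp only: Y(3) matrix_mult_simps matrix_mul_assoc)
  moreover have "(q ** Y ** I_hat ** adj q) ** (q ** I_hat ** adj q) = q ** Y ** (I_hat ** I_hat) ** adj q"
    by (simp only: matrix_mul_assoc unitary_cancel[OF u(1)])
  ultimately show ?thesis
    by (simp only: TF_def F_eq[OF q(2)] proj_matrix_def Y_def mem_Collect_eq)
qed

lemma range_F_deriv:
  assumes y: "y \<in> x ` U" shows "range (frechet_derivative F (at y)) = TF y"
proof (intro equalityI subsetI)
  obtain q where q: "q \<in> Sp" "coset q \<in> U" "y = x (coset q)" using image_cases[OF y] .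
  fix A
  {
    assume "A \<in> range (frechet_derivative F (at y))"
    then obtain v where A: "A = frechet_derivative F (at y) v" by blast
    obtain Z where "Z \<in> lie_p" "v = coset_diff x q (q ** Z)" using coset_diff_lie_p_surj[OF q(1,2)] by metis
    then show "A \<in> TF y"
      using F_deriv_horizontal[OF q(1,2)] horizontal_image_in_TF[OF q(1,2)] by (simp only: A q(3))
  }
  {
    assume A: "A \<in> TF y"
    have u: "unitary q" "quaternionic q" using q by (auto simp: Sp_iff)
    define B where "B = adj q ** A ** q"
    have F: "F y = q ** I_hat ** adj q" by (simp add: q(3) F_eq[OF q(2)] proj_matrix_def)
    have "I_hat ** B = adj q ** (F y ** A) ** q" by (simp add: B_def F matrix_mul_assoc unitary_cancel[OF u(1)])
    also have "\<dots> = - (adj q ** (A ** F y) ** q)" using A by (simp add: TF_def matrix_mult_simps)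
    also have "\<dots> = - (B ** I_hat)" by (simp add: B_def F matrix_mul_assoc unitary_cancel[OF u(1)])
    finally have EB: "I_hat ** B = - (B ** I_hat)" .
    have B: "quaternionic B" "adj B = B"
      using A u by (auto simp: B_def TF_def matrix_mul_assoc intro!: quaternionic_mult quaternionic_adj)
    \<comment> \<open>This solves \<open>(Z + Z) ** I_hat = B\<close>, since \<open>I_hat\<close> is
      its own inverse.\<close>
    define Z where "Z = (1/2) *\<^sub>R (B ** I_hat)"
    have "I_hat ** (B ** I_hat) ** I_hat = I_hat ** B ** (I_hat ** I_hat)" by (simp only: matrix_mul_assoc)
    then have "Z \<in> lie_p"
      using B by (simp add: Z_def lie_p_def lie_sp_def EB matrix_mult_simps quaternionic_scaleR quaternionic_mult quaternionic_I_hat)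
    from F_deriv_horizontal[OF q(1,2) this]
    have "frechet_derivative F (at y) (coset_diff x q (q ** Z)) = q ** (Z + Z) ** I_hat ** adj q" by (simp only: q(3))
    also have "Z + Z = B ** I_hat" by (simp only: Z_def scaleR_add_right[symmetric] scaleR_half_double)
    also have "q ** (B ** I_hat) ** I_hat ** adj q = q ** B ** (I_hat ** I_hat) ** adj q" by (simp only: matrix_mul_assoc)
    also have "\<dots> = A" by (simp add: B_def matrix_mul_assoc unitary_cancel[OF u(1)])
    finally show "A \<in> range (frechet_derivative F (at y))" by (metis rangeI)
  }
qed

lemma F_deriv_lie_p:
  assumes q: "q \<in> Sp" "coset q \<in> U"
  obtains Z where "Z \<in> lie_p" "coset_diff x q (q ** Z) = v"
    "frechet_derivative F (at (x (coset q))) v = q ** (Z + Z) ** I_hat ** adj q"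
  using coset_diff_lie_p_surj[OF q, of v] F_deriv_horizontal[OF q] by metis

lemma inj_F_deriv:
  assumes y: "y \<in> x ` U" shows "inj (frechet_derivative F (at y))"
proof -
  obtain q where q: "q \<in> Sp" "coset q \<in> U" "y = x (coset q)" using image_cases[OF y] .
  have u: "unitary q" using q by (auto simp: Sp_iff)
  have "v = 0" if v: "frechet_derivative F (at y) v = 0" for v
  proof -
    obtain Z where Z: "Z \<in> lie_p" "coset_diff x q (q ** Z) = v" "frechet_derivative F (at y) v = q ** (Z + Z) ** I_hat ** adj q"
      using F_deriv_lie_p[OF q(1,2), of v] q(3) by metis
    have "Z + Z = adj q ** (q ** (Z + Z) ** I_hat ** adj q) ** q ** I_hat"
      by (simp only: matrix_mul_assoc unitary_cancel[OF u] matrix_mul_lid) (simp only: matrix_mul_assoc[symmetric] I_hat_simps matrix_mul_rid)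
    also have "\<dots> = 0" using v by (simp only: Z(3)[symmetric] times0_left times0_right)
    finally have "Z = 0" by (metis scaleR_half_double scaleR_zero_right)
    then show ?thesis using Z(2) linear_0[OF linear_coset_diff[OF q(1,2)]] by simp
  qed
  then show ?thesis using linear_injective_0 has_derivative_linear[OF F_deriv[OF y]] by blast
qed

sublocale immersed_patch F "x ` U" "1/4"
proof
  show "open (x ` U)" by (rule open_image)
  show "Ck_on 2 (x ` U) F" using smooth_F by (simp only: smooth_on_def)
qed (use inj_F_deriv in auto)

lemma horizontal_lift_eq:
  assumes q: "q \<in> Sp" "coset q \<in> U" and Z: "Z \<in> lie_p"
  shows "horizontal_lift x q (coset_diff x q (q ** Z)) = q ** Z"
  unfolding horizontal_lift_def
proof (rule the_equality)
  show "q ** Z \<in> horizontal_space q \<and> coset_diff x q (q ** Z) = coset_diff x q (q ** Z)"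
    using Z by (simp add: horizontal_space_eq[OF q(1)])
  fix X assume X: "X \<in> horizontal_space q \<and> coset_diff x q X = coset_diff x q (q ** Z)"
  then obtain Y where Y: "Y \<in> lie_p" "X = q ** Y" by (auto simp: horizontal_space_eq[OF q(1)])
  have "coset_diff x q (q ** lie_p_of (lie_p_coords Y)) = coset_diff x q (q ** lie_p_of (lie_p_coords Z))"
    using X Y Z by (simp add: lie_p_of_coords)
  then have "lie_p_coords Y = lie_p_coords Z" by (rule injD[OF bij_is_inj[OF coset_diff_bij[OF q]]])
  then show "X = q ** Z" using lie_p_of_coords[OF Y(1)] lie_p_of_coords[OF Z] Y(2) by metis
qed

text \<open>The differential of \<open>F\<close> maps the vector with horizontal lift
  \<open>q ** Z\<close> to \<open>Z + Z\<close> multiplied by unitary matrices. Inner products grow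
  by the factor 4, which the scale 1/4 in the sublocale compensates.\<close>

lemma gram_eq:
  assumes P: "P \<in> U" shows "grassmannian_gram (U, x) P = g (x P)"
proof -
  obtain q0 where q0: "q0 \<in> Sp" "P = coset q0" using P U_subset by blast
  define q where "q = (SOME q. q \<in> P)"
  have "q \<in> coset q0" unfolding q_def q0(2) by (rule someI[of "\<lambda>q. q \<in> coset q0", OF self_in_coset])
  then have q: "q \<in> Sp" "coset q = P" using coset_eq[OF q0(1)] coset_subset_Sp[OF q0(1)] q0(2) by auto
  have qU: "coset q \<in> U" using q P by simp
  have u: "unitary q" using q by (simp add: Sp_iff)
  have "Sp_metric q (horizontal_lift x q (axis i 1)) (horizontal_lift x q (axis j 1)) = 1/4 * (Fd i (x P) \<bullet> Fd j (x P))" for i j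
  proof -
    obtain Z where Z: "Z \<in> lie_p" "coset_diff x q (q ** Z) = axis i 1"
      "Fd i (x P) = q ** (Z + Z) ** I_hat ** adj q"
      using F_deriv_lie_p[OF q(1) qU, of "axis i 1"] unfolding Fd_def q(2) by metis
    obtain Y where Y: "Y \<in> lie_p" "coset_diff x q (q ** Y) = axis j 1"
      "Fd j (x P) = q ** (Y + Y) ** I_hat ** adj q"
      using F_deriv_lie_p[OF q(1) qU, of "axis j 1"] unfolding Fd_def q(2) by metis
    have "Fd i (x P) \<bullet> Fd j (x P) = (Z + Z) \<bullet> (Y + Y)"
      unfolding Z(3) Y(3) by (simp only: inner_unitary[OF unitary_adj[OF u]] inner_unitary[OF u] inner_unitary[OF unitary_I_hat])
    also have "\<dots> = 4 * (Z \<bullet> Y)" by (simp only: inner_add_left inner_add_right)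
    finally have "1/4 * (Fd i (x P) \<bullet> Fd j (x P)) = Z \<bullet> Y" by simp
    then show ?thesis
      using horizontal_lift_eq[OF q(1) qU Z(1)] horizontal_lift_eq[OF q(1) qU Y(1)] Z(2) Y(2) Sp_metric_unitary[OF u] by metis
  qed
  then show ?thesis by (simp add: grassmannian_gram_def g_def q_def[symmetric] Let_def vec_eq_iff)
qed

end

lemma inner_sandwich: "inner (M ** A ** N) B = inner A (adj M ** B ** adj N)"
  for A M N B :: "complex^'k^'k"
  using inner_mult_right[of "M ** A" N B] inner_mult_left[of M A "B ** adj N"] by (simp add: matrix_mul_assoc)

lemma transpose_mult_nth: "(transpose A ** B) $ a $ d = (\<Sum>b\<in>UNIV. A $ b $ a * B $ b $ d)"
  by (simp add: matrix_matrix_mult_def transpose_def)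

lemma half_nth: "((1/2) *\<^sub>R A) $ a $ b = A $ a $ b / 2" for A :: "complex^'k^'l"
  by (simp add: complex_eq_iff)

lemma J_diag: "J $ a $ a = 0"
  by (cases a) (simp_all add: J_def)

lemma skew_diag: "transpose A = - A \<Longrightarrow> A $ a $ a = 0" for A :: "complex^'k^'k"
  by (drule arg_cong[of _ _ "\<lambda>B. B $ a $ a"]) (simp add: transpose_def eq_neg_iff_add_eq_0)

lemma transpose_hermitian:
  assumes "adj A = A" shows "transpose A = conj_mat A"
proof -
  have "A $ j $ i = cnj (A $ i $ j)" for i j using arg_cong[OF assms, of "\<lambda>B. B $ j $ i"] by simp
  then have "transpose A $ i $ j = conj_mat A $ i $ j" for i j
    unfolding transpose_def conj_mat_nth vec_lambda_beta .
  then show ?thesis unfolding vec_eq_iff by blast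
qed

section \<open>The contracted metric\<close>

text \<open>Conjugation by the antilinear map v -> J conj(v); its fixed points are exactly the
  quaternionic matrices.\<close>

definition conj_quat :: "complex^('k::finite + 'k)^('k + 'k) \<Rightarrow> complex^('k + 'k)^('k + 'k)" where
  "conj_quat A = - (J ** conj_mat A ** J)"

lemma quaternionic_conj_quat: "quaternionic A \<Longrightarrow> conj_quat A = A"
  by (simp add: conj_quat_def quaternionic_def) (metis J_cancel(2) minus_minus)

lemma quaternionic_add_conj_quat: "quaternionic (A + conj_quat A)"
  by (simp add: quaternionic_def conj_quat_def matrix_mult_simps matrix_mul_assoc)

lemma inner_conj_quat: "inner (conj_quat A) B = inner A (conj_quat B)"
proof -
  have "inner (J ** conj_mat A ** J) B = inner (conj_mat A) (J ** B ** J)"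
    by (simp add: inner_sandwich matrix_mult_simps)
  also have "\<dots> = inner A (J ** conj_mat B ** J)"
    using inner_conj_mat[of A "conj_mat (J ** B ** J)"] by simp
  finally show ?thesis by (simp add: conj_quat_def)
qed

lemma mult_elementary: "(M ** axis c (axis d z) ** N) $ a $ b = M $ a $ c * z * N $ d $ b"
  for M :: "complex^'k^'l" and N :: "complex^'p^'n"
proof -
  have axis: "axis c (axis d z) $ k $ l = (if k = c then if l = d then z else 0 else 0)" for k l
    by (simp add: axis_def)
  have "(M ** axis c (axis d z)) $ a $ l = (if l = d then M $ a $ c * z else 0)" for l
    by (simp add: matrix_matrix_mult_def axis if_distrib[where f="\<lambda>x. M $ a $ _ * x"] cong: if_cong)
  then show ?thesis
    by (simp add: matrix_matrix_mult_def[of "M ** axis c (axis d z)"] if_distrib[where f="\<lambda>x. x * _"] cong: if_cong)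
qed

lemma adj_elementary: "adj (axis c (axis d z)) = axis d (axis c (cnj z))"
  by (simp add: vec_eq_iff axis_def)

lemma conj_mat_elementary: "conj_mat (axis c (axis d z)) = axis c (axis d (cnj z))"
  by (simp add: vec_eq_iff axis_def)

text \<open>Recovers a complex entry from two real inner products. This is the passage from the real
  contraction to the complex-bilinear one.\<close>

lemma inner_elementary: "of_real (inner B (axis c (axis d 1))) + \<i> * of_real (inner B (axis c (axis d \<i>))) = B $ c $ d"
  for B :: "complex^'k^'l"
  by (simp add: inner_axis complex_eq_iff inner_complex_def)

text \<open>Four times the orthogonal projection onto the tangent space of the image of \<open>proj_matrix\<close> at \<open>F\<close>:
  averaging over the group generated by the commuting isometric involutions \<open>adj\<close>, \<open>conj_quat\<close> and
  \<open>A \<mapsto> - F A F\<close>.\<close>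

definition TF_sym :: "complex^('k::finite + 'k)^('k + 'k) \<Rightarrow> complex^('k + 'k)^('k + 'k) \<Rightarrow> complex^('k + 'k)^('k + 'k)" where
  "TF_sym F A = (let S = A + conj_quat A + adj (A + conj_quat A) in (1/2) *\<^sub>R (S - F ** S ** F))"

text \<open>In the value at z = 1 plus \<i> times the value at z = \<i>, terms in z cancel because 1
  + \<i> \<i> = 0, while terms in \<open>cnj z\<close> double because 1 + \<i> (-\<i>) = 2; the
  doubling absorbs the factor 1/2 of \<open>TF_sym\<close>.\<close>

lemma TF_sym_elementary:
  assumes "adj F = F"
  shows "TF_sym F (axis c (axis d 1)) $ a $ b + \<i> * TF_sym F (axis c (axis d \<i>)) $ a $ b =
    mat 1 $ a $ d * mat 1 $ c $ b - J $ a $ c * J $ d $ b - F $ a $ d * F $ c $ b + (F ** J) $ a $ c * (J ** F) $ d $ b"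
proof -
  let ?S = "\<lambda>z. axis c (axis d z) + axis d (axis c (cnj z)) - J ** axis c (axis d (cnj z)) ** J - J ** axis d (axis c z) ** J"
  have S: "axis c (axis d z) + conj_quat (axis c (axis d z)) + adj (axis c (axis d z) + conj_quat (axis c (axis d z))) = ?S z" for z
    by (simp add: conj_quat_def adj_elementary conj_mat_elementary matrix_mult_simps matrix_mul_assoc)
  have T: "TF_sym F (axis c (axis d z)) = (1/2) *\<^sub>R (?S z - F ** ?S z ** F)" for z
    by (simp only: TF_sym_def Let_def S)
  have 1: "?S z $ a $ b = z * (mat 1 $ a $ c * mat 1 $ d $ b) + cnj z * (mat 1 $ a $ d * mat 1 $ c $ b)
      - cnj z * (J $ a $ c * J $ d $ b) - z * (J $ a $ d * J $ c $ b)" for z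
    using mult_elementary[of "mat 1" c d z "mat 1" a b] mult_elementary[of "mat 1" d c "cnj z" "mat 1" a b]
    by (simp add: mult_elementary mult_ac)
  have "F ** ?S z ** F = F ** axis c (axis d z) ** F + F ** axis d (axis c (cnj z)) ** F
      - (F ** J) ** axis c (axis d (cnj z)) ** (J ** F) - (F ** J) ** axis d (axis c z) ** (J ** F)" for z
    by (simp add: matrix_mult_simps matrix_mul_assoc)
  then have 2: "(F ** ?S z ** F) $ a $ b = z * (F $ a $ c * F $ d $ b) + cnj z * (F $ a $ d * F $ c $ b)
      - cnj z * ((F ** J) $ a $ c * (J ** F) $ d $ b) - z * ((F ** J) $ a $ d * (J ** F) $ c $ b)" for z
    by (simp add: mult_elementary mult_ac)
  have TS: "TF_sym F (axis c (axis d z)) $ a $ b = (?S z $ a $ b - (F ** ?S z ** F) $ a $ b) / 2" for z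
    unfolding T half_nth by (simp only: vector_minus_component)
  show ?thesis unfolding TS 1 2 by (simp add: field_simps)
qed

context grassmannian_chart
begin

lemma subspace_TF: "y \<in> x ` U \<Longrightarrow> subspace (TF y)"
  using range_F_deriv[of y] linear_subspace_image[OF F_deriv_linear subspace_UNIV] by metis

lemma Fd_TF: "y \<in> x ` U \<Longrightarrow> Fd i y \<in> TF y"
  unfolding Fd_def range_F_deriv[symmetric] by blast

lemma TF_orthogonal:
  assumes y: "y \<in> x ` U" and B: "\<And>k. inner B (Fd k y) = 0" and A: "A \<in> TF y"
  shows "inner B A = 0"
proof -
  obtain v where "A = frechet_derivative F (at y) v" using A range_F_deriv[OF y] by blast
  then show ?thesis by (simp add: F_deriv_expand[OF y] inner_sum_right B)
qed

lemma TF_sym_in_TF: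
  assumes y: "y \<in> x ` U" shows "TF_sym (F y) A \<in> TF y"
proof -
  define S where "S = A + conj_quat A + adj (A + conj_quat A)"
  have S: "quaternionic S" "adj S = S"
    unfolding S_def by (intro quaternionic_add[OF _ quaternionic_adj] quaternionic_add_conj_quat) (simp add: add_ac)
  have F: "quaternionic (F y)" "adj (F y) = F y" "F y ** F y = mat 1" using F_props[OF y] by auto
  have FF: "F y ** (F y ** S ** F y) = S ** F y" "(F y ** S ** F y) ** F y = F y ** S"
    by (simp add: matrix_mul_assoc F(3), simp add: matrix_mul_assoc[symmetric] F(3))
  have "quaternionic (S - F y ** S ** F y)" by (intro quaternionic_diff quaternionic_mult S F)
  moreover have "adj (S - F y ** S ** F y) = S - F y ** S ** F y" by (simp add: S F matrix_mul_assoc)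
  moreover have "F y ** (S - F y ** S ** F y) = - ((S - F y ** S ** F y) ** F y)"
    by (simp only: bounded_bilinear.diff_left[OF bounded_bilinear_matrix_mult] bounded_bilinear.diff_right[OF bounded_bilinear_matrix_mult] FF minus_diff_eq)
  ultimately have "S - F y ** S ** F y \<in> TF y" by (simp only: TF_def mem_Collect_eq simp_thms)
  then show ?thesis
    unfolding TF_sym_def Let_def S_def[symmetric] by (rule subspace_mul[OF subspace_TF[OF y]])
qed

text \<open>Every involution is self-adjoint and fixes \<open>B\<close>, so each of the eight
  summands contributes \<open>inner A B\<close>; the factor 1/2 leaves 4.\<close>

lemma TF_sym_inner:
  assumes y: "y \<in> x ` U" and B: "B \<in> TF y"
  shows "inner (TF_sym (F y) A) B = 4 * inner A B"
proof -
  define S where "S = A + conj_quat A + adj (A + conj_quat A)"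
  have Bp: "quaternionic B" "adj B = B" "F y ** B = - (B ** F y)" using B by (auto simp: TF_def)
  have X: "inner (A + conj_quat A) B = 2 * inner A B"
    by (simp add: inner_add_left inner_conj_quat quaternionic_conj_quat[OF Bp(1)])
  have "inner (adj (A + conj_quat A)) B = inner (A + conj_quat A) B" using inner_adj[of "A + conj_quat A" B] Bp(2) by simp
  then have S: "inner S B = 4 * inner A B" unfolding S_def using X by (simp add: inner_add_left)
  have "inner (F y ** S ** F y) B = inner S (F y ** B ** F y)"
    by (simp add: inner_sandwich F_props(2)[OF y])
  also have "F y ** B ** F y = - B"
    using F_props(3)[OF y] by (simp add: Bp(3) matrix_mult_simps matrix_mul_assoc[symmetric])
  finally have "inner (F y ** S ** F y) B = - (4 * inner A B)" using S by simp
  then show ?thesis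
    unfolding TF_sym_def Let_def S_def[symmetric] using S by (simp add: inner_diff_left)
qed

text \<open>Both sides are tangent and have the same inner products with the spanning vectors
  \<open>Fd k y\<close>. The normalization fits: the 4 of \<open>TF_sym_inner\<close> equals the
  \<open>1 / c\<close> of \<open>dual_inner\<close> for c = 1/4.\<close>

lemma contraction_eq:
  assumes y: "y \<in> x ` U" shows "(\<Sum>j\<in>UNIV. inner (Fd j y) A *\<^sub>R dual j y) = TF_sym (F y) A"
proof -
  let ?C = "\<Sum>j\<in>UNIV. inner (Fd j y) A *\<^sub>R dual j y"
  have "?C \<in> TF y"
    unfolding dual_def
    by (intro subspace_sum subspace_mul subspace_TF[OF y] Fd_TF[OF y])
  then have D: "?C - TF_sym (F y) A \<in> TF y" by (intro subspace_diff subspace_TF[OF y] TF_sym_in_TF[OF y])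
  have "inner (?C - TF_sym (F y) A) (Fd k y) = 0" for k
  proof -
    have "inner ?C (Fd k y) = (\<Sum>j\<in>UNIV. inner (Fd j y) A * (if j = k then 4 else 0))"
    proof -
      have "inner (dual j y) (Fd k y) = (if j = k then 4 else 0)" for j by (simp add: dual_inner[OF y])
      then show ?thesis by (simp only: inner_sum_left inner_scaleR_left)
    qed
    also have "\<dots> = 4 * inner A (Fd k y)" by (simp add: inner_commute if_distrib cong: if_cong)
    finally show ?thesis by (simp add: inner_diff_left TF_sym_inner[OF y Fd_TF[OF y]])
  qed
  from TF_orthogonal[OF y this D] show ?thesis by simp
qed

text \<open>Contracting the complexified tangent vectors with the metric, only the conjugate-linear terms of
  the projection survive.\<close>

lemma tensor_eq:
  assumes y: "y \<in> x ` U"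
  shows "(\<Sum>i\<in>UNIV. dual i y $ a $ b * Fd i y $ c $ d) =
    mat 1 $ a $ d * mat 1 $ c $ b - J $ a $ c * J $ d $ b - F y $ a $ d * F y $ c $ b
    + (F y ** J) $ a $ c * (J ** F y) $ d $ b"
proof -
  let ?E = "\<lambda>z. axis c (axis d z) :: ('m, 'n) cmat"
  have C: "TF_sym (F y) A $ a $ b = (\<Sum>i\<in>UNIV. of_real (inner (Fd i y) A) * dual i y $ a $ b)" for A
    unfolding contraction_eq[OF y, symmetric] by (simp only: sum_component vector_scaleR_component) (simp only: scaleR_conv_of_real)
  have "(\<Sum>i\<in>UNIV. dual i y $ a $ b * Fd i y $ c $ d) =
      (\<Sum>i\<in>UNIV. dual i y $ a $ b * (of_real (inner (Fd i y) (?E 1)) + \<i> * of_real (inner (Fd i y) (?E \<i>))))"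
    by (simp only: inner_elementary)
  also have "\<dots> = TF_sym (F y) (?E 1) $ a $ b + \<i> * TF_sym (F y) (?E \<i>) $ a $ b"
    unfolding C by (simp add: sum.distrib sum_distrib_left algebra_simps)
  finally show ?thesis unfolding TF_sym_elementary[OF F_props(2)[OF y]] .
qed

lemma F_quaternionic_diag:
  assumes y: "y \<in> x ` U" shows "(J ** F y) $ a $ a = 0"
  by (rule skew_diag[OF quaternionic_J_mult_skew[OF F_props(1,2)[OF y]]])

text \<open>A partial trace of \<open>tensor_eq\<close>. The two terms involving \<open>J\<close>
  each sum to the identity, with opposite signs, and cancel; the others yield the size of the
  matrices and the trace of \<open>F y\<close>.\<close>

lemma contraction_product:
  assumes y: "y \<in> x ` U"
  shows "(\<Sum>i\<in>UNIV. Fd i y ** dual i y) $ a $ d =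
    of_nat CARD(('m, 'n) index) * mat 1 $ a $ d - trace (F y) * F y $ a $ d"
proof -
  have tJ: "transpose J = - (J :: ('m, 'n) cmat)" by (rule transpose_J)
  have JJ: "(\<Sum>b\<in>UNIV. J $ b $ a * J $ b $ d) = (mat 1 :: ('m, 'n) cmat) $ a $ d"
  proof -
    have "(\<Sum>b\<in>UNIV. J $ b $ a * J $ b $ d) = (transpose J ** J :: ('m, 'n) cmat) $ a $ d"
      by (simp only: transpose_mult_nth)
    then show ?thesis by (simp add: tJ matrix_mult_simps)
  qed
  have FJ: "(\<Sum>b\<in>UNIV. (F y ** J) $ b $ a * (J ** F y) $ b $ d) = (mat 1 :: ('m, 'n) cmat) $ a $ d"
  proof -
    have "transpose (F y) = conj_mat (F y)"
      by (rule transpose_hermitian[OF F_props(2)[OF y]])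
    moreover have "conj_mat (F y) ** J = J ** F y"
      using arg_cong[OF F_props(1)[OF y, unfolded quaternionic_def], of conj_mat] by simp
    ultimately have "transpose (F y ** J) = - (J ** conj_mat (F y))"
      by (simp add: matrix_transpose_mul tJ matrix_mult_simps)
    then have T: "transpose (F y ** J) = - (F y ** J)" using F_props(1)[OF y] by (simp add: quaternionic_def)
    have "(\<Sum>b\<in>UNIV. (F y ** J) $ b $ a * (J ** F y) $ b $ d) = (transpose (F y ** J) ** (J ** F y)) $ a $ d"
      by (simp only: transpose_mult_nth)
    also have "transpose (F y ** J) ** (J ** F y) = - (F y ** (J ** J) ** F y)"
      by (simp only: T matrix_mult_simps(5) matrix_mul_assoc)
    finally show ?thesis by (simp add: matrix_mult_simps F_props(3)[OF y])
  qed
  have "(\<Sum>i\<in>UNIV. Fd i y ** dual i y) $ a $ d = (\<Sum>i\<in>UNIV. \<Sum>b\<in>UNIV. dual i y $ b $ d * Fd i y $ a $ b)"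
    by (simp add: matrix_matrix_mult_def mult.commute)
  also have "\<dots> = (\<Sum>b\<in>UNIV. \<Sum>i\<in>UNIV. dual i y $ b $ d * Fd i y $ a $ b)" by (rule sum.swap)
  also have "\<dots> = (\<Sum>b\<in>UNIV. mat 1 $ b $ b * mat 1 $ a $ d - J $ b $ a * J $ b $ d - F y $ b $ b * F y $ a $ d
    + (F y ** J) $ b $ a * (J ** F y) $ b $ d)"
    by (simp only: tensor_eq[OF y])
  also have "\<dots> = of_nat CARD(('m, 'n) index) * mat 1 $ a $ d - trace (F y) * F y $ a $ d"
    unfolding sum.distrib sum_subtractf JJ FJ by (simp add: trace_def sum_distrib_right mat_def)
  finally show ?thesis .
qed

end

section \<open>Tension field and conformality operator\<close>

lemma derivative_in_kernel:
  assumes "open V" "y \<in> V" "(f has_derivative f') (at y)" "bounded_linear L" "\<And>z. z \<in> V \<Longrightarrow> L (f z) = 0"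
  shows "L (f' h) = 0"
proof -
  have "((\<lambda>z. L (f z)) has_derivative (\<lambda>h. L (f' h))) (at y)"
    by (rule bounded_linear.has_derivative[OF assms(4,3)])
  then have "((\<lambda>z. 0) has_derivative (\<lambda>h. L (f' h))) (at y)"
    by (rule has_derivative_transform_within_open[OF _ assms(1,2)]) (rule assms(5))
  then have "(\<lambda>h. L (f' h)) = (\<lambda>h. 0)" by (rule has_derivative_unique) (rule has_derivative_const)
  then show ?thesis by metis
qed

definition herm_quat :: "(complex^('k::finite + 'k)^('k + 'k)) set" where
  "herm_quat = {A. quaternionic A \<and> adj A = A}"

lemma subspace_herm_quat: "subspace herm_quat"
  by (auto simp: herm_quat_def subspace_def quaternionic_add quaternionic_scaleR) (simp add: quaternionic_def)

lemma bounded_linear_matrix_nth: "bounded_linear (\<lambda>A :: complex^'k^'l. A $ i $ j)"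
  by (rule bounded_linear_compose[OF bounded_linear_vec_nth bounded_linear_vec_nth])

context grassmannian_chart
begin

lemma F2_herm_quat: 
  assumes y: "y \<in> x ` U" shows "F2 i j y \<in> herm_quat"
proof -
  have Fd: "quaternionic (Fd i z)" "adj (Fd i z) = Fd i z" if "z \<in> x ` U" for z
    using Fd_TF[OF that] by (auto simp: TF_def)
  have "F2 i j y ** J - J ** conj_mat (F2 i j y) = 0"
    unfolding F2_def
  proof (rule derivative_in_kernel[OF open_V y Fd_deriv[OF y]])
    show "bounded_linear (\<lambda>A :: ('m, 'n) cmat. A ** J - J ** conj_mat A)"
      by (intro bounded_linear_sub bounded_linear_matrix_mult_left
          bounded_linear_compose[OF bounded_linear_matrix_mult_right] bounded_linear_conj_mat)
    show "Fd i z ** J - J ** conj_mat (Fd i z) = 0" if "z \<in> x ` U" for z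
      using Fd(1)[OF that] by (simp add: quaternionic_def)
  qed
  moreover have "adj (F2 i j y) - F2 i j y = 0"
    unfolding F2_def
    by (rule derivative_in_kernel[OF open_V y Fd_deriv[OF y]])
      (auto intro!: bounded_linear_sub bounded_linear_adj bounded_linear_ident simp: Fd(2))
  ultimately show ?thesis by (simp add: herm_quat_def quaternionic_def)
qed

text \<open>The second derivative of F F = 1, obtained by differentiating the anticommutation of
  \<open>F\<close> with its tangent vectors.\<close>

lemma F2_anticommutator:
  assumes y: "y \<in> x ` U"
  shows "F y ** F2 i j y + F2 i j y ** F y = - (Fd i y ** Fd j y + Fd j y ** Fd i y)"
proof -
  let ?P = "\<lambda>z. F z ** Fd i z + Fd i z ** F z"
  have "?P z = 0" if "z \<in> x ` U" for z using Fd_TF[OF that, of i] by (simp add: TF_def)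
  moreover have "(?P has_derivative (\<lambda>h. (F y ** frechet_derivative (Fd i) (at y) h + frechet_derivative F (at y) h ** Fd i y)
     + (Fd i y ** frechet_derivative F (at y) h + frechet_derivative (Fd i) (at y) h ** F y))) (at y)"
    by (intro has_derivative_add has_derivative_matrix_mult F_deriv[OF y] Fd_deriv[OF y])
  ultimately have "(F y ** frechet_derivative (Fd i) (at y) (axis j 1) + frechet_derivative F (at y) (axis j 1) ** Fd i y)
     + (Fd i y ** frechet_derivative F (at y) (axis j 1) + frechet_derivative (Fd i) (at y) (axis j 1) ** F y) = 0"
    using derivative_in_kernel[OF open_V y _ bounded_linear_ident, of ?P] by blast
  then show ?thesis unfolding F2_def[symmetric] Fd_def[symmetric] by (simp add: eq_neg_iff_add_eq_0 algebra_simps)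
qed

lemma laplacian_eq:
  assumes y: "y \<in> x ` U"
  shows "laplacian y $ j $ a = trace (F y) * mat 1 $ j $ a - of_nat CARD(('m, 'n) index) * F y $ j $ a"
proof -
  let ?F = "F y" and ?D = "laplacian y"
  have F: "quaternionic ?F" "adj ?F = ?F" "?F ** ?F = mat 1" by (rule F_props[OF y])+
  have FdT: "Fd k y \<in> TF y" for k by (rule Fd_TF[OF y])
  obtain b where D: "?D = (\<Sum>j\<in>UNIV. b j *\<^sub>R Fd j y) + (\<Sum>i\<in>UNIV. \<Sum>j\<in>UNIV. ginv y $ i $ j *\<^sub>R F2 i j y)"
    using laplacian_decompose[OF y] by blast
  have D_hq: "?D \<in> herm_quat"
    unfolding D
    by (intro subspace_add subspace_sum subspace_mul subspace_herm_quat F2_herm_quat[OF y])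
      (use FdT in \<open>auto simp: TF_def herm_quat_def\<close>)
  \<comment> \<open>The anticommutator with \<open>?F\<close> annihilates the part of
    \<open>?D\<close> with the unknown coefficients \<open>b\<close> and turns second derivatives
    into products of first ones.\<close>
  define Q where "Q A = ?F ** A + A ** ?F" for A :: "('m, 'n) cmat"
  have linQ: "linear Q"
    unfolding Q_def linear_conv_bounded_linear
    by (intro bounded_linear_add bounded_linear_matrix_mult_left bounded_linear_matrix_mult_right)
  define W where "W = (\<Sum>i\<in>UNIV. Fd i y ** dual i y)"
  have bl: "linear (\<lambda>B :: ('m, 'n) cmat. A ** B)" for A :: "('m, 'n) cmat"
    using bounded_linear.linear[OF bounded_linear_matrix_mult_right] .
  have W1: "W = (\<Sum>i\<in>UNIV. \<Sum>j\<in>UNIV. ginv y $ i $ j *\<^sub>R (Fd i y ** Fd j y))"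
    by (simp only: W_def dual_def linear_sum[OF bl] linear_cmul[OF bl])
  have W2: "W = (\<Sum>i\<in>UNIV. \<Sum>j\<in>UNIV. ginv y $ i $ j *\<^sub>R (Fd j y ** Fd i y))"
    unfolding W1 by (subst sum.swap) (simp only: ginv_sym[OF y])
  have "Q (Fd k y) = 0" for k using FdT[of k] by (simp add: Q_def TF_def)
  then have "Q ?D = (\<Sum>i\<in>UNIV. \<Sum>j\<in>UNIV. ginv y $ i $ j *\<^sub>R Q (F2 i j y))"
    unfolding D linear_add[OF linQ] linear_sum[OF linQ] linear_cmul[OF linQ] by simp
  also have "\<dots> = - (W + W)"
  proof -
    have "Q (F2 i j y) = - (Fd i y ** Fd j y + Fd j y ** Fd i y)" for i j
      unfolding Q_def by (rule F2_anticommutator[OF y])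
    then show ?thesis
      by (simp only: scaleR_minus_right scaleR_add_right sum_negf sum.distrib W1[symmetric] W2[symmetric])
  qed
  finally have QD: "?F ** ?D + ?D ** ?F = - (W + W)" by (simp only: Q_def)
  \<comment> \<open>Twice the tangential part of \<open>?D\<close>. Being tangent it is orthogonal
    to the normal vector \<open>?D\<close>; since F A F = - A, it is also orthogonal to F D F. So it
    is orthogonal to itself, and \<open>?D\<close> commutes with \<open>?F\<close>.\<close>
  define A where "A = ?D - ?F ** ?D ** ?F"
  have FF: "?F ** (?F ** ?D ** ?F) = ?D ** ?F" "(?F ** ?D ** ?F) ** ?F = ?F ** ?D"
    by (simp add: matrix_mul_assoc F(3), simp add: matrix_mul_assoc[symmetric] F(3))
  have Dp: "quaternionic ?D" "adj ?D = ?D" using D_hq by (auto simp: herm_quat_def)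
  have FA: "?F ** A = - (A ** ?F)"
    by (simp only: A_def bounded_bilinear.diff_left[OF bounded_bilinear_matrix_mult]
        bounded_bilinear.diff_right[OF bounded_bilinear_matrix_mult] FF minus_diff_eq)
  have "quaternionic A" unfolding A_def by (intro quaternionic_diff quaternionic_mult Dp F)
  moreover have "adj A = A" by (simp add: A_def Dp F matrix_mul_assoc)
  ultimately have "A \<in> TF y" using FA by (simp only: TF_def mem_Collect_eq simp_thms)
  then have DA: "inner ?D A = 0" by (rule TF_orthogonal[OF y laplacian_normal[OF y]])
  have "inner (?F ** ?D ** ?F) A = inner ?D (?F ** A ** ?F)" by (simp only: inner_sandwich F(2))
  also have "?F ** A ** ?F = - (A ** (?F ** ?F))" by (simp only: FA matrix_mult_simps(5) matrix_mul_assoc)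
  also have "inner ?D (- (A ** (?F ** ?F))) = 0" by (simp only: F(3) matrix_mul_rid inner_minus_right DA minus_zero)
  finally have "inner A A = 0" using DA by (subst (1) A_def) (simp only: inner_diff_left diff_self)
  then have "A = 0" by simp
  then have "?D = ?F ** ?D ** ?F" by (simp add: A_def)
  then have "?F ** ?D = ?D ** ?F" using FF(1) by metis
  \<comment> \<open>For commuting matrices the anticommutator is 2 F D, and multiplying by F once
    more isolates \<open>?D\<close>.\<close>
  with QD have "?F ** ?D + ?F ** ?D = - W + - W" by simp
  then have FD: "?F ** ?D = - W" by (metis scaleR_half_double)
  have "?D = ?F ** (?F ** ?D)" by (simp add: matrix_mul_assoc F(3))
  then have "?D = - (?F ** W)" unfolding FD by (simp add: matrix_mult_simps)
  then have "?D $ j $ a = - (\<Sum>k\<in>UNIV. ?F $ j $ k * W $ k $ a)" by (simp add: matrix_matrix_mult_def)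
  also have "\<dots> = - (\<Sum>k\<in>UNIV. ?F $ j $ k * (of_nat CARD(('m, 'n) index) * mat 1 $ k $ a - trace ?F * ?F $ k $ a))"
    unfolding W_def contraction_product[OF y] ..
  also have "\<dots> = trace ?F * (\<Sum>k\<in>UNIV. ?F $ j $ k * ?F $ k $ a) - of_nat CARD(('m, 'n) index) * (\<Sum>k\<in>UNIV. ?F $ j $ k * mat 1 $ k $ a)"
    by (simp only: right_diff_distrib sum_subtractf sum_distrib_left minus_diff_eq mult.left_commute)
  also have "(\<Sum>k\<in>UNIV. ?F $ j $ k * ?F $ k $ a) = (?F ** ?F) $ j $ a" by (simp only: matrix_matrix_mult_def vec_lambda_beta)
  also have "(\<Sum>k\<in>UNIV. ?F $ j $ k * mat 1 $ k $ a) = (?F ** mat 1) $ j $ a" by (simp only: matrix_matrix_mult_def vec_lambda_beta)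
  finally show ?thesis unfolding F(3) matrix_mul_rid .
qed

lemma psi_in_coords:
  assumes "y \<in> x ` U" shows "in_coords (U, x) (psi j a) y = (1/2) * (F y + mat 1) $ j $ a"
proof -
  obtain q where q: "coset q \<in> U" "y = x (coset q)" using image_cases[OF assms] .
  show ?thesis
    by (simp add: in_coords_def q(2) inv_into_f_f[OF inj_x q(1)] psi_coset F_eq[OF q(1)])
qed

lemma smooth_psi: "smooth_on (x ` U) (in_coords (U, x) (psi j a))"
  unfolding smooth_on_def
proof
  fix k
  have "Ck_on k (x ` U) (\<lambda>y. (1/2) * (F y + mat 1) $ j $ a)"
    using smooth_F
    by (intro Ck_on_bounded_linear[OF bounded_linear_compose[OF bounded_linear_mult_right bounded_linear_matrix_nth] open_V]
        Ck_on_add[OF open_V] Ck_on_const) (simp only: smooth_on_def)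
  then show "Ck_on k (x ` U) (in_coords (U, x) (psi j a))"
    by (rule Ck_on_cong[OF open_V, rotated]) (simp only: psi_in_coords)
qed

lemma chart_partial_psi:
  assumes P: "P \<in> U" shows "chart_partial (U, x) i (psi j a) P = Fd i (x P) $ j $ a / 2"
proof -
  have y: "x P \<in> x ` U" using P by simp
  have "((\<lambda>y. (1/2) * (F y + mat 1) $ j $ a) has_derivative (\<lambda>h. (1/2) * (frechet_derivative F (at (x P)) h + 0) $ j $ a)) (at (x P))"
    by (intro bounded_linear.has_derivative[OF bounded_linear_compose[OF bounded_linear_mult_right bounded_linear_matrix_nth]]
        has_derivative_add F_deriv[OF y] has_derivative_const)
  from frechet_derivative_at[OF this]
    frechet_derivative_cong[OF open_V y, of "in_coords (U, x) (psi j a)" "\<lambda>y. (1/2) * (F y + mat 1) $ j $ a"]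
  have "frechet_derivative (in_coords (U, x) (psi j a)) (at (x P)) = (\<lambda>h. (1/2) * (frechet_derivative F (at (x P)) h + 0) $ j $ a)"
    using psi_in_coords by simp
  then show ?thesis by (simp add: chart_partial_def Fd_def)
qed

lemma gradient_psi:
  assumes P: "P \<in> U" shows "gradient quaternionic_grassmannian (U, x) (psi j a) P $ i = dual i (x P) $ j $ a / 2"
proof -
  have "gradient quaternionic_grassmannian (U, x) (psi j a) P $ i = (\<Sum>k\<in>UNIV. of_real (ginv (x P) $ i $ k) * (Fd k (x P) $ j $ a / 2))"
    by (simp add: gradient_def quaternionic_grassmannian_def gram_eq[OF P] ginv_def chart_partial_psi[OF P])
  also have "\<dots> = dual i (x P) $ j $ a / 2"
    unfolding dual_def sum_component vector_scaleR_component by (simp add: scaleR_conv_of_real sum_divide_distrib)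
  finally show ?thesis .
qed

lemma conformality_psi:
  assumes P: "P \<in> U" and ne: "j \<noteq> a" "k \<noteq> a"
  shows "metric_C quaternionic_grassmannian (U, x) P (gradient quaternionic_grassmannian (U, x) (psi j a) P)
      (gradient quaternionic_grassmannian (U, x) (psi k a) P) = - psi j a P * psi k a P"
proof -
  let ?y = "x P"
  have y: "?y \<in> x ` U" using P by simp
  \<comment> \<open>Lowering the index of one gradient returns the coordinate derivatives, so the
    metric of two gradients becomes the sum evaluated in \<open>tensor_eq\<close>.\<close>
  have lower: "(\<Sum>i\<in>UNIV. g ?y $ i $ l *\<^sub>R dual i ?y) = Fd l ?y" for l
  proof -
    have "(\<Sum>i\<in>UNIV. g ?y $ i $ l *\<^sub>R dual i ?y) = (\<Sum>k\<in>UNIV. (\<Sum>i\<in>UNIV. ginv ?y $ k $ i * g ?y $ i $ l) *\<^sub>R Fd k ?y)"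
      unfolding dual_def scaleR_sum_right scaleR_sum_left
      by (subst sum.swap) (simp add: ginv_sym[OF y] mult.commute)
    also have "\<dots> = (\<Sum>k\<in>UNIV. (ginv ?y ** g ?y) $ k $ l *\<^sub>R Fd k ?y)" by (simp add: matrix_matrix_mult_def)
    also have "\<dots> = Fd l ?y" unfolding ginv_mult(1)[OF y]
      by (simp add: mat_def if_distrib[where f="\<lambda>r. r *\<^sub>R _"] cong: if_cong)
    finally show ?thesis .
  qed
  have "metric_C quaternionic_grassmannian (U, x) P (gradient quaternionic_grassmannian (U, x) (psi j a) P)
      (gradient quaternionic_grassmannian (U, x) (psi k a) P)
    = (\<Sum>i\<in>UNIV. \<Sum>l\<in>UNIV. of_real (g ?y $ i $ l) * (dual i ?y $ j $ a / 2) * (dual l ?y $ k $ a / 2))"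
    by (simp add: metric_C_def gradient_psi[OF P]) (simp add: quaternionic_grassmannian_def gram_eq[OF P])
  also have "\<dots> = (\<Sum>l\<in>UNIV. \<Sum>i\<in>UNIV. of_real (g ?y $ i $ l) * (dual i ?y $ j $ a / 2) * (dual l ?y $ k $ a / 2))"
    by (rule sum.swap)
  also have "\<dots> = (\<Sum>l\<in>UNIV. (\<Sum>i\<in>UNIV. g ?y $ i $ l *\<^sub>R dual i ?y) $ j $ a * dual l ?y $ k $ a) / 4"
    unfolding sum_component vector_scaleR_component
    by (simp add: scaleR_conv_of_real sum_divide_distrib sum_distrib_right)
  also have "\<dots> = (\<Sum>l\<in>UNIV. dual l ?y $ k $ a * Fd l ?y $ j $ a) / 4"
    unfolding lower by (simp only: mult.commute)
  \<comment> \<open>Of the four terms of \<open>tensor_eq\<close> the first vanishes because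
    \<open>j\<close> and \<open>k\<close> differ from \<open>a\<close>, the second and fourth
    because \<open>J\<close> and \<open>J ** F\<close> have zero diagonal.\<close>
  also have "\<dots> = - (F ?y $ k $ a * F ?y $ j $ a) / 4"
    unfolding tensor_eq[OF y] F_quaternionic_diag[OF y]
    using ne by (simp add: mat_def J_diag)
  also have "\<dots> = - psi j a P * psi k a P"
  proof -
    obtain q where q: "q \<in> Sp" "P = coset q" using P U_subset by blast
    have "psi l a P = F ?y $ l $ a / 2" if "l \<noteq> a" for l
      using that F_eq[of q] P q(2) by (simp add: psi_coset mat_def)
    from this[OF ne(1)] this[OF ne(2)] show ?thesis by (simp only:) simp
  qed
  finally show ?thesis .
qed

lemma divergence_psi:
  assumes P: "P \<in> U" and ne: "j \<noteq> a"
  shows "divergence quaternionic_grassmannian (U, x) (gradient quaternionic_grassmannian (U, x) (psi j a)) P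
    = - of_nat CARD(('m, 'n) index) * psi j a P"
proof -
  let ?y = "x P"
  have y: "?y \<in> x ` U" using P by simp
  let ?X = "gradient quaternionic_grassmannian (U, x) (psi j a)"
  let ?s = "\<lambda>z. sqrt (det (g z))"
  let ?W = "\<lambda>i. frechet_derivative (\<lambda>z. ?s z *\<^sub>R dual i z) (at ?y) (axis i 1)"
  have part: "chart_partial (U, x) i (\<lambda>q. of_real (sqrt (det (gram quaternionic_grassmannian (U, x) q))) * ?X q $ i) P
      = frechet_derivative (\<lambda>z. ?s z *\<^sub>R dual i z) (at ?y) (axis i 1) $ j $ a / 2" for i
  proof -
    let ?f = "in_coords (U, x) (\<lambda>q. of_real (sqrt (det (gram quaternionic_grassmannian (U, x) q))) * ?X q $ i)"
    let ?h = "\<lambda>z. (1/2) * (?s z *\<^sub>R dual i z) $ j $ a"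
    have "?f z = ?h z" if z: "z \<in> x ` U" for z
    proof -
      obtain Q where Q: "Q \<in> U" "z = x Q" using z by blast
      have "?f z = of_real (?s z) * (dual i z $ j $ a / 2)"
        by (simp add: in_coords_def Q(2) inv_into_f_f[OF inj_x Q(1)] gradient_psi[OF Q(1)])
          (simp add: quaternionic_grassmannian_def gram_eq[OF Q(1)])
      then show ?thesis unfolding vector_scaleR_component by (simp add: scaleR_conv_of_real)
    qed
    then have "frechet_derivative ?f (at ?y) = frechet_derivative ?h (at ?y)"
      by (rule frechet_derivative_cong[OF open_V y])
    also have "\<dots> = (\<lambda>h. (1/2) * frechet_derivative (\<lambda>z. ?s z *\<^sub>R dual i z) (at ?y) h $ j $ a)"
      by (rule frechet_derivative_at[symmetric],
        rule bounded_linear.has_derivative[OF bounded_linear_compose[OF bounded_linear_mult_right bounded_linear_matrix_nth]])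
        (use density_differentiable[OF y] in \<open>simp only: frechet_derivative_works\<close>)
    finally show ?thesis by (simp add: chart_partial_def)
  qed
  have "divergence quaternionic_grassmannian (U, x) ?X P
      = (\<Sum>i\<in>UNIV. frechet_derivative (\<lambda>z. ?s z *\<^sub>R dual i z) (at ?y) (axis i 1) $ j $ a / 2) / of_real (?s ?y)"
    unfolding divergence_def part by (simp add: quaternionic_grassmannian_def gram_eq[OF P])
  also have "\<dots> = laplacian ?y $ j $ a / 2"
  proof -
    have "X / 2 / of_real r = (inverse r *\<^sub>R X) / 2" for X :: complex and r :: real
      by (cases "r = 0") (simp_all add: scaleR_conv_of_real field_simps)
    moreover have "(\<Sum>i\<in>UNIV. ?W i $ j $ a / 2) = (\<Sum>i\<in>UNIV. ?W i $ j $ a) / 2"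
      by (rule sum_divide_distrib[symmetric])
    moreover have "laplacian ?y $ j $ a = inverse (?s ?y) *\<^sub>R (\<Sum>i\<in>UNIV. ?W i $ j $ a)"
      by (simp only: laplacian_def vector_scaleR_component sum_component)
    ultimately show ?thesis by (simp only:)
  qed
  \<comment> \<open>The trace term of \<open>laplacian_eq\<close> is a multiple of the identity and
    so is invisible at an off-diagonal entry.\<close>
  also have "\<dots> = - of_nat CARD(('m, 'n) index) * (F ?y $ j $ a / 2)"
  proof -
    have "(mat 1 :: ('m, 'n) cmat) $ j $ a = 0" using ne by (simp add: mat_def)
    then show ?thesis
      unfolding laplacian_eq[OF y] by (simp only: mult_zero_right diff_0 mult_minus_left times_divide_eq_right)
  qed
  also have "F ?y $ j $ a / 2 = psi j a P"
  proof -
    obtain q where q: "q \<in> Sp" "P = coset q" using P U_subset by blast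
    then show ?thesis using ne F_eq[of q] P by (simp add: psi_coset mat_def)
  qed
  finally show ?thesis .
qed

end

section \<open>Existence of charts\<close>

text \<open>Inverse of the Cayley transform, meaningful for unitary matrices without eigenvalue -1;
  it provides the coordinates of the chart constructed below.\<close>

definition uncayley :: "complex^'n^'n \<Rightarrow> complex^'n::finite^'n" where
  "uncayley M = (M - mat 1) ** matrix_inv (M + mat 1)"

lemma uncayley_commute:
  assumes "invertible (M + mat 1)"
  shows "uncayley M = matrix_inv (M + mat 1) ** (M - mat 1)"
proof -
  let ?A = "M - mat 1" and ?B = "M + mat 1"
  let ?R = "matrix_inv ?B"
  have "?R ** ?A = ?R ** ?A ** (?B ** ?R)" by (simp add: matrix_inv_cancel[OF assms])
  also have "\<dots> = ?R ** (?A ** ?B) ** ?R" by (simp only: matrix_mul_assoc)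
  also have "?A ** ?B = ?B ** ?A" by (simp add: matrix_mult_simps)
  also have "?R ** (?B ** ?A) ** ?R = ?A ** ?R" by (simp add: matrix_mul_assoc matrix_inv_cancel[OF assms])
  finally show ?thesis by (simp add: uncayley_def)
qed

text \<open>The adjoint of \<open>M\<close> is its inverse, and replacing M by its inverse changes
  the sign of (M - 1)/(M + 1).\<close>

lemma adj_uncayley:
  assumes M: "unitary M" "invertible (M + mat 1)"
  shows "adj (uncayley M) = - uncayley M" "uncayley (adj M) = - uncayley M"
proof -
  let ?B = "M + mat 1" and ?A = "M - mat 1"
  have "adj M ** ?B = adj M + mat 1" by (simp add: matrix_mult_simps unitary_cancel[OF M(1)] add.commute)
  moreover have "invertible (adj M)" using unitary_cancel[OF M(1)] matrix_inv_unique(2) by blast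
  ultimately have inv: "invertible (adj M + mat 1)" using invertible_mult[OF _ M(2)] by metis
  have "(adj M + mat 1) ** - uncayley M = - (adj M ** (?B ** ?A) ** matrix_inv ?B)"
    by (simp add: uncayley_def \<open>adj M ** ?B = _\<close>[symmetric] matrix_mult_simps(5,6) matrix_mul_assoc)
  also have "?B ** ?A = ?A ** ?B" by (simp add: matrix_mult_simps)
  also have "- (adj M ** (?A ** ?B) ** matrix_inv ?B) = - (adj M ** ?A)"
    by (simp only: matrix_mul_assoc[symmetric] matrix_inv_cancel[OF M(2)] matrix_mul_rid)
  also have "\<dots> = adj M - mat 1" by (simp add: matrix_mult_simps unitary_cancel[OF M(1)])
  finally have "(adj M + mat 1) ** - uncayley M = adj M - mat 1" .
  then have "matrix_inv (adj M + mat 1) ** (adj M - mat 1)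
      = matrix_inv (adj M + mat 1) ** (adj M + mat 1) ** - uncayley M" by (simp only: matrix_mul_assoc[symmetric])
  then have *: "matrix_inv (adj M + mat 1) ** (adj M - mat 1) = - uncayley M"
    by (simp only: matrix_inv_cancel[OF inv] matrix_mul_lid)
  then show "uncayley (adj M) = - uncayley M" by (simp only: uncayley_commute[OF inv])
  have "adj (uncayley M) = matrix_inv (adj M + mat 1) ** (adj M - mat 1)"
    by (simp add: uncayley_def adj_matrix_inv[OF M(2)])
  then show "adj (uncayley M) = - uncayley M" by (simp only: *)
qed

lemma cayley_uncayley:
  assumes M: "unitary M" "invertible (M + mat 1)"
  shows "cayley (uncayley M) = M"
proof -
  let ?Z = "uncayley M" and ?R = "matrix_inv (M + mat 1)"
  have R: "(M + mat 1) ** ?R = mat 1" by (rule matrix_inv_cancel[OF M(2)])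
  have Z: "?Z = M ** ?R - ?R" by (simp add: uncayley_def matrix_mult_simps)
  have R': "M ** ?R + ?R = mat 1" using R by (simp add: matrix_mult_simps)
  have "mat 1 - ?Z = (M ** ?R + ?R) - (M ** ?R - ?R)" by (simp only: Z R')
  then have 1: "mat 1 - ?Z = ?R + ?R" by simp
  have "mat 1 + ?Z = (M ** ?R + ?R) + (M ** ?R - ?R)" by (simp only: Z R')
  also have "\<dots> = M ** ?R + M ** ?R" by simp
  also have "\<dots> = M ** (mat 1 - ?Z)" unfolding 1 by (simp only: matrix_mult_simps)
  finally have "cayley ?Z = M ** ((mat 1 - ?Z) ** matrix_inv (mat 1 - ?Z))" by (simp only: cayley_def matrix_mul_assoc)
  then show ?thesis using matrix_inv_cancel[OF invertible_1_minus_skew[OF adj_uncayley(1)[OF M]]] by simp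
qed

lemma uncayley_conjugate:
  assumes E: "E ** E = mat 1" and M: "invertible (M + mat 1)"
  shows "E ** uncayley M ** E = uncayley (E ** M ** E)"
proof -
  have sum_eq: "E ** M ** E + mat 1 = E ** (M + mat 1) ** E" "E ** M ** E - mat 1 = E ** (M - mat 1) ** E"
    by (simp_all add: matrix_mult_simps E)
  have E2: "A ** E ** E = A" for A by (simp add: matrix_mul_assoc[symmetric] E)
  have "matrix_inv (E ** (M + mat 1) ** E) = E ** matrix_inv (M + mat 1) ** E"
  proof (rule matrix_inv_unique(1))
    have "E ** (M + mat 1) ** E ** (E ** matrix_inv (M + mat 1) ** E)
        = E ** ((M + mat 1) ** matrix_inv (M + mat 1)) ** E" by (simp only: matrix_mul_assoc E2)
    then show "E ** (M + mat 1) ** E ** (E ** matrix_inv (M + mat 1) ** E) = mat 1"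
      by (simp add: matrix_inv_cancel[OF M] E)
  qed
  then show ?thesis unfolding uncayley_def sum_eq by (simp only: matrix_mul_assoc E2)
qed

lemma open_uncayley_domain: "open {M :: complex^'n^'n. invertible (M + mat 1)}"
  using open_vimage[OF open_invertible, of "\<lambda>M :: complex^'n^'n. M + mat 1"]
  by (simp add: vimage_def continuous_intros)

lemma Ck_on_uncayley: "Ck_on k {M. invertible (M + mat 1)} uncayley"
proof -
  let ?S = "{M :: complex^'a^'a. invertible (M + mat 1)}"
  have S: "open ?S" by (rule open_uncayley_domain)
  have A: "Ck_on k ?S (\<lambda>M. M + c)" for c
    by (rule Ck_on_add[OF S Ck_on_bounded_linear_id[OF bounded_linear_ident S] Ck_on_const])
  have "Ck_on k ?S (\<lambda>M. matrix_inv (M + mat 1))"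
    by (rule Ck_on_matrix_inv_compose[OF S A]) simp
  from Ck_on_bilinear[OF bounded_bilinear_matrix_mult S A[of "- mat 1"] this]
  show ?thesis by (simp add: uncayley_def[abs_def])
qed

lemma has_derivative_uncayley_1: "(uncayley has_derivative (\<lambda>H. (1/2) *\<^sub>R H)) (at (mat 1))"
proof -
  have inv: "matrix_inv (mat 1 + mat 1 :: complex^'a^'a) = (1/2) *\<^sub>R mat 1" "invertible (mat 1 + mat 1 :: complex^'a^'a)"
    using matrix_inv_unique[of "mat 1 + mat 1 :: complex^'a^'a" "(1/2) *\<^sub>R mat 1"]
    by (simp_all only: matrix_mult_simps matrix_mul_lid matrix_mul_rid scaleR_half_double simp_thms)
  have A: "((\<lambda>M :: complex^'a^'a. M + c) has_derivative (\<lambda>H. H)) (at M)" for c M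
    by (auto intro!: derivative_eq_intros)
  from has_derivative_matrix_mult[OF A[of "- mat 1"] has_derivative_matrix_inv[OF A inv(2)]]
  show ?thesis
    by (simp only: uncayley_def[abs_def] diff_conv_add_uminus add.right_inverse times0_left add_0 inv(1)
        matrix_mult_simps(8) matrix_mul_rid)
qed

text \<open>At \<open>P = proj_matrix q\<close> this is \<open>r ** \<sigma> r\<inverse>\<close> for \<open>r = adj q0 ** q\<close> and the involution \<open>\<sigma>\<close>. Its
  inverse Cayley transform is the affine coordinate of \<open>coset q\<close> centred at \<open>q0\<close>, that is, the
  quaternionic subspace \<open>P\<close> written as a graph.\<close>

definition transvection :: "('m::finite, 'n::finite) cmat \<Rightarrow> ('m, 'n) cmat \<Rightarrow> ('m, 'n) cmat" where
  "transvection q0 P = adj q0 ** P ** q0 ** I_hat"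

lemma bounded_linear_transvection: "bounded_linear (transvection q0)"
  unfolding transvection_def[abs_def]
  by (intro bounded_linear_compose[OF bounded_linear_matrix_mult_left] bounded_linear_matrix_mult_right)

lemma transvection_props:
  fixes q0 q :: "('m::finite, 'n::finite) cmat"
  assumes q: "q0 \<in> Sp" "q \<in> Sp"
  defines "M \<equiv> transvection q0 (proj_matrix q)"
  shows "unitary M" "quaternionic M" "I_hat ** M ** I_hat = adj M" "q0 ** M ** I_hat ** adj q0 = proj_matrix q"
proof -
  have u: "unitary q0" "unitary q" using q by (auto simp: Sp_iff)
  show "unitary M" unfolding M_def transvection_def proj_matrix_def
    by (intro unitary_mult unitary_adj u unitary_I_hat)
  show "quaternionic M" using q unfolding M_def transvection_def proj_matrix_def
    by (intro quaternionic_mult quaternionic_adj quaternionic_I_hat) (auto simp: Sp_iff)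
  have E2: "A ** I_hat ** I_hat = A" for A :: "('m, 'n) cmat" by (simp add: matrix_mul_assoc[symmetric])
  show "I_hat ** M ** I_hat = adj M" by (simp add: M_def transvection_def adj_proj_matrix matrix_mul_assoc E2)
  show "q0 ** M ** I_hat ** adj q0 = proj_matrix q"
    by (simp add: M_def transvection_def matrix_mul_assoc E2 unitary_cancel[OF u(1)])
qed

lemma uncayley_transvection:
  assumes q: "q0 \<in> Sp" "q \<in> Sp" and inv: "invertible (transvection q0 (proj_matrix q) + mat 1)"
  shows "uncayley (transvection q0 (proj_matrix q)) \<in> lie_p"
    "cayley (uncayley (transvection q0 (proj_matrix q))) = transvection q0 (proj_matrix q)"
proof -
  let ?M = "transvection q0 (proj_matrix q)"
  note M = transvection_props[OF q]
  show "cayley (uncayley ?M) = ?M" by (rule cayley_uncayley[OF M(1) inv])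
  have "quaternionic (uncayley ?M)"
    unfolding uncayley_def
    by (intro quaternionic_mult quaternionic_diff quaternionic_matrix_inv quaternionic_add quaternionic_1 M(2) inv)
  moreover have "I_hat ** uncayley ?M ** I_hat = - uncayley ?M"
    by (simp only: uncayley_conjugate[OF I_hat_simps(1) inv] M(3) adj_uncayley(2)[OF M(1) inv])
  ultimately show "uncayley ?M \<in> lie_p"
    using adj_uncayley(1)[OF M(1) inv] by (simp add: lie_p_def lie_sp_def)
qed

text \<open>The point \<open>q0 ** cayley Y\<close> has affine coordinate \<open>uncayley (cayley Y ** cayley Y)\<close>, so every small
  coordinate is attained and no square root of a matrix is needed.\<close>

lemma uncayley_square_open:
  fixes f :: "real^('m::finite \<times> 'n::finite \<times> 4) \<Rightarrow> real^('m \<times> 'n \<times> 4)"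
  defines "f y \<equiv> lie_p_coords (uncayley (cayley (lie_p_of y) ** cayley (lie_p_of y)))"
    and "S \<equiv> {y :: real^('m \<times> 'n \<times> 4). invertible (cayley (lie_p_of y) ** cayley (lie_p_of y) + mat 1)}"
  shows "0 \<in> interior (f ` S)"
proof -
  let ?c = "\<lambda>y :: real^('m \<times> 'n \<times> 4). cayley (lie_p_of y)"
  have skew: "adj (lie_p_of u) = - lie_p_of u" for u :: "real^('m \<times> 'n \<times> 4)"
    using lie_p_of_in_lie_p[of u] by (auto simp: lie_p_def lie_sp_def)
  have "open {Z :: ('m, 'n) cmat. invertible (mat 1 - Z)}"
    using open_vimage[OF open_invertible, of "\<lambda>Z :: ('m, 'n) cmat. mat 1 - Z"]
    by (simp add: vimage_def continuous_intros)
  then have "Ck_on 0 UNIV ?c"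
    by (rule Ck_on_compose[OF open_UNIV _ _ Ck_on_cayley Ck_on_bounded_linear_id[OF bounded_linear_lie_p_of open_UNIV]])
      (auto simp: skew invertible_1_minus_skew)
  then have sq: "continuous_on UNIV (\<lambda>y. ?c y ** ?c y)"
    by (intro bounded_bilinear.continuous_on[OF bounded_bilinear_matrix_mult]) simp_all
  have S: "open S"
    using open_vimage[OF open_uncayley_domain sq] by (simp add: S_def vimage_def)
  have c0: "?c 0 = mat 1" by (simp add: linear_0[OF linear_lie_p_of] cayley_0)
  have inv: "invertible (mat 1 + mat 1 :: ('m, 'n) cmat)"
    using matrix_inv_unique(2)[of "mat 1 + mat 1 :: ('m, 'n) cmat" "(1/2) *\<^sub>R mat 1"]
    by (simp only: matrix_mult_simps matrix_mul_lid matrix_mul_rid scaleR_half_double simp_thms)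
  have S0: "0 \<in> S" unfolding S_def mem_Collect_eq c0 matrix_mul_lid by (rule inv)
  have f0: "f 0 = 0" by (simp add: f_def c0 uncayley_def linear_0[OF linear_lie_p_coords])
  have cont: "continuous_on S f"
    unfolding f_def
    by (intro bounded_linear.continuous_on[OF bounded_linear_lie_p_coords]
        continuous_on_compose2[OF Ck_on_continuous[OF Ck_on_uncayley]] continuous_on_subset[OF sq]) (auto simp: S_def)
  have c': "(?c has_derivative (\<lambda>h. lie_p_of h + lie_p_of h)) (at 0)"
  proof -
    have "(cayley has_derivative (\<lambda>H. H + H)) (at (lie_p_of (0 :: real^('m \<times> 'n \<times> 4))))"
      using has_derivative_cayley_0 by (simp only: linear_0[OF linear_lie_p_of])
    then show ?thesis
      by (rule has_derivative_compose[OF bounded_linear_imp_has_derivative[OF bounded_linear_lie_p_of]])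
  qed
  have sq': "((\<lambda>y. ?c y ** ?c y) has_derivative (\<lambda>h. (lie_p_of h + lie_p_of h) + (lie_p_of h + lie_p_of h))) (at 0)"
    using has_derivative_matrix_mult[OF c' c'] by (simp only: c0 matrix_mul_lid matrix_mul_rid)
  have "(uncayley has_derivative (\<lambda>H. (1/2) *\<^sub>R H)) (at (?c 0 ** ?c 0))"
    using has_derivative_uncayley_1 by (simp only: c0 matrix_mul_lid)
  \<comment> \<open>The Cayley transform contributes a factor 2, squaring another 2, and
    \<open>uncayley\<close> at the identity 1/2, so the differential at 0 is twice the identity. Its
    invertibility at this one point, together with continuity, is what the open mapping theorem
    below asks for.\<close>
  from bounded_linear.has_derivative[OF bounded_linear_lie_p_coords has_derivative_compose[OF sq' this]]
  have f': "(f has_derivative (\<lambda>h. h + h)) (at 0)"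
    unfolding f_def by (simp only: scaleR_half_double linear_add[OF linear_lie_p_coords] lie_p_coords_of)
  have "f 0 \<in> interior (f ` S)"
  proof (rule sussmann_open_mapping[OF S cont S0 f'])
    show "bounded_linear (\<lambda>h :: real^('m \<times> 'n \<times> 4). (1/2) *\<^sub>R h)" by (rule bounded_linear_scaleR_right)
    show "(\<lambda>h :: real^('m \<times> 'n \<times> 4). h + h) \<circ> (\<lambda>h. (1/2) *\<^sub>R h) = id"
      by (simp only: fun_eq_iff o_apply id_apply scaleR_add_right[symmetric] scaleR_half_double simp_thms)
  qed (use S S0 in \<open>auto simp: interior_open\<close>)
  then show ?thesis by (simp only: f0)
qed

theorem chart_exists:
  fixes q0 :: "('m::finite, 'n::finite) cmat"
  assumes q0: "q0 \<in> Sp"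
  obtains U x where "(U, x) \<in> grassmannian_charts" "coset q0 \<in> U"
proof -
  let ?M = "\<lambda>q. transvection q0 (proj_matrix q)"
  let ?c = "\<lambda>y :: real^('m \<times> 'n \<times> 4). cayley (lie_p_of y)"
  define f where "f y = lie_p_coords (uncayley (?c y ** ?c y))" for y
  define S where "S = {y. invertible (?c y ** ?c y + mat 1)}"
  \<comment> \<open>Passing to the interior of the attained coordinates makes the image of the chart
    open by construction; that 0 survives is the content of
    \<open>uncayley_square_open\<close>.\<close>
  define V where "V = interior (f ` S)"
  have V: "open V" "0 \<in> V" using uncayley_square_open unfolding V_def f_def S_def by auto
  define h where "h q = lie_p_coords (uncayley (?M q))" for q
  define T where "T = {q. invertible (?M q + mat 1)}"
  define x where "x P = lie_p_coords (uncayley (transvection q0 (proj_of_coset P)))" for P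
  define U where "U = {P \<in> coset ` Sp. invertible (transvection q0 (proj_of_coset P) + mat 1) \<and> x P \<in> V}"
  have x_coset: "x (coset q) = h q" for q by (simp add: x_def h_def proj_of_coset)
  have U_coset: "coset q \<in> U \<longleftrightarrow> q \<in> T \<and> h q \<in> V" if "q \<in> Sp" for q
    using that by (auto simp: U_def T_def x_coset proj_of_coset)
  have CkM: "Ck_on k UNIV ?M" for k
    unfolding proj_matrix_def
    by (intro Ck_on_bounded_linear[OF bounded_linear_transvection open_UNIV] Ck_on_bilinear[OF bounded_bilinear_matrix_mult open_UNIV]
        Ck_on_const Ck_on_bounded_linear_id open_UNIV bounded_linear_adj bounded_linear_ident)
  have T: "open T"
    using open_vimage[OF open_uncayley_domain Ck_on_continuous[OF CkM]] by (simp add: T_def vimage_def)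
  have Ckh: "Ck_on k T h" for k
    unfolding h_def
    by (rule Ck_on_bounded_linear[OF bounded_linear_lie_p_coords T Ck_on_compose[OF T open_uncayley_domain _ Ck_on_uncayley Ck_on_mono[OF subset_UNIV CkM]]])
      (auto simp: T_def)
  have cayley_h: "cayley (lie_p_of (h q)) = ?M q" if "q \<in> Sp" "q \<in> T" for q
    using uncayley_transvection[OF q0 that(1)] that(2) by (simp add: h_def T_def lie_p_of_coords)
  \<comment> \<open>Recovers the reflection from the affine coordinate. This inverse yields
    injectivity of \<open>x\<close> and, through its derivative, the submersion condition.\<close>
  define G where "G v = q0 ** cayley (lie_p_of v) ** I_hat ** adj q0" for v
  have G_eq: "G (x (coset q)) = proj_matrix q" if "q \<in> Sp" "coset q \<in> U" for q
    using that transvection_props(4)[OF q0 that(1)] by (simp add: G_def x_coset cayley_h U_coset)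
  have preimage: "{q \<in> Sp. coset q \<in> U} = Sp \<inter> (T \<inter> h -` V)" using U_coset by auto
  have open_TV: "open (T \<inter> h -` V)"
    using continuous_open_preimage[OF Ck_on_continuous[OF Ckh] T V(1)] .
  have image: "x ` U = V"
  proof (intro equalityI subsetI)
    fix v assume "v \<in> V"
    then obtain y where y: "y \<in> S" "v = f y" using interior_subset by (auto simp: V_def)
    have Z: "lie_p_of y \<in> lie_p" "lie_p_of y \<in> lie_sp" "adj (lie_p_of y) = - lie_p_of y" "I_hat ** lie_p_of y ** I_hat = - lie_p_of y"
      using lie_p_of_in_lie_p[of y] by (auto simp: lie_p_def lie_sp_def)
    \<comment> \<open>The representative over \<open>v\<close>: conjugation by \<open>I_hat\<close>
      inverts the Cayley transform of an element of \<open>lie_p\<close>, so the transvection of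
      this point is the square \<open>?c y ** ?c y\<close>.\<close>
    define q where "q = q0 ** ?c y"
    have q: "q \<in> Sp" using Sp_mult[OF q0 Sp_cayley[OF Z(2), of 1]] by (simp add: q_def)
    have u: "unitary q0" using q0 by (simp add: Sp_iff)
    have "I_hat ** adj (?c y) ** I_hat = ?c y"
      using cayley_conjugate[of I_hat "- lie_p_of y"] invertible_1_plus_skew[OF Z(3)] Z(4)
      by (simp add: adj_cayley[OF Z(3)] matrix_mult_simps)
    moreover have "?M q = ?c y ** (I_hat ** adj (?c y) ** I_hat)"
      by (simp add: transvection_def proj_matrix_def q_def matrix_mul_assoc unitary_cancel[OF u])
    ultimately have M: "?M q = ?c y ** ?c y" by simp
    then have "q \<in> T" "h q = v" using y by (simp_all add: T_def S_def h_def f_def)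
    then have "coset q \<in> U" "x (coset q) = v" using U_coset[OF q] x_coset \<open>v \<in> V\<close> by auto
    then show "v \<in> x ` U" by blast
  qed (auto simp: U_def)
  interpret grassmannian_prechart U x
  proof
    show "U \<subseteq> coset ` Sp" by (auto simp: U_def)
    show "openin (top_of_set Sp) {q \<in> Sp. coset q \<in> U}" unfolding preimage using open_TV by (simp add: openin_open_Int)
    show "open (x ` U)" using image V by simp
    show "inj_on x U"
    proof (rule inj_onI)
      fix P Q assume PQ: "P \<in> U" "Q \<in> U" "x P = x Q"
      then obtain p q where pq: "p \<in> Sp" "P = coset p" "q \<in> Sp" "Q = coset q" by (auto simp: U_def)
      then have "proj_matrix p = proj_matrix q" using PQ G_eq[of p] G_eq[of q] by simp
      then show "P = Q" using proj_matrix_eq_iff[OF pq(1,3)] pq by simp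
    qed
    show "smooth_on_subset {q \<in> Sp. coset q \<in> U} (x \<circ> coset)"
      unfolding smooth_on_subset_def smooth_on_def
    proof
      fix q assume "q \<in> {q \<in> Sp. coset q \<in> U}"
      then have "q \<in> T" using U_coset by blast
      then show "\<exists>V F. open V \<and> q \<in> V \<and> (\<forall>k. Ck_on k V F) \<and> (\<forall>y\<in>{q \<in> Sp. coset q \<in> U} \<inter> V. F y = (x \<circ> coset) y)"
        using T Ckh x_coset by (intro exI[of _ T] exI[of _ h]) simp
    qed
  qed
  \<comment> \<open>Injectivity on \<open>lie_p\<close> follows by applying the derivative of
    \<open>G\<close>, which turns a coordinate velocity back into the velocity of the reflection;
    equality of dimensions then gives surjectivity.\<close>
  have "coset_diff x q ` tangent_space_at Sp q = UNIV" if q: "q \<in> Sp" "coset q \<in> U" for q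
  proof -
    have u: "unitary q0" "unitary q" using q q0 by (auto simp: Sp_iff)
    let ?h = "\<lambda>v. coset_diff x q (q ** lie_p_of v)"
    have lin: "linear ?h"
      using linear_compose[OF linear_compose[OF linear_lie_p_of bounded_linear.linear[OF bounded_linear_matrix_mult_right]]
        linear_coset_diff[OF q]] by (simp add: o_def)
    have skew: "adj (lie_p_of v) = - lie_p_of v" for v :: "real^('m \<times> 'n \<times> 4)"
      using lie_p_of_in_lie_p[of v] by (auto simp: lie_p_def lie_sp_def)
    have "open {Z :: ('m, 'n) cmat. invertible (mat 1 - Z)}"
      using open_vimage[OF open_invertible, of "\<lambda>Z :: ('m, 'n) cmat. mat 1 - Z"]
      by (simp add: vimage_def continuous_intros)
    then have "Ck_on (Suc 0) UNIV ?c"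
      by (rule Ck_on_compose[OF open_UNIV _ _ Ck_on_cayley Ck_on_bounded_linear_id[OF bounded_linear_lie_p_of open_UNIV]])
        (auto simp: skew invertible_1_minus_skew)
    then have "Ck_on (Suc 0) UNIV G"
      unfolding G_def[abs_def] by (intro Ck_on_bilinear[OF bounded_bilinear_matrix_mult open_UNIV] Ck_on_const)
    then have G: "(G has_derivative frechet_derivative G (at v)) (at v)" for v using Ck_on_differentiable by blast
    have "v = 0" if v: "?h v = 0" for v
    proof -
      have "frechet_derivative G (at (x (coset q))) (?h v) = q ** (lie_p_of v + lie_p_of v) ** I_hat ** adj q"
        by (rule derivative_horizontal[OF q lie_p_of_in_lie_p G G_eq])
      then have 0: "q ** (lie_p_of v + lie_p_of v) ** I_hat ** adj q = 0"
        using v linear_0[OF has_derivative_linear[OF G]] by simp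
      have "lie_p_of v + lie_p_of v = adj q ** (q ** (lie_p_of v + lie_p_of v) ** I_hat ** adj q) ** q ** I_hat"
        by (simp only: matrix_mul_assoc unitary_cancel[OF u(2)] matrix_mul_lid)
          (simp only: matrix_mul_assoc[symmetric] I_hat_simps matrix_mul_rid)
      also have "\<dots> = 0" by (simp only: 0 times0_left times0_right)
      finally have "lie_p_of v = 0" by (metis scaleR_half_double scaleR_zero_right)
      then have "lie_p_coords (lie_p_of v) = 0" by (simp only: linear_0[OF linear_lie_p_coords])
      then show "v = 0" by simp
    qed
    then have "inj ?h" using linear_injective_0[OF lin] by blast
    then have "surj ?h" using linear_injective_imp_surjective[OF lin] by simp
    moreover have "q ** lie_p_of v \<in> tangent_space_at Sp q" for v
      using lie_p_of_in_lie_p[of v] by (auto simp: tangent_space_Sp[OF q(1)] lie_p_def)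
    ultimately show ?thesis by (auto simp: surj_def image_iff)
  qed
  then have "grassmannian_chart U x" by unfold_locales
  moreover have "coset q0 \<in> U"
  proof -
    have u: "unitary q0" using q0 by (simp add: Sp_iff)
    have M: "?M q0 = mat 1" by (simp add: transvection_def proj_matrix_def matrix_mul_assoc unitary_cancel[OF u])
    have "invertible (mat 1 + mat 1 :: ('m, 'n) cmat)"
      using matrix_inv_unique(2)[of "mat 1 + mat 1 :: ('m, 'n) cmat" "(1/2) *\<^sub>R mat 1"]
      by (simp only: matrix_mult_simps matrix_mul_lid matrix_mul_rid scaleR_half_double simp_thms)
    then have "q0 \<in> T" unfolding T_def mem_Collect_eq M .
    moreover have "h q0 = 0" unfolding h_def M by (simp add: uncayley_def linear_0[OF linear_lie_p_coords])
    ultimately show ?thesis using V(2) U_coset[OF q0] by simp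
  qed
  ultimately show thesis using that grassmannian_chart_iff by blast
qed

theorem theorem8p2:
  fixes \<alpha> :: "('m::finite, 'n::finite) index"
  shows "eigenfamily (quaternionic_grassmannian :: (('m, 'n) cmat set, 'm \<times> 'n \<times> 4) riem_manifold)
           (- 2 * (of_nat CARD('m) + of_nat CARD('n))) (- 1)
           {psi j \<alpha> | j. j \<noteq> \<alpha>}"
proof -
  let ?M = "quaternionic_grassmannian :: (('m, 'n) cmat set, 'm \<times> 'n \<times> 4) riem_manifold"
  have chart: "grassmannian_chart U x" if "(U, x) \<in> charts ?M" for U x
    using that by (simp add: quaternionic_grassmannian_def grassmannian_chart_iff)
  \<comment> \<open>The \<open>SOME\<close> in \<open>chart_at\<close> can be trusted only once a
    chart around \<open>P\<close> is known to exist; nothing else about the chosen chart is known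
    afterwards, so the preceding results are stated for every chart.\<close>
  have at: "\<exists>U x. chart_at ?M P = (U, x) \<and> P \<in> U \<and> grassmannian_chart U x" if P: "P \<in> points ?M" for P
  proof -
    obtain q where q: "q \<in> Sp" "P = coset q" using P by (auto simp: quaternionic_grassmannian_def)
    obtain U x where "(U, x) \<in> charts ?M" "P \<in> U"
      using chart_exists[OF q(1)] q(2) by (auto simp: quaternionic_grassmannian_def)
    then have "(U, x) \<in> charts ?M \<and> P \<in> fst (U, x)" by simp
    then have "chart_at ?M P \<in> charts ?M \<and> P \<in> fst (chart_at ?M P)"
      unfolding chart_at_def by (rule someI)
    moreover obtain U' x' where "chart_at ?M P = (U', x')" by (rule prod.exhaust)
    ultimately show ?thesis using chart[of U' x'] by simp
  qed
  have "smooth_function ?M (psi j \<alpha>)" for j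
    unfolding smooth_function_def using grassmannian_chart.smooth_psi[OF chart] by auto
  moreover have "tension ?M (psi j \<alpha>) P = - 2 * (of_nat CARD('m) + of_nat CARD('n)) * psi j \<alpha> P"
    if "j \<noteq> \<alpha>" and P: "P \<in> points ?M" for j P
  proof -
    obtain U x where U: "chart_at ?M P = (U, x)" "P \<in> U" "grassmannian_chart U x" using at[OF P] by blast
    \<comment> \<open>The index type has 2(m + n) elements, which gives the eigenvalue its stated
      form.\<close>
    show ?thesis
      using grassmannian_chart.divergence_psi[OF U(3,2) that(1)] by (simp add: tension_def U(1))
  qed
  moreover have "conformality ?M (psi j \<alpha>) (psi k \<alpha>) P = - 1 * psi j \<alpha> P * psi k \<alpha> P"
    if "j \<noteq> \<alpha>" "k \<noteq> \<alpha>" and P: "P \<in> points ?M" for j k P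
  proof -
    obtain U x where U: "chart_at ?M P = (U, x)" "P \<in> U" "grassmannian_chart U x" using at[OF P] by blast
    show ?thesis
      using grassmannian_chart.conformality_psi[OF U(3,2) that(1,2)] by (simp add: conformality_def U(1))
  qed
  ultimately show ?thesis unfolding eigenfamily_def by blast
qed

end
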